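(* Let $p$ be a prime. For any $\beta\in D_p$, $\beta\neq1$, and any field embedding $\rho:\mathbb Q^{{\rm cyc},p}\hookrightarrow\mathbb C_p$, the linear form $\varphi_{\beta,\rho}$ fulfills the KMS$_\beta$ condition $$\varphi_{\beta,\rho}(x\,\sigma^{(\beta)}(y))=\varphi_{\beta,\rho}(y\,x)\qquad\forall x,y\in\mathcal H_{\mathbb C_p}^{(p)}.$$ Moreover the partition function is the $p$-adic $L$-function $$Z(\beta):=\varphi_{\beta,\rho}(1)=L_p(\beta,1),$$ which does not vanish for $\beta\in D_p$.
   Context: Let $p$ be a prime, $q=4$ if $p=2$ and $q=p$ if $p\ne2$; $\mathbb C_p$ is the completion of an algebraic closure of $\mathbb Q_p$, with $|p|_p=p^{-1}$. $\mathbb N$ denotes the positive integers and $I(p)$ the positive integers prime to $p$. Let $D_p=\{\beta\in\mathbb C_p\mid|\beta|_p<q\,p^{-1/(p-1)}\}$. $\log_p$ is the Iwasawa logarithm on $\mathbb C_p^\times$ ($\log_p(p)=0$), $\exp$ the $p$-adic exponential. For $r\in\mathbb Z_{(p)}^\times$ (rationals with numerator and denominator prime to $p$) and $s\in D_p$ put $\langle r\rangle^s=\exp(s\log_p r)$, and for $\beta\in D_p$ put $r^{(\beta)}=r\exp((\beta-1)\log_p r)$. \textbf{The algebra.} $(\mathbb Q/\mathbb Z)^{(p)}$ is the group of fractions mod $1$ with denominator prime to $p$. $\mathcal H_{\mathbb Z}^{(p)}$ is the ring generated by $\mathbb Z[(\mathbb Q/\mathbb Z)^{(p)}]$ (generators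 $e(\gamma)$) and $\tilde\mu_n,\mu_n^*$ ($n\in I(p)$), with relations, for $n,m\in I(p)$, $x\in\mathbb Z[(\mathbb Q/\mathbb Z)^{(p)}]$: $\tilde\mu_{nm}=\tilde\mu_n\tilde\mu_m$, $\mu_{nm}^*=\mu_n^*\mu_m^*$, $\mu_n^*\tilde\mu_n=n$, $\tilde\mu_n\mu_m^*=\mu_m^*\tilde\mu_n$ if $\gcd(n,m)=1$, $\tilde\mu_n x\mu_n^*=\tilde\rho_n(x)$, $\mu_n^*x=\sigma_n(x)\mu_n^*$, $x\tilde\mu_n=\tilde\mu_n\sigma_n(x)$, where $\sigma_n(e(\gamma))=e(n\gamma)$ and $\tilde\rho_n(e(\gamma))=\sum_{\gamma'\in(\mathbb Q/\mathbb Z)^{(p)},\,n\gamma'=\gamma}e(\gamma')$. $\mathcal H_{\mathbb C_p}^{(p)}=\mathcal H_{\mathbb Z}^{(p)}\otimes_{\mathbb Z}\mathbb C_p$. For $\beta\in D_p$, $\sigma^{(\beta)}$ is the unique automorphism of $\mathcal H_{\mathbb C_p}^{(p)}$ with $\sigma^{(\beta)}(\tilde\mu_ae(\gamma)\mu_b^* )=\left(\frac ba\right)^{(\beta)}\tilde\mu_ae(\gamma)\mu_b^*$ for all $a,b\in I(p)$, $\gamma\in(\mathbb Q/\mathbb Z)^{(p)}$. \textbf{The linear forms.} $\mathbb Q^{{\rm cyc},p}$ is the field generated over $\mathbb Q$ by the roots of unity $\zeta_\gamma$, $\gamma\in(\mathbb Q/\mathbb Z)^{(p)}$ ($\zeta_\gamma\zeta_{\gamma'}=\zeta_{\gamma+\gamma'}$,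 $\zeta_\gamma$ of order the denominator of $\gamma$). $B_j$ are the Bernoulli numbers, $\frac{t}{e^t-1}=\sum B_jt^j/j!$. For $b\in I(p)$, $a\in\mathbb Z$, and $f\in\mathbb N$ any multiple of $bq$, set $$Z_\rho\left(\tfrac ab,\beta\right)=\frac1f\sum_{1\le c<f,\ p\nmid c}\rho(\zeta_{a/b}^c)\,\frac{\langle c\rangle^{1-\beta}}{\beta-1}\sum_{j=0}^\infty\binom{1-\beta}{j}\left(\frac fc\right)^jB_j ;$$ this is a meromorphic function on $D_p$, independent of the choice of $f$, with at most a pole at $\beta=1$. $\varphi_{\beta,\rho}$ is the linear form on $\mathcal H_{\mathbb Z}^{(p)}$ (extended $\mathbb C_p$-linearly to $\mathcal H_{\mathbb C_p}^{(p)}$) with, for $n,m\in I(p)$ relatively prime, $\varphi_{\beta,\rho}(\tilde\mu_ne(\frac ab)\mu_m^* )=Z_\rho(\frac ab,\beta)$ if $n=m=1$ and $0$ otherwise. $L_p(\beta,\chi)$ denotes the Kubota–Leopoldt $p$-adic $L$-function; for the trivial character, $L_p(\beta,1)=\frac1q\sum_{1\le c<q,\ p\nmid c}\frac{\langle c\rangle^{1-\beta}}{\beta-1}\sum_{j\ge0}\binom{1-\beta}{j}(q/c)^jB_j$. *)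

theory Defs
  imports
    "HOL-Analysis.Analysis"
    "HOL-Algebra.QuotRing"
    "HOL-Computational_Algebra.Formal_Power_Series"
    "HOL-Computational_Algebra.Polynomial"
    "HOL-Library.Poly_Mapping"
begin

section \<open>The field of p-adic complex numbers\<close>

class complete_ultrametric_field = field_char_0 + complete_space +
  fixes vabs :: "'a \<Rightarrow> real"
  assumes dist_vabs: "dist x y = vabs (x - y)"
    and vabs_mult: "vabs (x * y) = vabs x * vabs y"
    and vabs_ultrametric: "vabs (x + y) \<le> max (vabs x) (vabs y)"

text \<open>
  The predicate \<open>is_Cp\<close> says that such a field is the completion of an algebraic closure of the
  field of p-adic numbers, with \<^term>\<open>vabs\<close> as the normalised absolute value.  The p-adic numbers
  are the closure (= completion) of the rationals in \<^typ>\<open>'c\<close>: the class axioms and the value at p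
  determine the restriction of \<^term>\<open>vabs\<close> to the rationals.
\<close>

definition Qp :: "'c::complete_ultrametric_field set" where
  "Qp = closure (range of_rat)"

definition Qp_alg :: "'c::complete_ultrametric_field set" where
  "Qp_alg = {x. \<exists>f. f \<noteq> 0 \<and> (\<forall>i. poly.coeff f i \<in> Qp) \<and> poly f x = 0}"

definition is_Cp :: "nat \<Rightarrow> 'c::complete_ultrametric_field itself \<Rightarrow> bool" where
  "is_Cp p C \<longleftrightarrow>
     prime p
   \<and> vabs (of_nat p :: 'c) = 1 / real p
   \<and> (\<forall>f :: 'c poly. (\<forall>i. poly.coeff f i \<in> Qp_alg) \<and> Polynomial.degree f > 0
        \<longrightarrow> (\<exists>x \<in> Qp_alg. poly f x = 0))
   \<and> closure (Qp_alg :: 'c set) = UNIV"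


section \<open>Logarithm, exponential and powers\<close>

definition pq :: "nat \<Rightarrow> nat" where
  "pq p = (if p = 2 then 4 else p)"

definition padic_disc :: "nat \<Rightarrow> 'c::complete_ultrametric_field set" where
  "padic_disc p = {\<beta>. vabs \<beta> < real (pq p) * real p powr (- 1 / (real p - 1))}"

definition padic_exp :: "'c::complete_ultrametric_field \<Rightarrow> 'c" where
  "padic_exp x = suminf (\<lambda>n. x ^ n / fact n)"

text \<open>The value at 0, which is immaterial, is fixed to make the description unique.\<close>

definition iwasawa_log :: "nat \<Rightarrow> 'c::complete_ultrametric_field \<Rightarrow> 'c" where
  "iwasawa_log p = (THE L. L 0 = 0
     \<and> (\<forall>x y. x \<noteq> 0 \<longrightarrow> y \<noteq> 0 \<longrightarrow> L (x * y) = L x + L y)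
     \<and> (\<forall>x. vabs x < 1 \<longrightarrow> (\<lambda>n. (- 1) ^ n * x ^ Suc n / of_nat (Suc n)) sums L (1 + x))
     \<and> L (of_nat p) = 0)"

text \<open>\<open>ang_pow p r s\<close> is the s-th power of the bracket of r, and \<open>rat_pow p r \<beta>\<close> is the
  expression written r with upper index \<open>(\<beta>)\<close>.\<close>

definition ang_pow :: "nat \<Rightarrow> rat \<Rightarrow> 'c::complete_ultrametric_field \<Rightarrow> 'c" where
  "ang_pow p r s = padic_exp (s * iwasawa_log p (of_rat r))"

definition rat_pow :: "nat \<Rightarrow> rat \<Rightarrow> 'c::complete_ultrametric_field \<Rightarrow> 'c" where
  "rat_pow p r \<beta> = of_rat r * padic_exp ((\<beta> - 1) * iwasawa_log p (of_rat r))"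


section \<open>The index sets\<close>

definition Ip :: "nat \<Rightarrow> nat set" where
  "Ip p = {n. n > 0 \<and> coprime n p}"

text \<open>The prime-to-p part of the rationals modulo 1, by representatives in [0,1);
  the group law is addition followed by \<^const>\<open>frac\<close>.\<close>

definition QZp :: "nat \<Rightarrow> rat set" where
  "QZp p = {\<gamma>. 0 \<le> \<gamma> \<and> \<gamma> < 1 \<and> (\<exists>a. \<exists>b \<in> Ip p. \<gamma> = of_int a / of_nat b)}"


section \<open>The algebra\<close>

datatype bc_gen = Gen_e rat | Gen_mu nat | Gen_mustar nat

text \<open>Words in the generators form the free monoid, written additively in order that finitely
  supported functions on words, with the convolution product of
  \<^theory>\<open>HOL-Library.Poly_Mapping\<close>, form the free associative algebra.\<close>

datatype bc_word = Word (letters: "bc_gen list")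

instantiation bc_word :: monoid_add
begin

definition zero_bc_word :: bc_word where "0 = Word []"

definition plus_bc_word :: "bc_word \<Rightarrow> bc_word \<Rightarrow> bc_word" where
  "v + w = Word (letters v @ letters w)"

instance by standard (simp_all add: zero_bc_word_def plus_bc_word_def)

end

definition bc_gens :: "nat \<Rightarrow> bc_gen set" where
  "bc_gens p = Gen_e ` QZp p \<union> Gen_mu ` Ip p \<union> Gen_mustar ` Ip p"

definition bc_free :: "nat \<Rightarrow> (bc_word \<Rightarrow>\<^sub>0 'r::comm_ring_1) ring" where
  "bc_free p = \<lparr>carrier = {x. \<forall>w \<in> Poly_Mapping.keys x. set (letters w) \<subseteq> bc_gens p},
     mult = (*), one = 1, zero = 0, add = (+)\<rparr>"

definition bc_const :: "'r::comm_ring_1 \<Rightarrow> bc_word \<Rightarrow>\<^sub>0 'r" where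
  "bc_const c = Poly_Mapping.single 0 c"

definition bc_e :: "rat \<Rightarrow> bc_word \<Rightarrow>\<^sub>0 'r::comm_ring_1" where
  "bc_e \<gamma> = Poly_Mapping.single (Word [Gen_e \<gamma>]) 1"

definition bc_mu :: "nat \<Rightarrow> bc_word \<Rightarrow>\<^sub>0 'r::comm_ring_1" where
  "bc_mu n = Poly_Mapping.single (Word [Gen_mu n]) 1"

definition bc_mustar :: "nat \<Rightarrow> bc_word \<Rightarrow>\<^sub>0 'r::comm_ring_1" where
  "bc_mustar n = Poly_Mapping.single (Word [Gen_mustar n]) 1"

text \<open>The defining relations, each given as the difference of its two sides.  The first two lines
  present the group ring.  The last three relations are linear in the group ring element x, and
  are imposed for \<open>x = e(\<gamma>)\<close>.\<close>

definition bc_relators :: "nat \<Rightarrow> (bc_word \<Rightarrow>\<^sub>0 'r::comm_ring_1) set" where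
  "bc_relators p =
     {bc_e 0 - 1}
   \<union> {bc_e \<gamma> * bc_e \<delta> - bc_e (frac (\<gamma> + \<delta>)) | \<gamma> \<delta>. \<gamma> \<in> QZp p \<and> \<delta> \<in> QZp p}
   \<union> {bc_mu (n * m) - bc_mu n * bc_mu m | n m. n \<in> Ip p \<and> m \<in> Ip p}
   \<union> {bc_mustar (n * m) - bc_mustar n * bc_mustar m | n m. n \<in> Ip p \<and> m \<in> Ip p}
   \<union> {bc_mustar n * bc_mu n - of_nat n | n. n \<in> Ip p}
   \<union> {bc_mu n * bc_mustar m - bc_mustar m * bc_mu n | n m. n \<in> Ip p \<and> m \<in> Ip p \<and> coprime n m}
   \<union> {bc_mu n * bc_e \<gamma> * bc_mustar n - (\<Sum>\<gamma>' \<in> {\<gamma>' \<in> QZp p. frac (of_nat n * \<gamma>') = \<gamma>}. bc_e \<gamma>')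
       | n \<gamma>. n \<in> Ip p \<and> \<gamma> \<in> QZp p}
   \<union> {bc_mustar n * bc_e \<gamma> - bc_e (frac (of_nat n * \<gamma>)) * bc_mustar n
       | n \<gamma>. n \<in> Ip p \<and> \<gamma> \<in> QZp p}
   \<union> {bc_e \<gamma> * bc_mu n - bc_mu n * bc_e (frac (of_nat n * \<gamma>))
       | n \<gamma>. n \<in> Ip p \<and> \<gamma> \<in> QZp p}"

definition bc_ideal :: "nat \<Rightarrow> (bc_word \<Rightarrow>\<^sub>0 'r::comm_ring_1) set" where
  "bc_ideal p = genideal (bc_free p) (bc_relators p)"

text \<open>For \<open>'r = int\<close> this is the integral algebra.  For general \<open>'r\<close> it is its base change to
  \<open>'r\<close>: tensoring a ring given by generators and relations with \<open>'r\<close> over the integers gives the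
  \<open>'r\<close>-algebra with the same presentation.\<close>

definition bc_algebra :: "nat \<Rightarrow> (bc_word \<Rightarrow>\<^sub>0 'r::comm_ring_1) set ring" where
  "bc_algebra p = bc_free p Quot bc_ideal p"

definition bc_cls :: "nat \<Rightarrow> (bc_word \<Rightarrow>\<^sub>0 'r::comm_ring_1) \<Rightarrow> (bc_word \<Rightarrow>\<^sub>0 'r) set" where
  "bc_cls p x = a_r_coset (bc_free p) (bc_ideal p) x"

definition bc_scale :: "nat \<Rightarrow> 'r::comm_ring_1 \<Rightarrow> (bc_word \<Rightarrow>\<^sub>0 'r) set \<Rightarrow> (bc_word \<Rightarrow>\<^sub>0 'r) set" where
  "bc_scale p c X = bc_cls p (bc_const c) \<otimes>\<^bsub>bc_algebra p\<^esub> X"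

definition bc_mon :: "nat \<Rightarrow> nat \<Rightarrow> rat \<Rightarrow> nat \<Rightarrow> (bc_word \<Rightarrow>\<^sub>0 'r::comm_ring_1) set" where
  "bc_mon p a \<gamma> b = bc_cls p (bc_mu a * bc_e \<gamma> * bc_mustar b)"

definition is_bc_sigma ::
  "nat \<Rightarrow> 'c::complete_ultrametric_field
    \<Rightarrow> ((bc_word \<Rightarrow>\<^sub>0 'c) set \<Rightarrow> (bc_word \<Rightarrow>\<^sub>0 'c) set) \<Rightarrow> bool" where
  "is_bc_sigma p \<beta> \<sigma> \<longleftrightarrow>
     \<sigma> \<in> ring_iso (bc_algebra p) (bc_algebra p)
   \<and> (\<forall>c. \<forall>x \<in> carrier (bc_algebra p). \<sigma> (bc_scale p c x) = bc_scale p c (\<sigma> x))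
   \<and> (\<forall>a \<in> Ip p. \<forall>b \<in> Ip p. \<forall>\<gamma> \<in> QZp p.
        \<sigma> (bc_mon p a \<gamma> b) = bc_scale p (rat_pow p (of_nat b / of_nat a) \<beta>) (bc_mon p a \<gamma> b))"

definition bc_sigma ::
  "nat \<Rightarrow> 'c::complete_ultrametric_field
    \<Rightarrow> (bc_word \<Rightarrow>\<^sub>0 'c) set \<Rightarrow> (bc_word \<Rightarrow>\<^sub>0 'c) set" where
  "bc_sigma p \<beta> = (THE \<sigma>. \<sigma> \<in> extensional (carrier (bc_algebra p)) \<and> is_bc_sigma p \<beta> \<sigma>)"


section \<open>The cyclotomic field and its embeddings\<close>

definition zeta_root :: "rat \<Rightarrow> complex" where
  "zeta_root \<gamma> = cis (2 * pi * of_rat \<gamma>)"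

definition Qcyc :: "nat \<Rightarrow> complex set" where
  "Qcyc p = \<Inter> {K. 1 \<in> K \<and> (\<forall>x \<in> K. \<forall>y \<in> K. x - y \<in> K \<and> x * y \<in> K) \<and> (\<forall>x \<in> K. inverse x \<in> K)
                 \<and> zeta_root ` QZp p \<subseteq> K}"

definition is_Qcyc_embedding :: "nat \<Rightarrow> (complex \<Rightarrow> 'c::field) \<Rightarrow> bool" where
  "is_Qcyc_embedding p \<rho> \<longleftrightarrow>
     \<rho> 1 = 1
   \<and> (\<forall>x \<in> Qcyc p. \<forall>y \<in> Qcyc p. \<rho> (x + y) = \<rho> x + \<rho> y \<and> \<rho> (x * y) = \<rho> x * \<rho> y)
   \<and> inj_on \<rho> (Qcyc p)"


section \<open>Zeta values and the linear forms\<close>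

definition bernoulli_num :: "nat \<Rightarrow> rat" where
  "bernoulli_num j = fact j * fps_nth (fps_X / (fps_exp 1 - 1)) j"

definition padic_zsum ::
  "nat \<Rightarrow> nat \<Rightarrow> (nat \<Rightarrow> 'c) \<Rightarrow> 'c::complete_ultrametric_field \<Rightarrow> 'c" where
  "padic_zsum p f w \<beta> = 1 / of_nat f *
     (\<Sum>c \<in> {c. 1 \<le> c \<and> c < f \<and> \<not> p dvd c}.
        w c * (ang_pow p (of_nat c) (1 - \<beta>) / (\<beta> - 1))
          * suminf (\<lambda>j. ((1 - \<beta>) gchoose j) * (of_nat f / of_nat c) ^ j * of_rat (bernoulli_num j)))"

text \<open>The common value for all presentations \<open>\<gamma> = a/b\<close> and all admissible f.\<close>

definition Z_rho ::
  "nat \<Rightarrow> (complex \<Rightarrow> 'c) \<Rightarrow> rat \<Rightarrow> 'c::complete_ultrametric_field \<Rightarrow> 'c" where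
  "Z_rho p \<rho> \<gamma> \<beta> = (THE z. \<forall>a. \<forall>b \<in> Ip p. \<forall>f > 0.
      \<gamma> = of_int a / of_nat b \<and> b * pq p dvd f
        \<longrightarrow> z = padic_zsum p f (\<lambda>c. \<rho> (zeta_root (of_int a / of_nat b) ^ c)) \<beta>)"

definition Lp_trivial :: "nat \<Rightarrow> 'c::complete_ultrametric_field \<Rightarrow> 'c" where
  "Lp_trivial p \<beta> = padic_zsum p (pq p) (\<lambda>c. 1) \<beta>"

definition is_kms_form ::
  "nat \<Rightarrow> (complex \<Rightarrow> 'c) \<Rightarrow> 'c::complete_ultrametric_field
    \<Rightarrow> ((bc_word \<Rightarrow>\<^sub>0 'c) set \<Rightarrow> 'c) \<Rightarrow> bool" where
  "is_kms_form p \<rho> \<beta> \<phi> \<longleftrightarrow>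
     (\<forall>x \<in> carrier (bc_algebra p). \<forall>y \<in> carrier (bc_algebra p).
        \<phi> (x \<oplus>\<^bsub>bc_algebra p\<^esub> y) = \<phi> x + \<phi> y)
   \<and> (\<forall>c. \<forall>x \<in> carrier (bc_algebra p). \<phi> (bc_scale p c x) = c * \<phi> x)
   \<and> (\<forall>n \<in> Ip p. \<forall>m \<in> Ip p. \<forall>\<gamma> \<in> QZp p. coprime n m \<longrightarrow>
        \<phi> (bc_mon p n \<gamma> m) = (if n = 1 \<and> m = 1 then Z_rho p \<rho> \<gamma> \<beta> else 0))"

definition kms_form ::
  "nat \<Rightarrow> (complex \<Rightarrow> 'c) \<Rightarrow> 'c::complete_ultrametric_field
    \<Rightarrow> (bc_word \<Rightarrow>\<^sub>0 'c) set \<Rightarrow> 'c" where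
  "kms_form p \<rho> \<beta> = (THE \<phi>. \<phi> \<in> extensional (carrier (bc_algebra p)) \<and> is_kms_form p \<rho> \<beta> \<phi>)"

definition partition_fun ::
  "nat \<Rightarrow> (complex \<Rightarrow> 'c) \<Rightarrow> 'c::complete_ultrametric_field \<Rightarrow> 'c" where
  "partition_fun p \<rho> \<beta> = kms_form p \<rho> \<beta> \<one>\<^bsub>bc_algebra p\<^esub>"

end

theory Submission
  imports Defs "HOL-Number_Theory.Residue_Primitive_Roots"
begin

text \<open>
  The zeta values are p-adic means.  For \<open>c\<close> prime to p and f divisible by q the function
  \<open>k \<mapsto> \<langle>c + k f\<rangle>\<^sup>s\<close> has a binomial expansion in powers of \<open>k f / c\<close>, and the means
  \<open>(k\<^sup>j summed over k < M) / M\<close> tend to the Bernoulli number \<open>B\<^sub>j\<close> as M tends to 0 p-adically.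
  So the Bernoulli series in the definition of \<open>Z\<^sub>\<rho>(\<gamma>, \<beta>)\<close> is a Volkenborn integral, and
  \<open>(\<beta> - 1) Z\<^sub>\<rho>(\<gamma>, \<beta>)\<close> is the limit of \<open>(1/F)\<close> times the sum of
  \<open>\<rho>(\<zeta>\<^sub>\<gamma>)\<^sup>c \<langle>c\<rangle>\<^sup>1\<^sup>-\<^sup>\<beta>\<close> over \<open>c < F\<close> prime to p, where F runs through \<open>f m p\<^sup>N\<close>
  (\<open>zsum_limit\<close>).  This expression no longer depends on f.  Summed over the n points \<open>\<delta>\<close> with
  \<open>n \<delta> = \<gamma>\<close>, it keeps only the multiples \<open>c = n d\<close>, and \<open>\<langle>n d\<rangle> = \<langle>n\<rangle>\<langle>d\<rangle>\<close> gives the distribution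
  relation \<open>Z_rho_distribution\<close>: the sum is \<open>\<langle>n\<rangle>\<^sup>1\<^sup>-\<^sup>\<beta> Z\<^sub>\<rho>(\<gamma>, \<beta>)\<close>.

  The p-adic functions are all controlled by one limit: \<open>log u\<close> is the limit of
  \<open>(u\<^sup>N - 1)/N\<close> as N runs through the powers of p.  It makes the logarithm additive, and it
  computes the logarithm of \<open>exp y\<close> and of a binomial series \<open>(1 + x)\<^sup>s\<close>, both being homomorphisms
  in the exponent.  As the logarithm is injective near 1 this yields
  \<open>(1 + x)\<^sup>s = exp (s log (1 + x))\<close> (\<open>binom_series_eq_exp\<close>) without composing power series.  The
  Iwasawa logarithm exists and is unique because every nonzero x has a power in \<open>p\<^sup>m U\<close>, where U
  is the group of elements at distance less than 1 from 1.

  On the algebra, \<open>\<sigma>\<close> multiplies a monomial by a character of its degree, so it exists and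
  respects all relations.  The linear form exists because the algebra acts on functions on
  \<open>(\<rat>/\<int>)\<^sup>(\<^sup>p\<^sup>) \<times> \<rat>\<close>, the second coordinate recording the degree, and the form is a matrix
  coefficient of this representation; it is unique because the monomials with coprime indices span
  (\<open>bc_normal_form_induct\<close>).  If the identity \<open>\<phi>(x \<sigma>(y)) = \<phi>(y x)\<close> holds for all x and two
  elements y, it holds for their product, so only generators y and spanning monomials x need to be
  compared.  Both sides vanish unless the degrees of x and y cancel, and then the identity is
  trivial for \<open>y = e(\<delta>)\<close> and is the distribution relation for the other generators.

  Finally \<open>Z(\<beta>)\<close> is nonzero because in \<open>(\<beta> - 1) q L\<^sub>p(\<beta>, 1)\<close>, written as a series over the index j of
  the Bernoulli numbers, the term with \<open>j = 0\<close> is strictly larger than all the others.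
\<close>

section \<open>Analysis over a complete ultrametric field\<close>

lemma vabs_eq_dist: "vabs x = dist x (0 :: 'c::complete_ultrametric_field)"
  by (simp add: dist_vabs)

lemma vabs_nonneg [simp]: "0 \<le> vabs (x :: 'c::complete_ultrametric_field)"
  by (simp add: vabs_eq_dist)

lemma vabs_eq_0_iff [simp]: "vabs (x :: 'c::complete_ultrametric_field) = 0 \<longleftrightarrow> x = 0"
  by (simp add: vabs_eq_dist)

lemma vabs_0 [simp]: "vabs (0 :: 'c::complete_ultrametric_field) = 0"
  by simp

lemma vabs_pos_iff [simp]: "0 < vabs (x :: 'c::complete_ultrametric_field) \<longleftrightarrow> x \<noteq> 0"
  by (simp add: vabs_eq_dist)

lemma vabs_1 [simp]: "vabs (1 :: 'c::complete_ultrametric_field) = 1"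
proof -
  have "vabs (1 :: 'c) * vabs (1 :: 'c) = vabs (1 :: 'c) * 1" by (simp flip: vabs_mult)
  then show ?thesis by (subst (asm) mult_cancel_left) simp
qed

lemma vabs_minus [simp]: "vabs (- x) = vabs (x :: 'c::complete_ultrametric_field)"
  using dist_vabs[of 0 x] dist_vabs[of x 0] by (simp add: dist_commute)

lemma vabs_minus_commute: "vabs (x - y) = vabs (y - x :: 'c::complete_ultrametric_field)"
  by (metis minus_diff_eq vabs_minus)

lemma vabs_power: "vabs (x ^ n) = vabs (x :: 'c::complete_ultrametric_field) ^ n"
  by (induction n) (simp_all add: vabs_mult)

lemma vabs_inverse: "vabs (inverse x) = inverse (vabs (x :: 'c::complete_ultrametric_field))"
proof (cases "x = 0")
  case False
  then have "vabs (inverse x) * vabs x = 1" by (simp flip: vabs_mult)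
  then show ?thesis by (metis inverse_unique mult.commute)
qed simp

lemma vabs_divide: "vabs (x / y) = vabs x / vabs (y :: 'c::complete_ultrametric_field)"
  by (simp add: divide_inverse vabs_mult vabs_inverse)

lemma vabs_prod: "vabs (prod f A) = (\<Prod>i\<in>A. vabs (f i :: 'c::complete_ultrametric_field))"
  by (induction A rule: infinite_finite_induct) (simp_all add: vabs_mult)

lemma vabs_add_le:
  "vabs (x :: 'c::complete_ultrametric_field) \<le> C \<Longrightarrow> vabs y \<le> C \<Longrightarrow> vabs (x + y) \<le> C"
  using vabs_ultrametric[of x y] by simp

lemma vabs_add_less:
  "vabs (x :: 'c::complete_ultrametric_field) < C \<Longrightarrow> vabs y < C \<Longrightarrow> vabs (x + y) < C"
  using vabs_ultrametric[of x y] by simp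

lemma vabs_diff_le:
  "vabs (x :: 'c::complete_ultrametric_field) \<le> C \<Longrightarrow> vabs y \<le> C \<Longrightarrow> vabs (x - y) \<le> C"
  using vabs_add_le[of x C "- y"] by simp

lemma vabs_diff_less:
  "vabs (x :: 'c::complete_ultrametric_field) < C \<Longrightarrow> vabs y < C \<Longrightarrow> vabs (x - y) < C"
  using vabs_add_less[of x C "- y"] by simp

lemma vabs_add_eq_left:
  assumes "vabs (y :: 'c::complete_ultrametric_field) < vabs x"
  shows "vabs (x + y) = vabs x"
proof (rule antisym)
  show "vabs (x + y) \<le> vabs x" using assms by (intro vabs_add_le) auto
  show "vabs x \<le> vabs (x + y)"
  proof (rule ccontr)
    assume "\<not> ?thesis"
    then have "vabs (x + y - y) < vabs x" using assms by (intro vabs_diff_less) auto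
    then show False by simp
  qed
qed

lemma vabs_eq_if_close:
  "vabs (x - y :: 'c::complete_ultrametric_field) < vabs y \<Longrightarrow> vabs x = vabs y"
  using vabs_add_eq_left[of "x - y" y] by simp

lemma vabs_sum_le:
  assumes "\<And>i. i \<in> A \<Longrightarrow> vabs (f i :: 'c::complete_ultrametric_field) \<le> C" "0 \<le> C"
  shows "vabs (sum f A) \<le> C"
  using assms by (induction A rule: infinite_finite_induct) (auto intro!: vabs_add_le)

lemma vabs_sum_less:
  assumes "\<And>i. i \<in> A \<Longrightarrow> vabs (f i :: 'c::complete_ultrametric_field) < C" "0 < C"
  shows "vabs (sum f A) < C"
  using assms by (induction A rule: infinite_finite_induct) (auto intro!: vabs_add_less)

lemma vabs_of_nat_le_1: "vabs (of_nat n :: 'c::complete_ultrametric_field) \<le> 1"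
  by (induction n) (auto intro!: vabs_add_le)

lemma vabs_of_int_le_1: "vabs (of_int n :: 'c::complete_ultrametric_field) \<le> 1"
  by (cases n) (auto intro!: vabs_diff_le simp: vabs_of_nat_le_1)

lemma tendsto_vabs_iff:
  "(f \<longlongrightarrow> (l :: 'c::complete_ultrametric_field)) F \<longleftrightarrow> ((\<lambda>x. vabs (f x - l)) \<longlongrightarrow> 0) F"
  by (subst tendsto_dist_iff) (simp add: dist_vabs)

lemma tendsto_vabs_0_iff:
  "(f \<longlongrightarrow> (0 :: 'c::complete_ultrametric_field)) F \<longleftrightarrow> ((\<lambda>x. vabs (f x)) \<longlongrightarrow> 0) F"
  by (simp add: tendsto_vabs_iff)

lemma tendsto_vabs:
  "(f \<longlongrightarrow> (l :: 'c::complete_ultrametric_field)) F \<Longrightarrow> ((\<lambda>x. vabs (f x)) \<longlongrightarrow> vabs l) F"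
  unfolding vabs_eq_dist by (intro tendsto_intros)

lemma tendsto_vabs_le:
  assumes "(g \<longlongrightarrow> 0) F" "\<And>x. vabs (f x - (l :: 'c::complete_ultrametric_field)) \<le> g x"
  shows "(f \<longlongrightarrow> l) F"
  unfolding tendsto_vabs_iff using tendsto_const[of 0 F] assms(1)
  by (rule real_tendsto_sandwich[rotated 2]) (auto simp: assms(2))

lemma vabs_limit_le:
  assumes "(f \<longlongrightarrow> (l :: 'c::complete_ultrametric_field)) F" "\<And>x. vabs (f x) \<le> C" "F \<noteq> bot"
  shows "vabs l \<le> C"
  using tendsto_upperbound[OF tendsto_vabs[OF assms(1)]] assms(2,3) by simp

lemma vabs_seq_bounded:
  assumes "f \<longlonglongrightarrow> (l :: 'c::complete_ultrametric_field)"
  obtains C where "C > 0" "\<And>n. vabs (f n) \<le> C"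
proof -
  have "Bseq (\<lambda>n. vabs (f n))"
    using tendsto_vabs[OF assms] by (intro convergent_imp_Bseq) (auto simp: convergent_def)
  then show ?thesis using that by (auto elim!: BseqE)
qed

instance complete_ultrametric_field \<subseteq> topological_ab_group_add
proof
  fix a b :: 'a
  show "((\<lambda>x. fst x + snd x) \<longlongrightarrow> a + b) (nhds a \<times>\<^sub>F nhds b)"
  proof (rule tendsto_vabs_le)
    show "((\<lambda>x. dist (fst x) a + dist (snd x) b) \<longlongrightarrow> 0) (nhds a \<times>\<^sub>F nhds b)"
      by (rule tendsto_eq_intros filterlim_fst filterlim_snd | simp)+
    show "vabs (fst x + snd x - (a + b)) \<le> dist (fst x) a + dist (snd x) b" for x
    proof -
      have "vabs ((fst x - a) + (snd x - b)) \<le> vabs (fst x - a) + vabs (snd x - b)"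
        by (rule order_trans[OF vabs_ultrametric]) simp
      then show ?thesis by (simp add: dist_vabs algebra_simps)
    qed
  qed
  show "(uminus \<longlongrightarrow> - a) (nhds a)"
  proof (rule tendsto_vabs_le)
    show "((\<lambda>x. dist x a) \<longlongrightarrow> 0) (nhds a)"
      by (rule tendsto_eq_intros filterlim_ident | simp)+
    show "vabs (- x - - a) \<le> dist x a" for x
      by (simp add: dist_vabs vabs_minus_commute)
  qed
qed

instance complete_ultrametric_field \<subseteq> topological_comm_monoid_mult
proof
  fix a b :: 'a
  show "((\<lambda>x. fst x * snd x) \<longlongrightarrow> a * b) (nhds a \<times>\<^sub>F nhds b)"
  proof (rule tendsto_vabs_le)
    show "((\<lambda>x. dist (fst x) a * dist (snd x) 0 + vabs a * dist (snd x) b) \<longlongrightarrow> 0)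
        (nhds a \<times>\<^sub>F nhds b)"
      by (rule tendsto_eq_intros filterlim_fst filterlim_snd | simp)+
    show "vabs (fst x * snd x - a * b) \<le> dist (fst x) a * dist (snd x) 0 + vabs a * dist (snd x) b"
      for x
    proof -
      have "fst x * snd x - a * b = (fst x - a) * snd x + a * (snd x - b)"
        by (simp add: algebra_simps)
      then have "vabs (fst x * snd x - a * b)
          \<le> max (vabs (fst x - a) * vabs (snd x)) (vabs a * vabs (snd x - b))"
        by (metis vabs_mult vabs_ultrametric)
      also have "\<dots> \<le> vabs (fst x - a) * vabs (snd x) + vabs a * vabs (snd x - b)"
        by simp
      finally show ?thesis by (simp add: dist_vabs)
    qed
  qed
qed

lemma sums_mult_vabs:
  "f sums s \<Longrightarrow> (\<lambda>n. c * f n) sums (c * s :: 'c::complete_ultrametric_field)"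
  unfolding sums_def by (drule tendsto_mult_left[of _ _ _ c]) (simp add: sum_distrib_left)

lemma sums_diff_vabs:
  "f sums s \<Longrightarrow> g sums t \<Longrightarrow>
    (\<lambda>n. f n - g n) sums (s - t :: 'c::complete_ultrametric_field)"
  unfolding sums_def by (drule (1) tendsto_diff) (simp add: sum_subtractf)

lemma summable_vabs:
  assumes "f \<longlonglongrightarrow> (0 :: 'c::complete_ultrametric_field)"
  shows "summable f"
  unfolding summable_iff_convergent
proof (rule Cauchy_convergent, rule metric_CauchyI)
  fix e :: real assume e: "e > 0"
  obtain N where N: "\<And>n. n \<ge> N \<Longrightarrow> vabs (f n) < e"
    using metric_LIMSEQ_D[OF assms e] by (auto simp: dist_vabs)
  have less: "dist (\<Sum>i<m. f i) (\<Sum>i<n. f i) < e" if "N \<le> n" "n \<le> m" for m n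
  proof -
    have "(\<Sum>i<m. f i) - (\<Sum>i<n. f i) = (\<Sum>i\<in>{n..<m}. f i)"
      using that by (simp add: sum_diff_nat_ivl lessThan_atLeast0)
    also have "vabs \<dots> < e" using that e by (intro vabs_sum_less N) auto
    finally show ?thesis by (simp add: dist_vabs)
  qed
  show "\<exists>M. \<forall>m\<ge>M. \<forall>n\<ge>M. dist (\<Sum>i<m. f i) (\<Sum>i<n. f i) < e"
    by (rule exI[of _ N]) (metis dist_commute less nle_le)
qed

lemma sums_terms_tendsto_0:
  fixes f :: "nat \<Rightarrow> 'c::complete_ultrametric_field"
  assumes "f sums s"
  shows "f \<longlonglongrightarrow> 0"
proof -
  have "(\<lambda>n. (\<Sum>i<Suc n. f i) - (\<Sum>i<n. f i)) \<longlonglongrightarrow> s - s"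
    using assms unfolding sums_def by (intro tendsto_diff LIMSEQ_Suc)
  then show ?thesis by simp
qed

lemma sums_vabs_le:
  assumes "f sums (s :: 'c::complete_ultrametric_field)" "\<And>n. vabs (f n) \<le> C"
  shows "vabs s \<le> C"
proof -
  have "0 \<le> C" using assms(2)[of 0] vabs_nonneg[of "f 0"] by linarith
  then show ?thesis
    using assms unfolding sums_def by (intro vabs_limit_le[OF assms(1)[unfolded sums_def]] vabs_sum_le) auto
qed

text \<open>As the terms tend to 0, one of them is the largest, so the strict bound survives the limit.\<close>

lemma sums_vabs_less:
  assumes "f sums (s :: 'c::complete_ultrametric_field)" "f \<longlonglongrightarrow> 0" "\<And>n. vabs (f n) < C"
  shows "vabs s < C"
proof -
  have C: "0 < C" using assms(3)[of 0] vabs_nonneg[of "f 0"] by linarith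
  obtain N where N: "\<And>n. n \<ge> N \<Longrightarrow> vabs (f n) < C / 2"
    using metric_LIMSEQ_D[OF assms(2), of "C / 2"] C by (auto simp: dist_vabs)
  define B where "B = Max (insert (C / 2) ((\<lambda>n. vabs (f n)) ` {..<N}))"
  have "vabs (f n) \<le> B" for n
  proof (cases "n < N")
    case True then show ?thesis unfolding B_def by (intro Max_ge) auto
  next
    case False
    then have "vabs (f n) \<le> C / 2" using N[of n] by simp
    also have "\<dots> \<le> B" unfolding B_def by (intro Max_ge) auto
    finally show ?thesis .
  qed
  then have "vabs s \<le> B" by (rule sums_vabs_le[OF assms(1)])
  also have "B < C" unfolding B_def using C assms(3) by (subst Max_less_iff) auto
  finally show ?thesis .
qed

text \<open>The ultrametric form of dominated convergence: an infinite sum is dominated by the largest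
  term, so a bound tending to 0 suffices.\<close>

lemma tendsto_suminf_dominated:
  fixes a :: "nat \<Rightarrow> nat \<Rightarrow> 'c::complete_ultrametric_field"
  assumes lim: "\<And>j. (\<lambda>k. a k j) \<longlonglongrightarrow> b j"
    and le: "\<And>k j. vabs (a k j) \<le> M j" and M: "M \<longlonglongrightarrow> 0"
    and s: "\<And>k. a k sums s k" and t: "b sums t"
  shows "s \<longlonglongrightarrow> t"
proof (rule metric_LIMSEQ_I)
  fix e :: real assume e: "e > 0"
  have b_le: "vabs (b j) \<le> M j" for j by (rule vabs_limit_le[OF lim le]) simp
  obtain J where J: "\<And>j. j \<ge> J \<Longrightarrow> M j < e / 2"
    using order_tendstoD(2)[OF M, of "e / 2"] e by (auto simp: eventually_sequentially)
  have "eventually (\<lambda>k. \<forall>j\<in>{..<J}. vabs (a k j - b j) < e / 2) sequentially"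
    using e lim by (intro eventually_ball_finite ballI)
      (auto simp: tendsto_iff dist_vabs simp del: divide_less_eq_numeral1 less_divide_eq_numeral1)
  then obtain K where K: "\<And>k j. k \<ge> K \<Longrightarrow> j < J \<Longrightarrow> vabs (a k j - b j) < e / 2"
    by (auto simp: eventually_sequentially)
  have "dist (s k) t < e" if "k \<ge> K" for k
  proof -
    have "(\<lambda>j. a k j - b j) sums (s k - t)" by (intro sums_diff_vabs s t)
    then have "vabs (s k - t) \<le> e / 2"
    proof (rule sums_vabs_le)
      fix j show "vabs (a k j - b j) \<le> e / 2"
      proof (cases "j < J")
        case True then show ?thesis using K that by (simp add: less_imp_le)
      next
        case False
        then show ?thesis using J[of j] le[of k j] b_le[of j] by (intro vabs_diff_le) auto
      qed
    qed
    then show ?thesis using e by (simp add: dist_vabs)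
  qed
  then show "\<exists>K. \<forall>k\<ge>K. dist (s k) t < e" by blast
qed

text \<open>The partial sums of the product series are \<open>a\<^sub>0 B\<^sub>N + \<dots> + a\<^sub>N\<^sub>-\<^sub>1 B\<^sub>1\<close> with \<open>B\<^sub>k\<close> the partial sums of b, so
  dominated convergence in the index of a applies.\<close>

lemma sums_Cauchy_product:
  fixes a b :: "nat \<Rightarrow> 'c::complete_ultrametric_field"
  assumes a: "a sums A" and b: "b sums B" and a0: "a \<longlonglongrightarrow> 0"
  shows "(\<lambda>n. \<Sum>i\<le>n. a i * b (n - i)) sums (A * B)"
  unfolding sums_def
proof -
  let ?B = "\<lambda>k. \<Sum>i<k. b i"
  have B: "?B \<longlonglongrightarrow> B" using b by (simp add: sums_def)
  then obtain C where C: "C > 0" "\<And>k. vabs (?B k) \<le> C" by (rule vabs_seq_bounded) blast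
  have partial: "(\<Sum>n<N. \<Sum>i\<le>n. a i * b (n - i)) = (\<Sum>i<N. a i * ?B (N - i))" for N
  proof (induction N)
    case (Suc N)
    have "(\<Sum>i<Suc N. a i * ?B (Suc N - i)) = (\<Sum>i<Suc N. a i * ?B (N - i) + a i * b (N - i))"
      by (intro sum.cong) (auto simp: Suc_diff_le algebra_simps)
    also have "\<dots> = (\<Sum>i<N. a i * ?B (N - i)) + (\<Sum>i\<le>N. a i * b (N - i))"
      by (simp add: sum.distrib lessThan_Suc_atMost flip: lessThan_Suc_atMost)
    finally show ?case using Suc by simp
  qed simp
  show "(\<lambda>N. \<Sum>n<N. \<Sum>i\<le>n. a i * b (n - i)) \<longlonglongrightarrow> A * B"
    unfolding partial
  proof (rule tendsto_suminf_dominated)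
    let ?f = "\<lambda>N i. if i < N then a i * ?B (N - i) else 0"
    show "?f N sums (\<Sum>i<N. a i * ?B (N - i))" for N
      using sums_If_finite[of "\<lambda>i. i < N" "\<lambda>i. a i * ?B (N - i)"] by (simp add: lessThan_def)
    show "(\<lambda>i. a i * B) sums (A * B)"
      using sums_mult_vabs[OF a, of B] by (simp add: mult.commute)
    show "(\<lambda>N. ?f N i) \<longlonglongrightarrow> a i * B" for i
    proof (rule Lim_transform_eventually)
      show "(\<lambda>N. a i * ?B (N - i)) \<longlonglongrightarrow> a i * B"
        by (intro tendsto_mult tendsto_const filterlim_compose[OF B] filterlim_minus_const_nat_at_top)
      show "eventually (\<lambda>N. a i * ?B (N - i) = ?f N i) sequentially"
        using eventually_gt_at_top[of i] by eventually_elim simp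
    qed
    show "vabs (?f N i) \<le> vabs (a i) * C" for N i
      using C by (auto simp: vabs_mult intro!: mult_left_mono)
    show "(\<lambda>i. vabs (a i) * C) \<longlonglongrightarrow> 0"
      using tendsto_mult_right[OF tendsto_vabs[OF a0], of C] by simp
  qed
qed

section \<open>Natural numbers, factorials and Bernoulli numbers in residue characteristic p\<close>

locale residue_char =
  fixes p :: nat and ty :: "'c::complete_ultrametric_field itself"
  assumes prime_p: "prime p" and vabs_p: "vabs (of_nat p :: 'c) = 1 / real p"
begin

lemma p_ge_2: "2 \<le> p" using prime_p by (rule prime_ge_2_nat)

lemma p_pos: "0 < p" using p_ge_2 by simp

text \<open>The radius of convergence of the exponential series; \<open>rad\<close> to the power \<open>p - 1\<close> is \<open>1/p\<close>.\<close>

definition rad :: real where "rad = real p powr (- 1 / (real p - 1))"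

lemma rad_pos: "0 < rad"
  using p_pos by (simp add: rad_def)

lemma rad_less_1: "rad < 1"
  unfolding rad_def using p_ge_2 by (intro powr_less_one) (auto simp: divide_neg_pos)

lemma rad_power: "rad ^ (p - 1) = 1 / real p"
proof -
  have "rad ^ (p - 1) = real p powr (- 1 / (real p - 1) * real (p - 1))"
    unfolding rad_def using p_pos by (simp add: powr_powr flip: powr_realpow)
  also have "- 1 / (real p - 1) * real (p - 1) = - 1"
    using p_ge_2 by (simp add: field_simps of_nat_diff)
  finally show ?thesis using p_pos by (simp add: powr_minus_divide)
qed

lemma vabs_of_nat_coprime:
  assumes "coprime n p"
  shows "vabs (of_nat n :: 'c) = 1"
proof -
  obtain u v where uv: "u * int n + v * int p = 1"
    using bezout_int[of "int n" "int p"] assms by (metis coprime_int_iff coprime_iff_gcd_eq_1)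
  have one: "1 = of_int u * of_nat n + of_int v * (of_nat p :: 'c)"
    using arg_cong[OF uv, of "of_int :: int \<Rightarrow> 'c"] by simp
  have "1 \<le> vabs (of_nat n :: 'c)"
  proof (rule ccontr)
    assume "\<not> ?thesis"
    then have "vabs (of_int u * of_nat n :: 'c) < 1"
      using mult_right_mono[OF vabs_of_int_le_1[of u, where 'c='c], of "vabs (of_nat n :: 'c)"]
      by (simp add: vabs_mult)
    moreover have "vabs (of_int v * of_nat p :: 'c) < 1"
    proof -
      have "vabs (of_int v * of_nat p :: 'c) \<le> 1 * (1 / real p)"
        unfolding vabs_mult vabs_p by (intro mult_right_mono vabs_of_int_le_1) simp
      also have "\<dots> < 1" using p_ge_2 by simp
      finally show ?thesis .
    qed
    ultimately have "vabs (1 :: 'c) < 1" by (subst one) (rule vabs_add_less)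
    then show False by simp
  qed
  then show ?thesis using vabs_of_nat_le_1[of n, where 'c='c] by simp
qed

lemma vabs_of_nat_not_dvd: "\<not> p dvd n \<Longrightarrow> vabs (of_nat n :: 'c) = 1"
  using prime_p by (intro vabs_of_nat_coprime) (metis coprime_commute prime_imp_coprime)

lemma vabs_of_nat_dvd: "p dvd n \<Longrightarrow> vabs (of_nat n :: 'c) \<le> 1 / real p"
  using vabs_of_nat_le_1[where 'c='c] p_pos
  by (auto simp: vabs_mult vabs_p divide_right_mono elim!: dvdE)

lemma vabs_of_nat_ge_inverse: "n > 0 \<Longrightarrow> 1 / real n \<le> vabs (of_nat n :: 'c)"
proof (induction n rule: less_induct)
  case (less n)
  show ?case
  proof (cases "p dvd n")
    case False
    then show ?thesis using less.prems by (simp add: vabs_of_nat_not_dvd)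
  next
    case True
    then obtain k where k: "n = p * k" by (elim dvdE)
    have "k < n" "k > 0" using k less.prems p_ge_2 by auto
    then have "1 / real k \<le> vabs (of_nat k :: 'c)" by (rule less.IH)
    then have "1 / real p * (1 / real k) \<le> 1 / real p * vabs (of_nat k :: 'c)"
      by (intro mult_left_mono) auto
    then show ?thesis by (simp add: k vabs_mult vabs_p)
  qed
qed

lemma vabs_fact_add: "r < p \<Longrightarrow> vabs (fact (p * m + r) :: 'c) = vabs (fact (p * m) :: 'c)"
proof (induction r)
  case (Suc r)
  have "\<not> p dvd Suc (p * m + r)"
    using Suc.prems dvd_add_right_iff[of p "p * m" "Suc r"] nat_dvd_not_less[of "Suc r" p] by simp
  then have "vabs (of_nat (Suc (p * m + r)) :: 'c) = 1" by (rule vabs_of_nat_not_dvd)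
  then have "vabs (fact (Suc (p * m + r)) :: 'c) = vabs (fact (p * m + r) :: 'c)"
    by (simp only: fact_Suc vabs_mult mult_1)
  then show ?case using Suc by simp
qed simp

lemma vabs_fact_mult: "vabs (fact (p * m) :: 'c) = (1 / real p) ^ m * vabs (fact m :: 'c)"
proof (induction m)
  case (Suc m)
  have "p * Suc m = Suc (p * m + (p - 1))" using p_pos by simp
  then have "fact (p * Suc m) = of_nat (p * Suc m) * (fact (p * m + (p - 1)) :: 'c)"
    by (metis fact_Suc)
  also have "vabs \<dots> = 1 / real p * vabs (of_nat (Suc m) :: 'c) * vabs (fact (p * m) :: 'c)"
    using vabs_fact_add[of "p - 1" m] p_pos
    by (simp add: vabs_mult vabs_p of_nat_mult del: of_nat_Suc mult_Suc_right)
  also have "\<dots> = (1 / real p) ^ Suc m * vabs (fact (Suc m) :: 'c)"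
    using Suc by (simp add: vabs_mult del: of_nat_Suc)
  finally show ?case .
qed simp

text \<open>Legendre's bound for the exponent of p in a factorial.  The exponent being an integer is what
  makes the sharper bound below possible when \<open>p - 1\<close> divides n.\<close>

lemma vabs_fact:
  "n > 0 \<Longrightarrow> \<exists>v. vabs (fact n :: 'c) = (1 / real p) ^ v \<and> v * (p - 1) < n"
proof (induction n rule: less_induct)
  case (less n)
  define m where "m = n div p"
  have n: "n = p * m + n mod p" by (simp add: m_def)
  have eq: "vabs (fact n :: 'c) = (1 / real p) ^ m * vabs (fact m :: 'c)"
    using vabs_fact_add[of "n mod p" m] vabs_fact_mult[of m] p_pos n by simp
  show ?case
  proof (cases "m = 0")
    case True
    then show ?thesis using eq less.prems by (intro exI[of _ 0]) simp
  next
    case False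
    have "m < n" unfolding m_def using less.prems p_ge_2 by simp
    then obtain v where v: "vabs (fact m :: 'c) = (1 / real p) ^ v" "v * (p - 1) < m"
      using less.IH False by blast
    have "(m + v) * (p - 1) < m * (p - 1) + m" using v(2) by (simp add: algebra_simps)
    also have "\<dots> = p * m" using p_pos by (cases p) auto
    also have "\<dots> \<le> n" using n by linarith
    finally show ?thesis using eq v(1) by (intro exI[of _ "m + v"]) (simp add: power_add)
  qed
qed

lemma vabs_fact_ge:
  assumes "n > 0"
  shows "rad ^ (n - 1) \<le> vabs (fact n :: 'c)"
proof -
  obtain v where v: "vabs (fact n :: 'c) = (1 / real p) ^ v" "v * (p - 1) < n"
    using vabs_fact[OF assms] by blast
  have "rad ^ (n - 1) \<le> rad ^ ((p - 1) * v)"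
    using v(2) rad_pos rad_less_1 by (intro power_decreasing) (auto simp: mult.commute)
  then show ?thesis by (simp only: v(1) power_mult rad_power)
qed

text \<open>For \<open>n = (p - 1) k\<close> Legendre's bound is \<open>v < k\<close>, hence \<open>v \<le> k - 1\<close>: rounding gains a factor
  \<open>rad\<^sup>p\<^sup>-\<^sup>2\<close> over the general bound.\<close>

lemma vabs_fact_ge_dvd:
  assumes "n > 0" "(p - 1) dvd n"
  shows "rad ^ (n - (p - 1)) \<le> vabs (fact n :: 'c)"
proof -
  obtain v where v: "vabs (fact n :: 'c) = (1 / real p) ^ v" "v * (p - 1) < n"
    using vabs_fact[OF assms(1)] by blast
  obtain k where k: "n = (p - 1) * k" using assms(2) by (elim dvdE)
  have "v < k" using v(2) unfolding k mult.commute[of v] by simp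
  then have "(p - 1) * v \<le> (p - 1) * (k - 1)" by (intro mult_left_mono) auto
  also have "\<dots> = n - (p - 1)" by (simp add: k right_diff_distrib')
  finally have "rad ^ (n - (p - 1)) \<le> rad ^ ((p - 1) * v)"
    using rad_pos rad_less_1 by (intro power_decreasing) auto
  then show ?thesis by (simp only: v(1) power_mult rad_power)
qed

lemma vabs_of_nat_ge:
  assumes "n > 0"
  shows "rad ^ (n - 1) \<le> vabs (of_nat n :: 'c)"
proof -
  have "fact n = (of_nat n * fact (n - 1) :: 'c)" by (rule fact_reduce[OF assms])
  then have "vabs (fact n :: 'c) = vabs (of_nat n :: 'c) * vabs (of_nat (fact (n - 1)) :: 'c)"
    by (simp only: vabs_mult of_nat_fact)
  also have "\<dots> \<le> vabs (of_nat n :: 'c) * 1"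
    by (intro mult_left_mono vabs_of_nat_le_1) simp
  finally show ?thesis using vabs_fact_ge[OF assms] by simp
qed

end

lemma fps_exp_minus_1_nonzero: "fps_exp 1 - 1 \<noteq> (0 :: rat fps)"
proof
  assume "fps_exp 1 - 1 = (0 :: rat fps)"
  then have "fps_nth (fps_exp 1 - 1 :: rat fps) 1 = 0" by simp
  then show False by simp
qed

lemma bernoulli_fps:
  "(fps_exp 1 - 1) * Abs_fps (\<lambda>j. bernoulli_num j / fact j) = fps_X"
proof -
  let ?E = "fps_exp 1 - 1 :: rat fps"
  have E0: "?E \<noteq> 0" by (rule fps_exp_minus_1_nonzero)
  have "subdegree ?E = 1"
    by (rule subdegreeI) auto
  then have "?E dvd fps_X" using E0 by (subst fps_dvd_iff) auto
  moreover have "Abs_fps (\<lambda>j. bernoulli_num j / fact j) = fps_X / ?E"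
    by (simp add: bernoulli_num_def fps_eq_iff)
  ultimately show ?thesis by (simp only: dvd_mult_div_cancel)
qed

lemma bernoulli_num_0: "bernoulli_num 0 = 1"
  using arg_cong[OF bernoulli_fps, of "\<lambda>f. fps_nth f 1"] by (simp add: fps_mult_nth)

text \<open>Compare coefficients in
  \<open>1 + e\<^sup>t + \<dots> + e\<^sup>(\<^sup>M\<^sup>-\<^sup>1\<^sup>)\<^sup>t = (t / (e\<^sup>t - 1)) ((e\<^sup>M\<^sup>t - 1) / t)\<close>.\<close>

lemma sum_powers_bernoulli_rat:
  "(\<Sum>k<M. of_nat k ^ j :: rat)
     = fact j * (\<Sum>i\<le>j. bernoulli_num i / fact i * (of_nat M ^ Suc (j - i) / fact (Suc (j - i))))"
proof -
  let ?E = "fps_exp 1 - 1 :: rat fps"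
  define B where "B = Abs_fps (\<lambda>j. bernoulli_num j / fact j)"
  define D where "D = Abs_fps (\<lambda>n. of_nat M ^ Suc n / fact (Suc n) :: rat)"
  have E0: "?E \<noteq> 0" by (rule fps_exp_minus_1_nonzero)
  have "fps_X * D = fps_exp (of_nat M) - 1"
  proof (rule fps_ext)
    fix n show "fps_nth (fps_X * D) n = fps_nth (fps_exp (of_nat M) - 1) n"
      by (cases n) (simp_all add: D_def del: fact_Suc)
  qed
  also have "\<dots> = fps_exp 1 ^ M - 1" by (simp add: fps_exp_power_mult)
  also have "\<dots> = ?E * (\<Sum>k<M. fps_exp 1 ^ k)"
    by (simp add: power_diff_1_eq)
  finally have "?E * (\<Sum>k<M. fps_exp (of_nat k)) = ?E * (B * D)"
    using bernoulli_fps by (simp add: fps_exp_power_mult B_def mult.assoc[symmetric])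
  then have "(\<Sum>k<M. fps_exp (of_nat k)) = B * D" using E0 by (simp only: mult_cancel_left) simp
  then have "fps_nth (\<Sum>k<M. fps_exp (of_nat k)) j = fps_nth (B * D) j" by simp
  then have "(\<Sum>k<M. of_nat k ^ j / fact j :: rat) = (\<Sum>i\<le>j. fps_nth B i * fps_nth D (j - i))"
    by (simp add: fps_sum_nth fps_mult_nth atLeast0AtMost)
  then show ?thesis by (simp add: B_def D_def field_simps flip: sum_divide_distrib)
qed

definition power_mean :: "nat \<Rightarrow> nat \<Rightarrow> 'c::complete_ultrametric_field" where
  "power_mean j M = (\<Sum>k<M. of_nat k ^ j) / of_nat M"

lemma sum_powers_bernoulli:
  assumes "M > 0"
  shows "power_mean j M
     = fact j * (\<Sum>i\<le>j. of_rat (bernoulli_num i) / fact i * (of_nat M ^ (j - i) / fact (Suc (j - i)))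
        :: 'c::complete_ultrametric_field)"
proof -
  have of_rat_fact: "of_rat (fact n) = (fact n :: 'c)" for n
    by (metis of_nat_fact of_rat_of_nat_eq)
  have "(\<Sum>k<M. of_nat k ^ j :: 'c) = of_rat (\<Sum>k<M. of_nat k ^ j)"
    by (simp add: of_rat_sum of_rat_power)
  also have "\<dots> = fact j * (\<Sum>i\<le>j. of_rat (bernoulli_num i) / fact i
      * (of_nat M ^ Suc (j - i) / fact (Suc (j - i))))"
    unfolding sum_powers_bernoulli_rat
    by (simp only: of_rat_mult of_rat_sum of_rat_divide of_rat_power of_rat_of_nat_eq of_rat_fact)
  finally show ?thesis
    using assms by (simp add: power_mean_def sum_divide_distrib mult_ac flip: sum_divide_distrib)
      (simp add: sum_divide_distrib sum_distrib_left mult_ac)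
qed

text \<open>Every term of the formula except the one with \<open>i = j\<close> contains a positive power of M.\<close>

lemma power_mean_tendsto:
  assumes M: "\<And>N. M N > 0" "(\<lambda>N. of_nat (M N) :: 'c::complete_ultrametric_field) \<longlonglongrightarrow> 0"
  shows "(\<lambda>N. power_mean j (M N)) \<longlonglongrightarrow> (of_rat (bernoulli_num j) :: 'c)"
proof -
  let ?b = "\<lambda>i. of_rat (bernoulli_num i) / fact i :: 'c"
  have "(\<lambda>N. fact j * (\<Sum>i\<le>j. ?b i * (of_nat (M N) ^ (j - i) * (1 / fact (Suc (j - i))))))
      \<longlonglongrightarrow> fact j * (\<Sum>i\<le>j. ?b i * (0 ^ (j - i) * (1 / fact (Suc (j - i)))))"
    by (intro tendsto_intros M(2))
  also have "(\<Sum>i\<le>j. ?b i * (0 ^ (j - i) * (1 / fact (Suc (j - i)))))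
      = (\<Sum>i\<in>{j}. ?b i * (0 ^ (j - i) * (1 / fact (Suc (j - i)))))"
    by (intro sum.mono_neutral_right) auto
  also have "fact j * \<dots> = of_rat (bernoulli_num j)" by simp
  also have "(\<lambda>N. fact j * (\<Sum>i\<le>j. ?b i * (of_nat (M N) ^ (j - i) * (1 / fact (Suc (j - i))))))
      = (\<lambda>N. power_mean j (M N))"
    by (simp add: sum_powers_bernoulli[OF M(1)] del: fact_Suc)
  finally show ?thesis .
qed

lemma vabs_power_diff_le:
  assumes "vabs (x :: 'c::complete_ultrametric_field) \<le> 1" "vabs y \<le> 1"
  shows "vabs (x ^ j - y ^ j) \<le> vabs (x - y)"
proof (induction j)
  case (Suc j)
  have "x ^ Suc j - y ^ Suc j = x * (x ^ j - y ^ j) + (x - y) * y ^ j" by (simp add: algebra_simps)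
  moreover have "vabs (x * (x ^ j - y ^ j)) \<le> 1 * vabs (x - y)"
    unfolding vabs_mult using assms Suc by (intro mult_mono) auto
  moreover have "vabs ((x - y) * y ^ j) \<le> vabs (x - y) * 1"
    unfolding vabs_mult vabs_power using assms by (intro mult_left_mono power_le_one) auto
  ultimately show ?case by (simp add: vabs_add_le del: power_Suc)
qed simp

lemma vabs_power_taylor_le:
  assumes "vabs (x :: 'c::complete_ultrametric_field) \<le> 1" "vabs y \<le> 1"
  shows "vabs ((x + y) ^ j - x ^ j - of_nat j * x ^ (j - 1) * y) \<le> vabs y ^ 2"
proof (induction j)
  case (Suc j)
  let ?d = "(x + y) ^ j - x ^ j - of_nat j * x ^ (j - 1) * y"
  have xj: "of_nat j * x ^ (j - 1) * x = of_nat j * x ^ j" by (cases j) auto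
  have "(x + y) ^ Suc j - x ^ Suc j - of_nat (Suc j) * x ^ (Suc j - 1) * y
      = (x + y) * ?d + of_nat j * x ^ (j - 1) * y ^ 2
        + (of_nat j * x ^ (j - 1) * x - of_nat j * x ^ j) * y"
    by (simp add: algebra_simps power2_eq_square)
  also have "\<dots> = (x + y) * ?d + of_nat j * x ^ (j - 1) * y ^ 2" by (simp only: xj) simp
  also have "vabs \<dots> \<le> vabs y ^ 2"
  proof (rule vabs_add_le)
    have "vabs ((x + y) * ?d) \<le> 1 * vabs y ^ 2"
      unfolding vabs_mult using Suc assms by (intro mult_mono vabs_add_le) auto
    then show "vabs ((x + y) * ?d) \<le> vabs y ^ 2" by simp
    have "vabs (of_nat j * x ^ (j - 1) * y ^ 2) \<le> (1 * 1) * vabs y ^ 2"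
      unfolding vabs_mult vabs_power using assms
      by (intro mult_mono vabs_of_nat_le_1 power_le_one) auto
    then show "vabs (of_nat j * x ^ (j - 1) * y ^ 2) \<le> vabs y ^ 2" by simp
  qed
  finally show ?case .
qed simp

lemma sum_lessThan_blocks:
  fixes f :: "nat \<Rightarrow> 'a::comm_monoid_add"
  shows "(\<Sum>k<n * M. f k) = (\<Sum>a<n. \<Sum>b<M. f (b + a * M))"
proof -
  have "(\<Sum>k<n * M. f k) = (\<Sum>a<n. sum f {a * M..<a * M + M})" by (simp add: sum.nat_group)
  also have "\<dots> = (\<Sum>a<n. \<Sum>b<M. f (b + a * M))"
    using sum.shift_bounds_nat_ivl[of f 0 "a * M" M for a]
    by (simp add: atLeast0LessThan add.commute)
  finally show ?thesis .
qed

text \<open>Multiplication by a primitive root g permutes the residues and multiplies the sum by \<open>g\<^sup>j\<close>, which is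
  not 1 mod p.\<close>

lemma prime_dvd_sum_powers:
  assumes p: "prime (p :: nat)" and j: "\<not> (p - 1) dvd j"
  shows "p dvd (\<Sum>k<p. k ^ j)"
proof -
  obtain g where g: "residue_primroot p g"
    using prime_primitive_root_exists[of p] p prime_gt_1_nat[OF p] by auto
  have g_ord: "ord p g = p - 1" and cop: "coprime p g"
    using g p by (auto simp: residue_primroot_def totient_prime)
  have bij: "bij_betw (\<lambda>k. g * k mod p) {..<p} {..<p}"
  proof -
    have "inj_on (\<lambda>k. g * k mod p) {..<p}"
    proof (rule inj_onI)
      fix x y assume xy: "x \<in> {..<p}" "y \<in> {..<p}" and eq: "g * x mod p = g * y mod p"
      then have "[g * x = g * y] (mod p)" by (simp add: cong_def)
      then have "[x = y] (mod p)"
        using cop by (simp add: cong_mult_lcancel_nat coprime_commute)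
      then show "x = y" using xy by (simp add: cong_less_modulus_unique_nat)
    qed
    moreover have "(\<lambda>k. g * k mod p) ` {..<p} \<subseteq> {..<p}" using p prime_gt_0_nat by auto
    ultimately show ?thesis by (simp add: bij_betw_def endo_inj_surj)
  qed
  have "(\<Sum>k<p. k ^ j) = (\<Sum>k<p. (g * k mod p) ^ j)"
    by (rule sum.reindex_bij_betw[OF bij, symmetric])
  also have "[\<dots> = (\<Sum>k<p. (g * k) ^ j)] (mod p)"
    by (intro cong_sum cong_pow) (simp add: cong_def)
  also have "(\<Sum>k<p. (g * k) ^ j) = g ^ j * (\<Sum>k<p. k ^ j)"
    by (simp add: power_mult_distrib sum_distrib_left)
  finally have "[int (g ^ j) * int (\<Sum>k<p. k ^ j) = int (\<Sum>k<p. k ^ j)] (mod int p)"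
    by (metis cong_int_iff cong_sym of_nat_mult)
  then have "int p dvd (int (g ^ j) - 1) * int (\<Sum>k<p. k ^ j)"
    by (simp add: cong_iff_dvd_diff algebra_simps)
  moreover have "\<not> int p dvd int (g ^ j) - 1"
  proof
    assume "int p dvd int (g ^ j) - 1"
    then have "[int (g ^ j) = int 1] (mod int p)" by (simp add: cong_iff_dvd_diff)
    then have "[g ^ j = 1] (mod p)" by (simp only: cong_int_iff)
    then show False using j by (simp only: ord_divides g_ord)
  qed
  ultimately have "int p dvd int (\<Sum>k<p. k ^ j)"
    using p by (metis prime_dvd_mult_iff prime_nat_int_transfer)
  then show ?thesis by (simp only: int_dvd_int_iff)
qed

context residue_char
begin

lemma power_mean_step:
  assumes M: "M > 0"
  shows "power_mean j (p * M) - (power_mean j M :: 'c)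
    = (\<Sum>a<p. \<Sum>b<M. (of_nat b + of_nat a * of_nat M) ^ j - of_nat b ^ j) / of_nat (p * M)"
proof -
  have "(\<Sum>k<p * M. of_nat k ^ j :: 'c) = (\<Sum>a<p. \<Sum>b<M. (of_nat b + of_nat a * of_nat M) ^ j)"
    by (simp add: sum_lessThan_blocks)
  moreover have "(power_mean j M :: 'c) = (\<Sum>a<p. \<Sum>b<M. of_nat b ^ j) / of_nat (p * M)"
    using M p_pos by (simp add: power_mean_def)
  ultimately show ?thesis
    by (simp add: power_mean_def sum_subtractf diff_divide_distrib)
qed

text \<open>Each difference \<open>(b + a M)\<^sup>j - b\<^sup>j\<close> is divisible by M, and \<open>M / (p M)\<close> has absolute value p.\<close>

lemma vabs_power_mean_step_le:
  assumes M: "M > 0"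
  shows "vabs (power_mean j (p * M) - (power_mean j M :: 'c)) \<le> real p"
proof -
  have M0: "vabs (of_nat M :: 'c) > 0" using M by simp
  have "vabs ((\<Sum>a<p. \<Sum>b<M. (of_nat b + of_nat a * of_nat M) ^ j - of_nat b ^ j) :: 'c)
      \<le> vabs (of_nat M :: 'c)"
  proof (intro vabs_sum_le)
    fix a b
    have "vabs ((of_nat b + of_nat a * of_nat M) ^ j - of_nat b ^ j :: 'c)
        \<le> vabs ((of_nat b + of_nat a * of_nat M) - of_nat b :: 'c)"
      using vabs_of_nat_le_1[of "b + a * M", where 'c='c] vabs_of_nat_le_1
      by (intro vabs_power_diff_le) auto
    also have "\<dots> = vabs (of_nat a :: 'c) * vabs (of_nat M :: 'c)" by (simp add: vabs_mult)
    also have "\<dots> \<le> 1 * vabs (of_nat M :: 'c)" by (intro mult_right_mono vabs_of_nat_le_1) simp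
    finally show "vabs ((of_nat b + of_nat a * of_nat M) ^ j - of_nat b ^ j :: 'c)
        \<le> vabs (of_nat M :: 'c)" by simp
  qed simp_all
  then show ?thesis
    using M0 p_pos
    by (simp only: power_mean_step[OF M] vabs_divide) (simp add: vabs_mult vabs_p field_simps)
qed

text \<open>To first order in M the differences are \<open>j b\<^sup>j\<^sup>-\<^sup>1 a M\<close>; summed over a they contribute the
  additional factor \<open>p (p - 1)/2\<close>.  The remainder is divisible by \<open>M\<^sup>2\<close>, hence by \<open>p M\<close>.\<close>

lemma vabs_power_mean_step_le_1:
  assumes M: "M > 0" and pM: "p dvd M" and odd: "odd p"
  shows "vabs (power_mean j (p * M) - (power_mean j M :: 'c)) \<le> 1"
proof -
  have M0: "vabs (of_nat M :: 'c) > 0" using M by simp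
  let ?m = "of_nat M :: 'c"
  let ?R = "\<lambda>a b. (of_nat b + of_nat a * ?m) ^ j - of_nat b ^ j
    - of_nat j * of_nat b ^ (j - 1) * (of_nat a * ?m)"
  have split: "(\<Sum>a<p. \<Sum>b<M. (of_nat b + of_nat a * ?m) ^ j - of_nat b ^ j)
      = (\<Sum>a<p. \<Sum>b<M. ?R a b)
        + (\<Sum>b<M. of_nat j * of_nat b ^ (j - 1)) * ?m * (\<Sum>a<p. of_nat a)"
    by (simp add: sum_subtractf sum_distrib_left sum_distrib_right mult_ac sum.swap[of _ "{..<p}"])
  have "vabs ((\<Sum>a<p. \<Sum>b<M. ?R a b)
        + (\<Sum>b<M. of_nat j * of_nat b ^ (j - 1)) * ?m * (\<Sum>a<p. of_nat a)) \<le> vabs ?m / real p"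
  proof (intro vabs_add_le vabs_sum_le)
    fix a b
    have am: "vabs (of_nat a * ?m) \<le> vabs ?m"
      using mult_right_mono[OF vabs_of_nat_le_1[of a, where 'c='c], of "vabs ?m"]
      by (simp add: vabs_mult)
    have "vabs (?R a b) \<le> vabs (of_nat a * ?m) ^ 2"
      using vabs_of_nat_le_1[of "a * M", where 'c='c] vabs_of_nat_le_1
      by (intro vabs_power_taylor_le) auto
    also have "\<dots> \<le> vabs ?m * vabs ?m"
      unfolding power2_eq_square using am by (intro mult_mono) auto
    also have "\<dots> \<le> vabs ?m * (1 / real p)"
      using vabs_of_nat_dvd[OF pM] by (intro mult_left_mono) auto
    finally show "vabs (?R a b) \<le> vabs ?m / real p" by simp
  next
    have "(\<Sum>a<p. a) = p * ((p - 1) div 2)"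
      using gauss_sum_nat[of "p - 1"] p_pos odd
      by (auto simp: lessThan_Suc_atMost[symmetric] atLeast0AtMost elim!: oddE)
    then have dvd: "p dvd (\<Sum>a<p. a)" by simp
    have "vabs (\<Sum>a<p. of_nat a :: 'c) \<le> 1 / real p"
      using vabs_of_nat_dvd[OF dvd] by (simp only: of_nat_sum)
    moreover have "vabs (\<Sum>b<M. of_nat j * of_nat b ^ (j - 1) :: 'c) \<le> 1"
      using vabs_of_nat_le_1[of "\<Sum>b<M. j * b ^ (j - 1)", where 'c='c] by simp
    ultimately have "vabs ((\<Sum>b<M. of_nat j * of_nat b ^ (j - 1)) * ?m * (\<Sum>a<p. of_nat a))
        \<le> 1 * vabs ?m * (1 / real p)"
      unfolding vabs_mult by (intro mult_mono) auto
    then show "vabs ((\<Sum>b<M. of_nat j * of_nat b ^ (j - 1)) * ?m * (\<Sum>a<p. of_nat a))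
        \<le> vabs ?m / real p" by simp
  qed simp_all
  then show ?thesis
    using M0 p_pos
    by (simp only: power_mean_step[OF M] split vabs_divide) (simp add: vabs_mult vabs_p field_simps)
qed

lemma of_nat_mult_p_power_tendsto_0: "(\<lambda>N. of_nat (m * p ^ N) :: 'c) \<longlonglongrightarrow> 0"
proof (rule tendsto_vabs_le)
  show "(\<lambda>N. (1 / real p) ^ N) \<longlonglongrightarrow> 0"
    using p_ge_2 by (intro LIMSEQ_realpow_zero) auto
  show "vabs (of_nat (m * p ^ N) - 0 :: 'c) \<le> (1 / real p) ^ N" for N
    using mult_right_mono[OF vabs_of_nat_le_1[of m, where 'c='c], of "(1 / real p) ^ N"]
    by (simp add: vabs_mult vabs_power vabs_p)
qed

lemma vabs_power_mean_le:
  assumes "m > 0"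
  shows "vabs (power_mean j (m * p ^ N) :: 'c) \<le> max (real p) (1 / vabs (of_nat m :: 'c))"
proof (induction N)
  case 0
  have "vabs (\<Sum>k<m. of_nat k ^ j :: 'c) \<le> 1"
    using vabs_of_nat_le_1[of "\<Sum>k<m. k ^ j", where 'c='c] by simp
  then have "vabs (power_mean j m :: 'c) \<le> 1 / vabs (of_nat m :: 'c)"
    by (simp add: power_mean_def vabs_divide divide_right_mono)
  then show ?case by simp
next
  case (Suc N)
  let ?M = "m * p ^ N"
  have eq: "power_mean j (m * p ^ Suc N)
      = (power_mean j (p * ?M) - power_mean j ?M) + (power_mean j ?M :: 'c)"
    by (simp add: mult_ac)
  have "vabs (power_mean j (p * ?M) - power_mean j ?M :: 'c) \<le> real p"
    using assms p_pos by (intro vabs_power_mean_step_le) simp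
  then show ?case unfolding eq using Suc by (intro vabs_add_le) auto
qed

text \<open>The means along \<open>M = p\<^sup>N\<close> start with an integer and change by elements of absolute value at most p.\<close>

lemma vabs_bernoulli_le: "vabs (of_rat (bernoulli_num j) :: 'c) \<le> real p"
proof (rule vabs_limit_le)
  show "(\<lambda>N. power_mean j (1 * p ^ N)) \<longlonglongrightarrow> (of_rat (bernoulli_num j) :: 'c)"
    using p_pos by (intro power_mean_tendsto of_nat_mult_p_power_tendsto_0) simp
  show "vabs (power_mean j (1 * p ^ N) :: 'c) \<le> real p" for N
    using vabs_power_mean_le[of 1 j N] p_pos by (auto simp: max_def split: if_splits)
qed simp

text \<open>The easy half of the von Staudt--Clausen theorem: the first mean, over a full period mod p,
  is p-integral since the power sum is divisible by p, and the later ones differ from it by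
  p-integers.\<close>

lemma vabs_bernoulli_le_1:
  assumes "odd p" "\<not> (p - 1) dvd j"
  shows "vabs (of_rat (bernoulli_num j) :: 'c) \<le> 1"
proof (rule vabs_limit_le)
  show "(\<lambda>N. power_mean j (p * p ^ N)) \<longlonglongrightarrow> (of_rat (bernoulli_num j) :: 'c)"
    using p_pos by (intro power_mean_tendsto of_nat_mult_p_power_tendsto_0) simp
  show "vabs (power_mean j (p * p ^ N) :: 'c) \<le> 1" for N
  proof (induction N)
    case 0
    have "vabs (\<Sum>k<p. of_nat k ^ j :: 'c) \<le> 1 / real p"
      using vabs_of_nat_dvd[OF prime_dvd_sum_powers[OF prime_p assms(2)]] by simp
    then show ?case using p_pos by (simp add: power_mean_def vabs_divide vabs_p field_simps)
  next
    case (Suc N)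
    let ?M = "p * p ^ N"
    have eq: "power_mean j (p * p ^ Suc N)
        = (power_mean j (p * ?M) - power_mean j ?M) + (power_mean j ?M :: 'c)" by simp
    have "vabs (power_mean j (p * ?M) - power_mean j ?M :: 'c) \<le> 1"
      using assms p_pos by (intro vabs_power_mean_step_le_1) simp_all
    then show ?case unfolding eq using Suc by (intro vabs_add_le) auto
  qed
qed simp

end

section \<open>Logarithm, exponential and binomial series\<close>

lemma sums_Suc_vabs:
  fixes f :: "nat \<Rightarrow> 'c::complete_ultrametric_field"
  assumes "f sums s"
  shows "(\<lambda>n. f (Suc n)) sums (s - f 0)"
proof -
  have "(\<lambda>n. (\<Sum>i<Suc n. f i) - f 0) \<longlonglongrightarrow> s - f 0"
    using assms unfolding sums_def by (intro tendsto_diff tendsto_const) (rule LIMSEQ_Suc)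
  then show ?thesis unfolding sums_def by (simp only: sum.lessThan_Suc_shift) simp
qed

lemma tendsto_gbinomial:
  "(f \<longlongrightarrow> (a :: 'c::complete_ultrametric_field)) F \<Longrightarrow> ((\<lambda>x. f x gchoose j) \<longlongrightarrow> a gchoose j) F"
proof -
  assume f: "(f \<longlongrightarrow> a) F"
  have eq: "(b gchoose j) = (\<Prod>i = 0..<j. b - of_nat i) * (1 / fact j)" for b :: 'c
    by (simp add: gbinomial_prod_rev)
  show ?thesis unfolding eq by (intro tendsto_intros f)
qed

lemma gbinomial_minus_one: "(- 1 :: 'a::field_char_0) gchoose j = (- 1) ^ j"
  using gbinomial_minus[of "1 :: 'a" j] binomial_gbinomial[of j j, where ?'a = 'a] by simp

lemma binomial_sums_of_nat:
  fixes x :: "'c::complete_ultrametric_field"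
  shows "(\<lambda>j. (of_nat N gchoose j) * x ^ j) sums (1 + x) ^ N"
proof -
  have "(\<lambda>j. (of_nat N gchoose j) * x ^ j) sums (\<Sum>j\<le>N. (of_nat N gchoose j) * x ^ j)"
    by (rule sums_finite) (auto simp: binomial_gbinomial[symmetric] binomial_eq_0)
  also have "(\<Sum>j\<le>N. (of_nat N gchoose j) * x ^ j) = (1 + x) ^ N"
    by (subst add.commute, subst binomial_ring) (simp add: binomial_gbinomial)
  finally show ?thesis .
qed

definition plog :: "'c::complete_ultrametric_field \<Rightarrow> 'c" where
  "plog u = suminf (\<lambda>n. (- 1) ^ n * (u - 1) ^ Suc n / of_nat (Suc n))"

definition binom_series :: "'c::complete_ultrametric_field \<Rightarrow> 'c \<Rightarrow> 'c" where
  "binom_series x s = suminf (\<lambda>j. (s gchoose j) * x ^ j)"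

context residue_char
begin

lemma vabs_log_term:
  "vabs ((- 1) ^ n * x ^ Suc n / of_nat (Suc n) :: 'c) = vabs x ^ Suc n / vabs (of_nat (Suc n) :: 'c)"
  by (simp add: vabs_mult vabs_divide vabs_power del: of_nat_Suc power_Suc)

lemma log_bound_tendsto_0:
  assumes "vabs (x :: 'c) < 1"
  shows "(\<lambda>n. vabs x ^ Suc n / vabs (of_nat (Suc n) :: 'c)) \<longlonglongrightarrow> 0"
proof (rule real_tendsto_sandwich[OF _ _ tendsto_const])
  show "(\<lambda>n. real (Suc n) * vabs x ^ Suc n) \<longlonglongrightarrow> 0"
    using assms by (intro LIMSEQ_Suc powser_times_n_limit_0) simp
  have "vabs x ^ Suc n / vabs (of_nat (Suc n) :: 'c) \<le> vabs x ^ Suc n / (1 / real (Suc n))" for n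
    using vabs_of_nat_ge_inverse[of "Suc n"] by (intro divide_left_mono) (auto simp del: of_nat_Suc)
  then show "eventually (\<lambda>n. vabs x ^ Suc n / vabs (of_nat (Suc n) :: 'c)
      \<le> real (Suc n) * vabs x ^ Suc n) sequentially"
    by (simp add: mult.commute)
qed (simp del: of_nat_Suc)

lemma plog_sums:
  assumes "vabs (x :: 'c) < 1"
  shows "(\<lambda>n. (- 1) ^ n * x ^ Suc n / of_nat (Suc n)) sums plog (1 + x)"
proof -
  have "(\<lambda>n. (- 1) ^ n * x ^ Suc n / of_nat (Suc n)) \<longlonglongrightarrow> 0"
    unfolding tendsto_vabs_0_iff vabs_log_term by (rule log_bound_tendsto_0[OF assms])
  then have "summable (\<lambda>n. (- 1) ^ n * x ^ Suc n / of_nat (Suc n))" by (rule summable_vabs)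
  then show ?thesis by (simp add: plog_def summable_sums del: of_nat_Suc power_Suc)
qed

lemma plog_1 [simp]: "plog (1 :: 'c) = 0"
  by (simp add: plog_def)

lemma of_nat_p_power_tendsto_0: "(\<lambda>k. of_nat p ^ k :: 'c) \<longlonglongrightarrow> 0"
  using of_nat_mult_p_power_tendsto_0[of 1] by simp

text \<open>The logarithm as the derivative at 0 of \<open>t \<mapsto> (1 + x)\<^sup>t\<close>, taken along the powers of p.
  Applied with \<open>s = 1\<close> it turns the additivity of the logarithm into an identity between limits;
  with general s it computes the logarithm of a binomial series.\<close>

lemma binomial_difference_quotient:
  fixes x s :: 'c
  assumes x: "vabs x < 1"
    and le: "\<And>k j. vabs (s / of_nat (Suc j) * ((of_nat p ^ k * s - 1) gchoose j) * x ^ Suc j) \<le> M j"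
    and M: "M \<longlonglongrightarrow> 0"
    and g: "\<And>k. (\<lambda>j. ((of_nat p ^ k * s) gchoose j) * x ^ j) sums g k"
  shows "(\<lambda>k. (g k - 1) / of_nat p ^ k) \<longlonglongrightarrow> s * plog (1 + x)"
proof (rule tendsto_suminf_dominated[OF _ le M])
  show "(\<lambda>j. s * ((- 1) ^ j * x ^ Suc j / of_nat (Suc j))) sums (s * plog (1 + x))"
    by (intro sums_mult_vabs plog_sums x)
  fix k
  have "(\<lambda>j. ((of_nat p ^ k * s) gchoose Suc j) * x ^ Suc j) sums (g k - 1)"
    using sums_Suc_vabs[OF g[of k]] by simp
  then have "(\<lambda>j. 1 / of_nat p ^ k * (((of_nat p ^ k * s) gchoose Suc j) * x ^ Suc j))
      sums (1 / of_nat p ^ k * (g k - 1))"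
    by (rule sums_mult_vabs)
  moreover have "1 / of_nat p ^ k * (((of_nat p ^ k * s) gchoose Suc j) * x ^ Suc j)
      = s / of_nat (Suc j) * ((of_nat p ^ k * s - 1) gchoose j) * x ^ Suc j" for j
  proof -
    have "(of_nat p ^ k * s) gchoose Suc j
        = of_nat p ^ k * s / of_nat (Suc j) * ((of_nat p ^ k * s - 1) gchoose j)"
      using gbinomial_absorption'[of "Suc j" "of_nat p ^ k * s"] by (simp del: of_nat_Suc)
    then show ?thesis using p_pos by (simp del: of_nat_Suc power_Suc)
  qed
  ultimately show "(\<lambda>j. s / of_nat (Suc j) * ((of_nat p ^ k * s - 1) gchoose j) * x ^ Suc j)
      sums ((g k - 1) / of_nat p ^ k)" by simp
next
  fix j
  have "(\<lambda>k. s / of_nat (Suc j) * ((of_nat p ^ k * s - 1) gchoose j) * x ^ Suc j)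
      \<longlonglongrightarrow> s / of_nat (Suc j) * ((0 * s - 1) gchoose j) * x ^ Suc j"
    by (intro tendsto_intros tendsto_gbinomial of_nat_p_power_tendsto_0)
  then show "(\<lambda>k. s / of_nat (Suc j) * ((of_nat p ^ k * s - 1) gchoose j) * x ^ Suc j)
      \<longlonglongrightarrow> s * ((- 1) ^ j * x ^ Suc j / of_nat (Suc j))"
    by (simp add: gbinomial_minus_one field_simps del: of_nat_Suc power_Suc)
qed

lemma plog_limit:
  fixes u :: 'c
  assumes "vabs (u - 1) < 1"
  shows "(\<lambda>k. (u ^ (p ^ k) - 1) / of_nat p ^ k) \<longlonglongrightarrow> plog u"
proof -
  let ?x = "u - 1"
  have le: "vabs (1 / of_nat (Suc j) * ((of_nat p ^ k * 1 - 1) gchoose j) * ?x ^ Suc j)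
      \<le> vabs ?x ^ Suc j / vabs (of_nat (Suc j) :: 'c)" for k j
  proof -
    have "(of_nat p ^ k * 1 - 1 :: 'c) = of_nat (p ^ k - 1)"
      using p_pos by (simp add: of_nat_diff)
    then have "((of_nat p ^ k * 1 - 1 :: 'c) gchoose j) = of_nat ((p ^ k - 1) choose j)"
      by (simp only: binomial_gbinomial)
    then have "vabs ((of_nat p ^ k * 1 - 1 :: 'c) gchoose j) \<le> 1"
      by (simp only: vabs_of_nat_le_1)
    then have "vabs ((of_nat p ^ k * 1 - 1 :: 'c) gchoose j)
        * (vabs ?x ^ Suc j / vabs (of_nat (Suc j) :: 'c))
      \<le> 1 * (vabs ?x ^ Suc j / vabs (of_nat (Suc j) :: 'c))"
      by (intro mult_right_mono) (auto simp del: of_nat_Suc)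
    then show ?thesis
      by (simp add: vabs_mult vabs_divide vabs_power field_simps del: of_nat_Suc power_Suc)
  qed
  have g: "(\<lambda>j. ((of_nat p ^ k * 1) gchoose j) * ?x ^ j) sums u ^ (p ^ k)" for k
    using binomial_sums_of_nat[of "p ^ k" ?x] by simp
  show ?thesis
    using binomial_difference_quotient[OF assms le log_bound_tendsto_0[OF assms] g] by simp
qed

lemma power_p_power_tendsto_1:
  assumes "vabs (u - 1 :: 'c) < 1"
  shows "(\<lambda>k. u ^ (p ^ k)) \<longlonglongrightarrow> 1"
proof -
  have "(\<lambda>k. (u ^ (p ^ k) - 1) / of_nat p ^ k * of_nat p ^ k + 1) \<longlonglongrightarrow> plog u * 0 + 1"
    by (intro tendsto_intros plog_limit assms of_nat_p_power_tendsto_0)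
  then show ?thesis using p_pos by simp
qed

lemma vabs_eq_1_if_near: "vabs (u - 1 :: 'c) < 1 \<Longrightarrow> vabs u = 1"
  using vabs_eq_if_close[of u 1] by simp

lemma near_1_mult:
  assumes "vabs (u - 1 :: 'c) < C" "vabs (v - 1 :: 'c) < C" "C \<le> 1"
  shows "vabs (u * v - 1) < C"
proof -
  have eq: "u * v - 1 = (u - 1) * v + (v - 1)" by (simp add: algebra_simps)
  have "vabs v = 1" using assms by (intro vabs_eq_1_if_near) simp
  then show ?thesis unfolding eq using assms by (intro vabs_add_less) (simp_all add: vabs_mult)
qed

lemma near_1_divide:
  assumes "vabs (u - 1 :: 'c) < C" "vabs (v - 1 :: 'c) < C" "C \<le> 1"
  shows "vabs (u / v - 1) < C"
proof -
  have v: "vabs v = 1" using assms by (intro vabs_eq_1_if_near) simp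
  then have "v \<noteq> 0" by auto
  then have "u / v - 1 = (u - 1 - (v - 1)) / v" by (simp add: field_simps)
  then show ?thesis using vabs_diff_less[OF assms(1,2)] by (simp add: vabs_divide v)
qed

lemma near_1_power:
  assumes "vabs (u - 1 :: 'c) < C" "C \<le> 1" "0 < C"
  shows "vabs (u ^ n - 1) < C"
  using assms by (induction n) (auto intro!: near_1_mult)

text \<open>\<open>(u v)\<^sup>N - 1 = (u\<^sup>N - 1) v\<^sup>N + (v\<^sup>N - 1)\<close>, divided by N and taken to the limit.\<close>

lemma plog_mult:
  fixes u v :: 'c
  assumes u: "vabs (u - 1) < 1" and v: "vabs (v - 1) < 1"
  shows "plog (u * v) = plog u + plog v"
proof (rule LIMSEQ_unique)
  show "(\<lambda>k. ((u * v) ^ (p ^ k) - 1) / of_nat p ^ k) \<longlonglongrightarrow> plog (u * v)"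
    by (intro plog_limit near_1_mult u v) simp
  have "(\<lambda>k. (u ^ (p ^ k) - 1) / of_nat p ^ k * v ^ (p ^ k) + (v ^ (p ^ k) - 1) / of_nat p ^ k)
      \<longlonglongrightarrow> plog u * 1 + plog v"
    by (intro tendsto_intros plog_limit power_p_power_tendsto_1 u v)
  also have "(\<lambda>k. (u ^ (p ^ k) - 1) / of_nat p ^ k * v ^ (p ^ k) + (v ^ (p ^ k) - 1) / of_nat p ^ k)
      = (\<lambda>k. ((u * v) ^ (p ^ k) - 1) / of_nat p ^ k)"
    using p_pos by (simp add: fun_eq_iff field_simps power_mult_distrib)
  finally show "(\<lambda>k. ((u * v) ^ (p ^ k) - 1) / of_nat p ^ k) \<longlonglongrightarrow> plog u + plog v" by simp
qed

lemma plog_power: "vabs (u - 1 :: 'c) < 1 \<Longrightarrow> plog (u ^ n) = of_nat n * plog u"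
  by (induction n) (simp_all add: plog_mult near_1_power algebra_simps)

lemma vabs_log_term_le:
  fixes x :: 'c
  shows "vabs ((- 1) ^ n * x ^ Suc n / of_nat (Suc n)) \<le> vabs x * (vabs x / rad) ^ n"
proof -
  have "vabs x ^ Suc n / vabs (of_nat (Suc n) :: 'c) \<le> vabs x ^ Suc n / rad ^ n"
    using vabs_of_nat_ge[of "Suc n"] rad_pos by (intro divide_left_mono) (auto simp del: of_nat_Suc)
  then show ?thesis unfolding vabs_log_term by (simp add: power_divide)
qed

lemma ratio_power_le_1: "vabs (x :: 'c) < rad \<Longrightarrow> (vabs x / rad) ^ n \<le> 1"
  using rad_pos by (intro power_le_one) auto

lemma vabs_less_1_if_rad: "vabs (x :: 'c) < rad \<Longrightarrow> vabs x < 1"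
  using rad_less_1 by simp

lemma vabs_plog_le:
  assumes "vabs (x :: 'c) < rad"
  shows "vabs (plog (1 + x)) \<le> vabs x"
proof (rule sums_vabs_le[OF plog_sums[OF vabs_less_1_if_rad[OF assms]]])
  fix n
  have "vabs x * (vabs x / rad) ^ n \<le> vabs x * 1"
    by (intro mult_left_mono ratio_power_le_1 assms) simp
  then show "vabs ((- 1) ^ n * x ^ Suc n / of_nat (Suc n)) \<le> vabs x"
    using vabs_log_term_le[of n x] by linarith
qed

text \<open>On this disc the linear term of the logarithm series strictly dominates the others.\<close>

lemma plog_eq_0D:
  assumes u: "vabs (u - 1 :: 'c) < rad" and 0: "plog u = 0"
  shows "u = 1"
proof (rule ccontr)
  define x where "x = u - 1"
  assume "u \<noteq> 1"
  then have x0: "vabs x > 0" by (simp add: x_def)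
  have x: "vabs x < rad" using u by (simp add: x_def)
  let ?f = "\<lambda>n. (- 1) ^ n * x ^ Suc n / of_nat (Suc n)"
  have sums: "?f sums 0" using plog_sums[OF vabs_less_1_if_rad[OF x]] 0 by (simp add: x_def)
  have f0: "?f \<longlonglongrightarrow> 0"
    unfolding tendsto_vabs_0_iff vabs_log_term
    by (rule log_bound_tendsto_0[OF vabs_less_1_if_rad[OF x]])
  have "vabs (0 - ?f 0) < vabs x"
  proof (rule sums_vabs_less[OF sums_Suc_vabs[OF sums] LIMSEQ_Suc[OF f0]])
    fix n
    have "(vabs x / rad) ^ Suc n < 1" using x rad_pos by (intro power_less_one_iff[THEN iffD2]) auto
    then have "vabs x * (vabs x / rad) ^ Suc n < vabs x * 1" using x0 by (intro mult_strict_left_mono)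
    then show "vabs (?f (Suc n)) < vabs x" using vabs_log_term_le[of "Suc n" x] by linarith
  qed
  then show False by simp
qed

lemma plog_inj:
  assumes u: "vabs (u - 1 :: 'c) < rad" and v: "vabs (v - 1) < rad" and eq: "plog u = plog v"
  shows "u = v"
proof -
  have v0: "v \<noteq> 0" using vabs_eq_1_if_near[OF vabs_less_1_if_rad[OF v]] by auto
  have w: "vabs (u / v - 1) < rad" using u v rad_less_1 by (intro near_1_divide) auto
  have "plog (u / v * v) = plog (u / v) + plog v"
    by (intro plog_mult vabs_less_1_if_rad w v)
  then have "plog (u / v) = 0" using v0 eq by simp
  then have "u / v = 1" by (intro plog_eq_0D w)
  then show ?thesis using v0 by simp
qed

lemma vabs_exp_term_le:
  fixes y :: 'c
  shows "vabs (y ^ Suc n / fact (Suc n)) \<le> vabs y * (vabs y / rad) ^ n"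
proof -
  have "vabs y ^ Suc n / vabs (fact (Suc n) :: 'c) \<le> vabs y ^ Suc n / rad ^ n"
    using vabs_fact_ge[of "Suc n"] rad_pos
    by (intro divide_left_mono) (auto simp del: fact_Suc intro!: mult_pos_pos)
  then show ?thesis by (simp add: power_divide vabs_divide vabs_power vabs_mult del: fact_Suc)
qed

lemma exp_terms_tendsto_0:
  assumes "vabs (y :: 'c) < rad"
  shows "(\<lambda>n. y ^ n / fact n) \<longlonglongrightarrow> 0"
proof (rule LIMSEQ_imp_Suc, rule tendsto_vabs_le)
  have "(\<lambda>n. vabs y * (vabs y / rad) ^ n) \<longlonglongrightarrow> vabs y * 0"
    using assms rad_pos by (intro tendsto_intros LIMSEQ_realpow_zero) auto
  then show "(\<lambda>n. vabs y * (vabs y / rad) ^ n) \<longlonglongrightarrow> 0" by simp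
  show "vabs (y ^ Suc n / fact (Suc n) - 0) \<le> vabs y * (vabs y / rad) ^ n" for n
    using vabs_exp_term_le[of y n] by (simp del: fact_Suc)
qed

lemma padic_exp_sums:
  assumes "vabs (y :: 'c) < rad"
  shows "(\<lambda>n. y ^ n / fact n) sums padic_exp y"
  unfolding padic_exp_def by (intro summable_sums summable_vabs exp_terms_tendsto_0 assms)

lemma padic_exp_0 [simp]: "padic_exp (0 :: 'c) = 1"
proof -
  have "(\<lambda>n. (0 :: 'c) ^ n / fact n) sums (\<Sum>n\<in>{0}. (0 :: 'c) ^ n / fact n)"
    by (rule sums_finite) auto
  then show ?thesis unfolding padic_exp_def using sums_unique by fastforce
qed

lemma vabs_padic_exp_minus_1_le:
  assumes "vabs (y :: 'c) < rad"
  shows "vabs (padic_exp y - 1) \<le> vabs y"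
proof -
  have "(\<lambda>n. y ^ Suc n / fact (Suc n)) sums (padic_exp y - 1)"
    using sums_Suc_vabs[OF padic_exp_sums[OF assms]] by simp
  then show ?thesis
  proof (rule sums_vabs_le)
    fix n
    have "vabs y * (vabs y / rad) ^ n \<le> vabs y * 1"
      by (intro mult_left_mono ratio_power_le_1 assms) simp
    then show "vabs (y ^ Suc n / fact (Suc n)) \<le> vabs y"
      using vabs_exp_term_le[of y n] by linarith
  qed
qed

lemma padic_exp_add:
  assumes "vabs (x :: 'c) < rad" "vabs y < rad"
  shows "padic_exp (x + y) = padic_exp x * padic_exp y"
proof (rule sums_unique2)
  show "(\<lambda>n. (x + y) ^ n / fact n) sums padic_exp (x + y)"
    by (intro padic_exp_sums vabs_add_less assms)
  have "(\<lambda>n. \<Sum>i\<le>n. x ^ i / fact i * (y ^ (n - i) / fact (n - i))) sums (padic_exp x * padic_exp y)"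
    by (intro sums_Cauchy_product padic_exp_sums exp_terms_tendsto_0 assms)
  moreover have "(\<Sum>i\<le>n. x ^ i / fact i * (y ^ (n - i) / fact (n - i))) = (x + y) ^ n / fact n" for n
    by (simp add: binomial_ring sum_divide_distrib binomial_fact field_simps)
  ultimately show "(\<lambda>n. (x + y) ^ n / fact n) sums (padic_exp x * padic_exp y)" by simp
qed

lemma vabs_of_nat_mult_le: "vabs (of_nat n * x :: 'c) \<le> vabs x"
  using mult_right_mono[OF vabs_of_nat_le_1[of n, where 'c='c], of "vabs x"] by (simp add: vabs_mult)

lemma padic_exp_of_nat_mult:
  assumes "vabs (y :: 'c) < rad"
  shows "padic_exp (of_nat n * y) = padic_exp y ^ n"
proof (induction n)
  case (Suc n)
  have "padic_exp (y + of_nat n * y) = padic_exp y * padic_exp (of_nat n * y)"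
    using assms vabs_of_nat_mult_le[of n y] by (intro padic_exp_add) auto
  then show ?case using Suc by (simp add: algebra_simps)
qed simp

text \<open>By the homomorphism property the quotients are \<open>(exp (p\<^sup>k y) - 1)/p\<^sup>k\<close>, and the exponential is
  \<open>1 + z\<close> up to an error quadratic in z.\<close>

lemma plog_padic_exp:
  assumes y: "vabs (y :: 'c) < rad"
  shows "plog (padic_exp y) = y"
proof (rule LIMSEQ_unique)
  show "(\<lambda>k. (padic_exp y ^ (p ^ k) - 1) / of_nat p ^ k) \<longlonglongrightarrow> plog (padic_exp y)"
    using vabs_padic_exp_minus_1_le[OF y] y rad_less_1 by (intro plog_limit) simp
  show "(\<lambda>k. (padic_exp y ^ (p ^ k) - 1) / of_nat p ^ k) \<longlonglongrightarrow> y"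
  proof (rule tendsto_vabs_le)
    show "(\<lambda>k. vabs y ^ 2 / rad * (1 / real p) ^ k) \<longlonglongrightarrow> 0"
      using p_ge_2 by (intro tendsto_mult_right_zero LIMSEQ_realpow_zero) auto
    fix k
    define z where "z = of_nat p ^ k * y"
    have vz: "vabs z = (1 / real p) ^ k * vabs y" by (simp add: z_def vabs_mult vabs_power vabs_p)
    have z: "vabs z < rad" using vabs_of_nat_mult_le[of "p ^ k" y] y by (simp add: z_def)
    have "(\<lambda>n. z ^ Suc (Suc n) / fact (Suc (Suc n))) sums (padic_exp z - 1 - z)"
      using sums_Suc_vabs[OF sums_Suc_vabs[OF padic_exp_sums[OF z]]] by simp
    then have "vabs (padic_exp z - 1 - z) \<le> vabs z * (vabs z / rad)"
    proof (rule sums_vabs_le)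
      fix n
      have "vabs z * ((vabs z / rad) * (vabs z / rad) ^ n) \<le> vabs z * ((vabs z / rad) * 1)"
        using rad_pos by (intro mult_left_mono ratio_power_le_1 z) auto
      then show "vabs (z ^ Suc (Suc n) / fact (Suc (Suc n))) \<le> vabs z * (vabs z / rad)"
        using vabs_exp_term_le[of z "Suc n"] by (simp del: fact_Suc)
    qed
    then have le: "vabs (padic_exp z - 1 - z) / (1 / real p) ^ k
        \<le> vabs z * (vabs z / rad) / (1 / real p) ^ k"
      by (intro divide_right_mono) auto
    have eq: "(padic_exp y ^ (p ^ k) - 1) / of_nat p ^ k - y = (padic_exp z - 1 - z) / of_nat p ^ k"
      using padic_exp_of_nat_mult[OF y, of "p ^ k"] p_pos by (simp add: z_def field_simps)
    have "vabs ((padic_exp y ^ (p ^ k) - 1) / of_nat p ^ k - y)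
        \<le> vabs z * (vabs z / rad) / (1 / real p) ^ k"
      using le by (simp only: eq vabs_divide vabs_power vabs_p)
    also have "\<dots> = vabs y ^ 2 / rad * (1 / real p) ^ k"
      using p_pos by (simp add: vz power2_eq_square field_simps)
    finally show "vabs ((padic_exp y ^ (p ^ k) - 1) / of_nat p ^ k - y)
        \<le> vabs y ^ 2 / rad * (1 / real p) ^ k" .
  qed
qed

lemma vabs_gbinomial_mult_fact_le:
  assumes "vabs (t :: 'c) \<le> R" "1 \<le> R"
  shows "vabs (t gchoose j) * vabs (fact j :: 'c) \<le> R ^ j"
proof -
  have "vabs (t gchoose j) * vabs (fact j :: 'c) = (\<Prod>i = 0..<j. vabs (t - of_nat i))"
    by (simp flip: vabs_mult add: gbinomial_mult_fact' vabs_prod)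
  also have "\<dots> \<le> (\<Prod>i = 0..<j. R)"
    using assms vabs_of_nat_le_1[where 'c='c] order_trans by (intro prod_mono) (auto intro!: vabs_diff_le)
  finally show ?thesis by simp
qed

text \<open>The extra factor j + 1 in the denominator, from \<open>(s choose (j + 1)) = s/(j + 1) ((s - 1) choose j)\<close>,
  completes \<open>j!\<close> to \<open>(j + 1)!\<close>, for which Legendre's bound still has the exponent j.\<close>

lemma vabs_binomial_term_le:
  fixes s t x :: 'c
  assumes "vabs t \<le> R" "1 \<le> R"
  shows "vabs (s / of_nat (Suc j) * (t gchoose j) * x ^ Suc j) \<le> vabs s * vabs x * (R * vabs x / rad) ^ j"
proof -
  have f0: "vabs (fact j :: 'c) > 0" by simp
  have "rad ^ j \<le> vabs (of_nat (Suc j) :: 'c) * vabs (fact j :: 'c)"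
    using vabs_fact_ge[of "Suc j"] by (simp flip: vabs_mult)
  then have "vabs (t gchoose j) * vabs (fact j :: 'c) / (vabs (of_nat (Suc j) :: 'c) * vabs (fact j :: 'c))
      \<le> R ^ j / rad ^ j"
    using rad_pos assms by (intro frac_le vabs_gbinomial_mult_fact_le) auto
  then have "vabs (t gchoose j) / vabs (of_nat (Suc j) :: 'c) \<le> R ^ j / rad ^ j"
    using f0 by (simp del: of_nat_Suc)
  then have "vabs s * vabs x ^ Suc j * (vabs (t gchoose j) / vabs (of_nat (Suc j) :: 'c))
      \<le> vabs s * vabs x ^ Suc j * (R ^ j / rad ^ j)"
    by (intro mult_left_mono) auto
  then show ?thesis
    by (simp add: vabs_mult vabs_divide vabs_power power_divide power_mult_distrib mult_ac del: of_nat_Suc)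
qed

text \<open>A domain on which both sides of \<open>(1 + x)\<^sup>s = exp (s log (1 + x))\<close> converge.\<close>

definition binom_dom :: "'c \<Rightarrow> 'c set" where
  "binom_dom x = {s. max 1 (vabs s) * vabs x < rad}"

lemma binom_dom_base: "s \<in> binom_dom x \<Longrightarrow> vabs x < rad"
  using mult_right_mono[of 1 "max 1 (vabs s)" "vabs x"] by (simp add: binom_dom_def)

lemma binom_dom_mult_less: "s \<in> binom_dom x \<Longrightarrow> vabs s * vabs x < rad"
  using mult_right_mono[of "vabs s" "max 1 (vabs s)" "vabs x"] by (simp add: binom_dom_def)

lemma binom_dom_add: "s \<in> binom_dom x \<Longrightarrow> t \<in> binom_dom x \<Longrightarrow> s + t \<in> binom_dom x"
proof -
  assume s: "s \<in> binom_dom x" and t: "t \<in> binom_dom x"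
  have "max 1 (vabs (s + t)) * vabs x \<le> max (max 1 (vabs s)) (max 1 (vabs t)) * vabs x"
    using vabs_ultrametric[of s t] by (intro mult_right_mono) auto
  also have "\<dots> < rad" using s t by (auto simp: binom_dom_def max_def)
  finally show ?thesis by (simp add: binom_dom_def)
qed

lemma binom_dom_of_nat_mult: "s \<in> binom_dom x \<Longrightarrow> of_nat n * s \<in> binom_dom x"
proof -
  assume s: "s \<in> binom_dom x"
  have "max 1 (vabs (of_nat n * s)) * vabs x \<le> max 1 (vabs s) * vabs x"
    using vabs_of_nat_mult_le[of n s] by (intro mult_right_mono) auto
  then show ?thesis using s by (simp add: binom_dom_def)
qed

lemma vabs_binomial_series_term_le:
  fixes s x :: 'c
  shows "vabs ((s gchoose Suc j) * x ^ Suc j)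
    \<le> vabs s * vabs x * (max 1 (vabs s) * vabs x / rad) ^ j"
proof -
  have "(s gchoose Suc j) = s / of_nat (Suc j) * ((s - 1) gchoose j)"
    using gbinomial_absorption'[of "Suc j" s] by (simp del: of_nat_Suc)
  then show ?thesis
    using vabs_binomial_term_le[of "s - 1" "max 1 (vabs s)" s j x] vabs_diff_le[of s _ 1]
    by (simp del: of_nat_Suc power_Suc)
qed

lemma binom_bound_tendsto_0:
  fixes x s :: 'c
  assumes "s \<in> binom_dom x"
  shows "(\<lambda>j. vabs s * vabs x * (max 1 (vabs s) * vabs x / rad) ^ j) \<longlonglongrightarrow> 0"
  using assms rad_pos unfolding binom_dom_def
  by (intro tendsto_mult_right_zero LIMSEQ_realpow_zero) auto

lemma binom_terms_tendsto_0:
  fixes x s :: 'c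
  assumes "s \<in> binom_dom x"
  shows "(\<lambda>j. (s gchoose j) * x ^ j) \<longlonglongrightarrow> 0"
proof (rule LIMSEQ_imp_Suc, rule tendsto_vabs_le[OF binom_bound_tendsto_0[OF assms]])
  show "vabs ((s gchoose Suc n) * x ^ Suc n - 0)
      \<le> vabs s * vabs x * (max 1 (vabs s) * vabs x / rad) ^ n" for n
    using vabs_binomial_series_term_le[of s n x] by simp
qed

lemma binom_series_sums:
  fixes x s :: 'c
  assumes "s \<in> binom_dom x"
  shows "(\<lambda>j. (s gchoose j) * x ^ j) sums binom_series x s"
  unfolding binom_series_def by (intro summable_sums summable_vabs binom_terms_tendsto_0 assms)

lemma binom_series_add:
  fixes x s t :: 'c
  assumes s: "s \<in> binom_dom x" and t: "t \<in> binom_dom x"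
  shows "binom_series x (s + t) = binom_series x s * binom_series x t"
proof (rule sums_unique2)
  show "(\<lambda>j. ((s + t) gchoose j) * x ^ j) sums binom_series x (s + t)"
    by (intro binom_series_sums binom_dom_add s t)
  have "(\<lambda>n. \<Sum>i\<le>n. (s gchoose i) * x ^ i * ((t gchoose (n - i)) * x ^ (n - i)))
      sums (binom_series x s * binom_series x t)"
    by (intro sums_Cauchy_product binom_series_sums binom_terms_tendsto_0 s t)
  moreover have "(\<Sum>i\<le>n. (s gchoose i) * x ^ i * ((t gchoose (n - i)) * x ^ (n - i)))
      = ((s + t) gchoose n) * x ^ n" for n
  proof -
    have "(\<Sum>i\<le>n. (s gchoose i) * x ^ i * ((t gchoose (n - i)) * x ^ (n - i)))
        = (\<Sum>i\<le>n. (s gchoose i) * (t gchoose (n - i)) * x ^ n)"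
      by (intro sum.cong refl) (auto simp: mult_ac simp flip: power_add)
    also have "\<dots> = ((s + t) gchoose n) * x ^ n"
      using gbinomial_Vandermonde[of s t n] by (simp add: atLeast0AtMost flip: sum_distrib_right)
    finally show ?thesis .
  qed
  ultimately show "(\<lambda>n. ((s + t) gchoose n) * x ^ n) sums (binom_series x s * binom_series x t)"
    by simp
qed

lemma binom_series_0 [simp]: "binom_series (x :: 'c) 0 = 1"
  using binomial_sums_of_nat[of 0 x] unfolding binom_series_def by (simp add: sums_iff)

lemma binom_series_of_nat_mult:
  fixes x s :: 'c
  assumes "s \<in> binom_dom x"
  shows "binom_series x (of_nat n * s) = binom_series x s ^ n"
proof (induction n)
  case (Suc n)
  have "binom_series x (s + of_nat n * s) = binom_series x s * binom_series x (of_nat n * s)"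
    by (intro binom_series_add binom_dom_of_nat_mult assms)
  then show ?case using Suc by (simp add: algebra_simps)
qed simp

lemma vabs_binom_series_minus_1:
  fixes x s :: 'c
  assumes s: "s \<in> binom_dom x"
  shows "vabs (binom_series x s - 1) < rad"
proof -
  have "(\<lambda>j. (s gchoose Suc j) * x ^ Suc j) sums (binom_series x s - 1)"
    using sums_Suc_vabs[OF binom_series_sums[OF s]] by simp
  then have "vabs (binom_series x s - 1) \<le> vabs s * vabs x"
  proof (rule sums_vabs_le)
    fix j
    have "vabs s * vabs x * (max 1 (vabs s) * vabs x / rad) ^ j \<le> vabs s * vabs x * 1"
      using s rad_pos by (intro mult_left_mono power_le_one) (auto simp: binom_dom_def)
    then show "vabs ((s gchoose Suc j) * x ^ Suc j) \<le> vabs s * vabs x"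
      using vabs_binomial_series_term_le[of s j x] by linarith
  qed
  then show ?thesis using binom_dom_mult_less[OF s] by simp
qed

text \<open>Both sides are homomorphisms in s, so that their logarithms can be computed from their
  behaviour near \<open>s = 0\<close>; the logarithms agree, and the logarithm is injective near 1.  This
  replaces the composition of power series by a limit.\<close>

lemma binom_series_eq_exp:
  fixes x s :: 'c
  assumes s: "s \<in> binom_dom x"
  shows "binom_series x s = padic_exp (s * plog (1 + x))"
proof (rule plog_inj)
  have x: "vabs x < rad" by (rule binom_dom_base[OF s])
  have "vabs (s * plog (1 + x)) \<le> vabs s * vabs x"
    unfolding vabs_mult by (intro mult_left_mono vabs_plog_le x) simp
  then have y: "vabs (s * plog (1 + x)) < rad" using binom_dom_mult_less[OF s] by simp
  show "vabs (binom_series x s - 1) < rad" by (rule vabs_binom_series_minus_1[OF s])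
  show "vabs (padic_exp (s * plog (1 + x)) - 1) < rad"
    using vabs_padic_exp_minus_1_le[OF y] y by simp
  have "plog (binom_series x s) = s * plog (1 + x)"
  proof (rule LIMSEQ_unique)
    show "(\<lambda>k. (binom_series x s ^ (p ^ k) - 1) / of_nat p ^ k) \<longlonglongrightarrow> plog (binom_series x s)"
      by (intro plog_limit vabs_less_1_if_rad vabs_binom_series_minus_1 s)
    show "(\<lambda>k. (binom_series x s ^ (p ^ k) - 1) / of_nat p ^ k) \<longlonglongrightarrow> s * plog (1 + x)"
    proof (rule binomial_difference_quotient[OF vabs_less_1_if_rad[OF x] _ binom_bound_tendsto_0[OF s]])
      fix k
      have ps: "of_nat p ^ k * s \<in> binom_dom x"
        using binom_dom_of_nat_mult[OF s, of "p ^ k"] by simp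
      show "(\<lambda>j. ((of_nat p ^ k * s) gchoose j) * x ^ j) sums binom_series x s ^ (p ^ k)"
        using binom_series_sums[OF ps] binom_series_of_nat_mult[OF s, of "p ^ k"] by simp
      fix j
      have "vabs (of_nat p ^ k * s - 1) \<le> max 1 (vabs s)"
        using vabs_of_nat_mult_le[of "p ^ k" s] by (intro vabs_diff_le) auto
      then show "vabs (s / of_nat (Suc j) * ((of_nat p ^ k * s - 1) gchoose j) * x ^ Suc j)
          \<le> vabs s * vabs x * (max 1 (vabs s) * vabs x / rad) ^ j"
        by (intro vabs_binomial_term_le) auto
    qed
  qed
  then show "plog (binom_series x s) = plog (padic_exp (s * plog (1 + x)))"
    by (simp add: plog_padic_exp[OF y])
qed

end

section \<open>The Iwasawa logarithm\<close>

lemma vabs_power_int: "vabs (x powi m) = vabs (x :: 'c::complete_ultrametric_field) powi m"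
  by (auto simp: power_int_def vabs_power vabs_inverse)

text \<open>A sum that vanishes cannot have a single term of maximal absolute value.\<close>

lemma ultrametric_sum_eq_0:
  fixes t :: "'i \<Rightarrow> 'c::complete_ultrametric_field"
  assumes "finite I" "sum t I = 0" "i \<in> I" "t i \<noteq> 0"
  obtains k l where "k \<in> I" "l \<in> I" "k \<noteq> l" "vabs (t k) = vabs (t l)" "t k \<noteq> 0"
proof -
  obtain k where k: "k \<in> I" "\<And>l. l \<in> I \<Longrightarrow> vabs (t l) \<le> vabs (t k)"
  proof -
    have "Max ((\<lambda>l. vabs (t l)) ` I) \<in> (\<lambda>l. vabs (t l)) ` I"
      using assms by (intro Max_in) auto
    then obtain k where "k \<in> I" "vabs (t k) = Max ((\<lambda>l. vabs (t l)) ` I)" by auto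
    then show ?thesis using assms(1) by (intro that[of k]) auto
  qed
  have tk: "vabs (t k) > 0" using k(2)[OF assms(3)] assms(4) by (metis less_le_trans vabs_pos_iff)
  have "\<exists>l\<in>I. l \<noteq> k \<and> vabs (t k) = vabs (t l)"
  proof (rule ccontr)
    assume "\<not> ?thesis"
    then have less: "vabs (t l) < vabs (t k)" if "l \<in> I - {k}" for l
      using that k(2)[of l] by fastforce
    have "vabs (sum t (I - {k})) < vabs (t k)"
      using less tk by (intro vabs_sum_less) auto
    then have "vabs (t k + sum t (I - {k})) = vabs (t k)" by (rule vabs_add_eq_left)
    then show False using assms k(1) tk by (simp add: sum.remove[of I k])
  qed
  then show ?thesis using k(1) tk that by auto
qed

definition p_power_valued :: "nat \<Rightarrow> real \<Rightarrow> bool" where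
  "p_power_valued p r \<longleftrightarrow> (\<exists>m. r = real p powi m)"

lemma p_power_valued_mult: "p > 0 \<Longrightarrow> p_power_valued p r \<Longrightarrow> p_power_valued p s \<Longrightarrow> p_power_valued p (r * s)"
  unfolding p_power_valued_def by (metis of_nat_0_less_iff order_less_irrefl power_int_add)

lemma p_power_valued_divide: "p > 0 \<Longrightarrow> p_power_valued p r \<Longrightarrow> p_power_valued p s \<Longrightarrow> p_power_valued p (r / s)"
  unfolding p_power_valued_def by (metis of_nat_0_less_iff order_less_irrefl power_int_diff)

context residue_char
begin

lemma vabs_of_nat_p_power_valued: "n > 0 \<Longrightarrow> p_power_valued p (vabs (of_nat n :: 'c))"
proof (induction n rule: less_induct)
  case (less n)
  show ?case
  proof (cases "p dvd n")
    case False
    then show ?thesis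
      by (auto simp: vabs_of_nat_not_dvd p_power_valued_def intro!: exI[of _ 0])
  next
    case True
    then obtain k where k: "n = p * k" by (elim dvdE)
    have "k < n" "k > 0" using k less.prems p_ge_2 by auto
    then have "p_power_valued p (vabs (of_nat k :: 'c))" by (rule less.IH)
    moreover have "p_power_valued p (1 / real p)"
      unfolding p_power_valued_def by (rule exI[of _ "- 1"]) (simp add: power_int_minus inverse_eq_divide)
    ultimately show ?thesis using p_pos by (simp only: k of_nat_mult vabs_mult vabs_p p_power_valued_mult)
  qed
qed

lemma vabs_of_int_eq_nat: "vabs (of_int a :: 'c) = vabs (of_nat (nat \<bar>a\<bar>) :: 'c)"
  by (cases "a \<ge> 0") auto

lemma vabs_of_int_not_dvd: "\<not> int p dvd a \<Longrightarrow> vabs (of_int a :: 'c) = 1"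
  unfolding vabs_of_int_eq_nat by (intro vabs_of_nat_not_dvd) (simp add: nat_dvd_iff flip: int_dvd_int_iff)

lemma vabs_of_int_dvd: "int p dvd a \<Longrightarrow> vabs (of_int a :: 'c) \<le> 1 / real p"
  unfolding vabs_of_int_eq_nat by (intro vabs_of_nat_dvd) (simp flip: int_dvd_int_iff)

lemma Qp_approx:
  assumes "(x :: 'c) \<in> Qp" "0 < e"
  obtains r where "vabs (x - of_rat r) < e"
  using assms unfolding Qp_def closure_approachable by (auto simp: dist_vabs vabs_minus_commute)

lemma vabs_of_rat_p_power_valued:
  assumes "r \<noteq> 0"
  shows "p_power_valued p (vabs (of_rat r :: 'c))"
proof -
  obtain a b where ab: "quotient_of r = (a, b)" by force
  have b: "b > 0" using quotient_of_denom_pos[OF ab] .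
  have r: "r = of_int a / of_int b" using quotient_of_div[OF ab] .
  have a: "a \<noteq> 0" using r assms by auto
  have "vabs (of_rat r :: 'c) = vabs (of_int a :: 'c) / vabs (of_int b :: 'c)"
    by (simp add: r of_rat_divide vabs_divide)
  then show ?thesis
    using a b p_pos unfolding vabs_of_int_eq_nat
    by (simp only:) (intro p_power_valued_divide vabs_of_nat_p_power_valued; simp)
qed

lemma vabs_Qp_p_power_valued:
  assumes "(x :: 'c) \<in> Qp" "x \<noteq> 0"
  shows "p_power_valued p (vabs x)"
proof -
  obtain r where r: "vabs (x - of_rat r) < vabs x"
    using Qp_approx[OF assms(1), of "vabs x"] assms(2) by auto
  then have eq: "vabs x = vabs (of_rat r :: 'c)"
    using vabs_eq_if_close[of "of_rat r" x] by (simp add: vabs_minus_commute)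
  then have "r \<noteq> 0" using assms(2) by auto
  then show ?thesis unfolding eq by (rule vabs_of_rat_p_power_valued)
qed

lemma Qp_quotient_approx:
  assumes "(x :: 'c) \<in> Qp" "y \<in> Qp" "y \<noteq> 0" "vabs x \<le> vabs y"
  obtains r where "vabs (x / y - of_rat r) < 1"
proof -
  obtain r where r: "vabs (x - of_rat r) < vabs y" using Qp_approx[OF assms(1), of "vabs y"] assms(3) by auto
  obtain s where s: "vabs (y - of_rat s) < vabs y" using Qp_approx[OF assms(2), of "vabs y"] assms(3) by auto
  have vs: "vabs (of_rat s :: 'c) = vabs y"
    using vabs_eq_if_close[of "of_rat s" y] s by (simp add: vabs_minus_commute)
  then have s0: "(of_rat s :: 'c) \<noteq> 0" using assms(3) by auto
  have "vabs (x - (x - of_rat r)) \<le> vabs y" using r assms(4) by (intro vabs_diff_le[of x _ "x - of_rat r"]) auto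
  then have vr: "vabs (of_rat r :: 'c) \<le> vabs y" by simp
  have "vabs (of_rat r * (y - of_rat s) / (y * of_rat s)) < 1"
  proof -
    have "vabs (of_rat r :: 'c) * vabs (y - of_rat s) \<le> vabs y * vabs (y - of_rat s)"
      by (intro mult_right_mono vr) simp
    also have "\<dots> < vabs y * vabs y" using assms(3) by (intro mult_strict_left_mono s) simp
    finally have "vabs (of_rat r :: 'c) * vabs (y - of_rat s) < vabs y * vabs y" .
    then show ?thesis using assms(3) by (simp add: vabs_mult vabs_divide vs)
  qed
  moreover have "vabs ((x - of_rat r) / y) < 1" using r assms(3) by (simp add: vabs_divide)
  moreover have "x / y - of_rat (r / s) = (x - of_rat r) / y - of_rat r * (y - of_rat s) / (y * of_rat s)"
    using assms(3) s0 by (simp add: of_rat_divide field_simps)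
  ultimately have "vabs (x / y - of_rat (r / s)) < 1" by (simp only: vabs_diff_less)
  then show ?thesis by (rule that)
qed

text \<open>The rational approximation \<open>a/b\<close> is p-integral, so b is invertible mod p and some m solves
  \<open>a + b m \<equiv> 0\<close>.\<close>

lemma Qp_quotient_approx_nat:
  assumes "(c :: 'c) \<in> Qp" "d \<in> Qp" "d \<noteq> 0" "vabs c \<le> vabs d"
  obtains m :: nat where "vabs (c / d + of_nat m) < 1"
proof -
  define x where "x = c / d"
  obtain r where r: "vabs (x - of_rat r) < 1" using Qp_quotient_approx[OF assms] by (auto simp: x_def)
  have "vabs x \<le> 1" using assms(3,4) by (simp add: x_def vabs_divide)
  then have "vabs (x - (x - of_rat r)) \<le> 1" using r by (intro vabs_diff_le[of x _ "x - of_rat r"]) auto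
  then have r1: "vabs (of_rat r :: 'c) \<le> 1" by simp
  obtain a b where ab: "quotient_of r = (a, b)" by force
  have b: "b > 0" using quotient_of_denom_pos[OF ab] .
  have cop: "coprime a b" using quotient_of_coprime[OF ab] .
  have rab: "of_rat r = (of_int a / of_int b :: 'c)"
    using quotient_of_div[OF ab] by (simp add: of_rat_divide)
  have pb: "\<not> int p dvd b"
  proof
    assume pb: "int p dvd b"
    then have "\<not> int p dvd a"
      using cop p_ge_2 coprime_common_divisor[of a b "int p"] by auto
    then have "vabs (of_int a :: 'c) = 1" by (rule vabs_of_int_not_dvd)
    moreover have "vabs (of_int b :: 'c) < 1"
    proof -
      have "1 / real p < 1" using p_ge_2 by simp
      with vabs_of_int_dvd[OF pb] show ?thesis by (rule le_less_trans)
    qed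
    ultimately have "1 < vabs (of_rat r :: 'c)"
      using b by (simp add: rab vabs_divide)
    then show False using r1 by simp
  qed
  then have cbp: "coprime b (int p)"
    using prime_p by (metis coprime_commute prime_imp_coprime prime_nat_int_transfer)
  obtain k0 where "[b * k0 = 1] (mod int p)" using cong_solve_coprime_int[OF cbp] by blast
  then have "[b * k0 * - a = 1 * - a] (mod int p)" by (rule cong_scalar_right)
  then obtain k where k: "[b * k = - a] (mod int p)" by (simp only: mult.assoc mult_1)
  define m where "m = nat (k mod int p)"
  have "[b * int m = b * k] (mod int p)"
    using p_pos by (intro cong_mult cong_refl) (simp add: m_def cong_def)
  then have "[b * int m = - a] (mod int p)" using k cong_trans by blast
  then have "int p dvd a + b * int m" by (simp add: cong_iff_dvd_diff add.commute)
  then have "vabs (of_int (a + b * int m) :: 'c) \<le> 1 / real p" by (rule vabs_of_int_dvd)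
  also have "1 / real p < 1" using p_ge_2 by simp
  finally have "vabs (of_int (a + b * int m) / of_int b :: 'c) < 1"
    by (simp only: vabs_divide vabs_of_int_not_dvd[OF pb] div_by_1)
  also have "of_int (a + b * int m) / of_int b = (of_rat r + of_nat m :: 'c)"
    using b by (simp add: rab field_simps)
  finally have "vabs ((x - of_rat r) + (of_rat r + of_nat m)) < 1"
    by (rule vabs_add_less[OF r])
  then show ?thesis by (intro that[of m]) (simp add: x_def)
qed

text \<open>Two terms of the polynomial equation for y have the same absolute value, and the coefficients have
  absolute values in \<open>p\<^sup>\<int>\<close>.\<close>

lemma Qp_alg_vabs_power:
  assumes "(y :: 'c) \<in> Qp_alg" "y \<noteq> 0"
  shows "\<exists>n>0. p_power_valued p (vabs (y ^ n))"
proof -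
  obtain f where f: "f \<noteq> 0" "\<And>i. poly.coeff f i \<in> Qp" "poly f y = 0"
    using assms(1) by (auto simp: Qp_alg_def)
  let ?t = "\<lambda>i. poly.coeff f i * y ^ i"
  have sum_0: "sum ?t {..Polynomial.degree f} = 0" using f(3) by (simp add: poly_altdef)
  have "?t (Polynomial.degree f) \<noteq> 0" using f(1) assms(2) by simp
  then obtain k l where "k \<in> {..Polynomial.degree f}" "l \<in> {..Polynomial.degree f}"
    and kl: "k \<noteq> l" "vabs (?t k) = vabs (?t l)" "?t k \<noteq> 0"
    by (rule ultrametric_sum_eq_0[OF finite_atMost sum_0 atMost_iff[THEN iffD2, OF order_refl]])
  have *: "\<exists>n>0. p_power_valued p (vabs (y ^ n))"
    if "k < l" "vabs (?t k) = vabs (?t l)" "?t k \<noteq> 0" for k l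
  proof -
    have nz: "poly.coeff f k \<noteq> 0" "poly.coeff f l \<noteq> 0" using that by auto
    have "vabs (poly.coeff f k) * vabs y ^ k = vabs (poly.coeff f l) * (vabs y ^ (l - k) * vabs y ^ k)"
      using that by (simp add: vabs_mult vabs_power flip: power_add)
    then have "vabs (poly.coeff f k) = vabs (poly.coeff f l) * vabs y ^ (l - k)"
      using assms(2) by simp
    then have "vabs (y ^ (l - k)) = vabs (poly.coeff f k) / vabs (poly.coeff f l)"
      using nz by (simp add: vabs_power)
    then have "p_power_valued p (vabs (y ^ (l - k)))"
      using nz p_pos f(2) by (simp add: p_power_valued_divide vabs_Qp_p_power_valued)
    then show ?thesis using that(1) by (intro exI[of _ "l - k"]) simp
  qed
  have "?t l \<noteq> 0" using kl by (metis vabs_eq_0_iff)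
  then show ?thesis using *[of k l] *[of l k] kl by (metis nat_neq_iff)
qed

text \<open>The residue class of an algebraic unit generates a finite ring over the prime field, so its
  powers repeat.\<close>

lemma Qp_alg_unit_power:
  assumes "(u :: 'c) \<in> Qp_alg" "vabs u = 1"
  shows "\<exists>n>0. vabs (u ^ n - 1) < 1"
proof -
  obtain f where f: "f \<noteq> 0" "\<And>i. poly.coeff f i \<in> Qp" "poly f u = 0"
    using assms(1) by (auto simp: Qp_alg_def)
  let ?c = "poly.coeff f" and ?N = "Polynomial.degree f"
  define C where "C = Max ((\<lambda>i. vabs (?c i)) ` {..?N})"
  have le_C: "vabs (?c i) \<le> C" if "i \<le> ?N" for i unfolding C_def using that by (intro Max_ge) auto
  have C_pos: "C > 0" using le_C[of ?N] f(1) by (metis leading_coeff_0_iff le_refl less_le_trans vabs_pos_iff)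
  \<comment> \<open>D is the largest index of a coefficient of maximal absolute value: divided by that coefficient,
    the equation expresses \<open>u\<^sup>D\<close> through lower powers, up to an element of absolute value less than 1.\<close>
  define S where "S = {i. i \<le> ?N \<and> vabs (?c i) = C}"
  have fin: "finite S" by (simp add: S_def)
  have "C \<in> (\<lambda>i. vabs (?c i)) ` {..?N}" unfolding C_def by (intro Max_in) auto
  then have ne: "S \<noteq> {}" by (auto simp: S_def)
  define D where "D = Max S"
  have "D \<in> S" unfolding D_def using fin ne by (rule Max_in)
  then have D: "D \<le> ?N" "vabs (?c D) = C" by (auto simp: S_def)
  have above: "vabs (?c i) < C" if "D < i" "i \<le> ?N" for i
  proof -
    have "i \<notin> S" using that(1) Max_ge[OF fin, of i] unfolding D_def by auto
    then show ?thesis using le_C[OF that(2)] that(2) by (auto simp: S_def)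
  qed
  have cD: "?c D \<noteq> 0" using D C_pos by auto
  have "\<exists>m. i \<le> ?N \<longrightarrow> vabs (?c i / ?c D + of_nat m) < 1" for i
  proof (cases "i \<le> ?N")
    case True
    then show ?thesis using Qp_quotient_approx_nat[OF f(2) f(2) cD] le_C D(2) by metis
  qed simp
  then obtain m where m: "\<And>i. i \<le> ?N \<Longrightarrow> vabs (?c i / ?c D + of_nat (m i)) < 1" by metis
  define val where "val k = (\<Sum>i<D. of_nat (k i) * u ^ i)" for k :: "nat \<Rightarrow> nat"
  have uD: "vabs (u ^ D - val m) < 1"
  proof -
    have "0 = (\<Sum>i\<le>?N. ?c i / ?c D * u ^ i)"
      using f(3) by (simp add: poly_altdef flip: sum_divide_distrib)
    also have "{..?N} = {..<D} \<union> {D} \<union> {D<..?N}" using D(1) by auto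
    also have "(\<Sum>i\<in>\<dots>. ?c i / ?c D * u ^ i)
        = (\<Sum>i<D. ?c i / ?c D * u ^ i) + u ^ D + (\<Sum>i\<in>{D<..?N}. ?c i / ?c D * u ^ i)"
      using cD by (subst sum.union_disjoint, simp, simp, force)+ simp
    finally have "u ^ D - val m = - (\<Sum>i<D. (?c i / ?c D + of_nat (m i)) * u ^ i)
        - (\<Sum>i\<in>{D<..?N}. ?c i / ?c D * u ^ i)"
      by (simp add: val_def algebra_simps sum.distrib)
    moreover have "vabs (- (\<Sum>i<D. (?c i / ?c D + of_nat (m i)) * u ^ i)) < 1"
      unfolding vabs_minus using m D(1) assms(2)
      by (intro vabs_sum_less) (auto simp: vabs_mult vabs_power)
    moreover have "vabs (\<Sum>i\<in>{D<..?N}. ?c i / ?c D * u ^ i) < 1"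
      using above assms(2) C_pos
      by (intro vabs_sum_less) (auto simp: vabs_mult vabs_power vabs_divide D)
    ultimately show ?thesis by (simp only: vabs_diff_less)
  qed
  have D_pos: "D > 0"
  proof (rule ccontr)
    assume "\<not> ?thesis" then show False using uD by (simp add: val_def)
  qed
  have "\<exists>k. vabs (u ^ n - val k) < 1" for n
  proof (induction n)
    case 0
    have "val (\<lambda>i. if i = 0 then 1 else 0) = 1"
      using D_pos by (simp add: val_def if_distrib[of of_nat] if_distrib[of "\<lambda>x. x * _"] cong: if_cong)
    then show ?case by (intro exI[of _ "\<lambda>i. if i = 0 then 1 else 0"]) simp
  next
    case (Suc n)
    then obtain k where k: "vabs (u ^ n - val k) < 1" by blast
    obtain d where d: "D = Suc d" using D_pos by (cases D) auto
    define k' where "k' i = (if i = 0 then 0 else k (i - 1)) + k d * m i" for i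
    have "u * val k = (\<Sum>i<d. of_nat (k i) * u ^ Suc i) + of_nat (k d) * u ^ D"
      by (simp add: val_def d sum_distrib_left algebra_simps)
    moreover have "val k' = (\<Sum>i<d. of_nat (k i) * u ^ Suc i) + of_nat (k d) * val m"
    proof -
      have "val k' = (\<Sum>i<D. of_nat (if i = 0 then 0 else k (i - 1)) * u ^ i) + of_nat (k d) * val m"
        by (simp add: val_def k'_def algebra_simps sum.distrib sum_distrib_left)
      also have "(\<Sum>i<D. of_nat (if i = 0 then 0 else k (i - 1)) * u ^ i) = (\<Sum>i<d. of_nat (k i) * u ^ Suc i)"
        unfolding d by (subst sum.lessThan_Suc_shift) simp
      finally show ?thesis .
    qed
    ultimately have "u ^ Suc n - val k' = u * (u ^ n - val k) + of_nat (k d) * (u ^ D - val m)"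
      by (simp add: algebra_simps)
    moreover have "vabs (u * (u ^ n - val k)) < 1" using k assms(2) by (simp add: vabs_mult)
    moreover have "vabs (of_nat (k d) * (u ^ D - val m)) < 1"
      using vabs_of_nat_mult_le[of "k d" "u ^ D - val m"] uD by simp
    ultimately show ?case by (metis vabs_add_less)
  qed
  then obtain k where k: "\<And>n. vabs (u ^ n - val (k n)) < 1" by metis
  \<comment> \<open>Coefficients matter only mod p, which leaves finitely many possibilities for all powers of u.\<close>
  define h where "h n = (\<lambda>i\<in>{..<D}. k n i mod p)" for n
  have "h n \<in> {..<D} \<rightarrow>\<^sub>E {..<p}" for n unfolding h_def restrict_PiE_iff using p_pos by simp
  then have "range h \<subseteq> {..<D} \<rightarrow>\<^sub>E {..<p}" by blast
  then have "finite (range h)" by (rule finite_subset) (intro finite_PiE; simp)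
  then have "\<not> inj h" using finite_imageD infinite_UNIV_nat by blast
  then obtain n n' where nn': "n < n'" "h n = h n'" unfolding inj_def by (metis nat_neq_iff)
  have "vabs (val (k n) - val (k n')) < 1"
  proof -
    have "vabs (of_nat (k n i) - of_nat (k n' i) :: 'c) < 1" if "i < D" for i
    proof -
      have "k n i mod p = k n' i mod p" using nn'(2) that by (auto simp: h_def dest!: fun_cong[of _ _ i])
      then have "int p dvd int (k n i) - int (k n' i)"
        by (metis mod_eq_dvd_iff of_nat_mod)
      then have "vabs (of_int (int (k n i) - int (k n' i)) :: 'c) \<le> 1 / real p" by (rule vabs_of_int_dvd)
      also have "\<dots> < 1" using p_ge_2 by simp
      finally show ?thesis by simp
    qed
    then have "vabs (\<Sum>i<D. (of_nat (k n i) - of_nat (k n' i)) * u ^ i) < 1"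
      using assms(2) by (intro vabs_sum_less) (auto simp: vabs_mult vabs_power)
    then show ?thesis by (simp add: val_def algebra_simps sum_subtractf)
  qed
  then have "vabs ((u ^ n - val (k n)) + (val (k n) - val (k n')) - (u ^ n' - val (k n'))) < 1"
    by (rule vabs_diff_less[OF vabs_add_less[OF k _] k])
  then have "vabs (u ^ n' - u ^ n) < 1" by (simp add: vabs_minus_commute)
  moreover have "u ^ n' - u ^ n = u ^ n * (u ^ (n' - n) - 1)"
    using nn'(1) by (simp add: algebra_simps flip: power_add)
  ultimately have "vabs (u ^ (n' - n) - 1) < 1" using assms(2) by (simp add: vabs_mult vabs_power)
  then show ?thesis using nn'(1) by (intro exI[of _ "n' - n"]) simp
qed

end

locale padic_complex = residue_char p ty
  for p and ty :: "'c::complete_ultrametric_field itself" +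
  assumes dense: "closure (Qp_alg :: 'c set) = UNIV"
begin

lemma Qp_alg_approx:
  assumes "0 < e"
  obtains y where "(y :: 'c) \<in> Qp_alg" "vabs (x - y) < e"
proof -
  have "x \<in> closure Qp_alg" by (simp add: dense)
  then show ?thesis using assms that unfolding closure_approachable
    by (auto simp: dist_vabs vabs_minus_commute)
qed

text \<open>Being dense, the algebraic elements represent all absolute values and all residue classes.  By
  \<open>Qp_alg_vabs_power\<close> some power of x is a unit times a power of p, and by \<open>Qp_alg_unit_power\<close> some
  power of this unit is close to 1.\<close>

lemma power_near_p_power:
  assumes "(x :: 'c) \<noteq> 0"
  shows "\<exists>n>0. \<exists>m. vabs (x ^ n * of_nat p powi m - 1) < 1"
proof -
  obtain y where y: "y \<in> Qp_alg" "vabs (x - y) < vabs x"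
    using Qp_alg_approx[of "vabs x" x] assms by auto
  then have xy: "vabs x = vabs y" using vabs_eq_if_close[of y x] by (simp add: vabs_minus_commute)
  then have "y \<noteq> 0" using assms by auto
  then obtain n m where n: "n > 0" "vabs (y ^ n) = real p powi m"
    using Qp_alg_vabs_power[OF y(1)] by (auto simp: p_power_valued_def)
  define u where "u = x ^ n * of_nat p powi m"
  have "vabs u = real p powi m * (1 / real p) powi m"
    using n(2) by (simp add: u_def vabs_mult vabs_power_int vabs_p vabs_power xy)
  also have "\<dots> = 1" using p_pos by (simp flip: power_int_mult_distrib)
  finally have u: "vabs u = 1" .
  obtain v where v: "v \<in> Qp_alg" "vabs (u - v) < 1" using Qp_alg_approx[of 1 u] by auto
  have v1: "vabs v = 1" using v(2) vabs_eq_if_close[of v u] u by (simp add: vabs_minus_commute)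
  obtain k where k: "k > 0" "vabs (v ^ k - 1) < 1" using Qp_alg_unit_power[OF v(1) v1] by auto
  have "vabs (u ^ k - v ^ k) < 1" using vabs_power_diff_le[of u v k] u v1 v(2) by simp
  then have "vabs ((u ^ k - v ^ k) + (v ^ k - 1)) < 1" using k(2) by (rule vabs_add_less)
  then have "vabs (x ^ (n * k) * of_nat p powi (m * int k) - 1) < 1"
    by (simp add: u_def power_mult_distrib power_mult power_int_power')
  then show ?thesis using n(1) k(1) by (metis nat_0_less_mult_iff)
qed

text \<open>Additivity and \<open>log p = 0\<close> force this value, for any n and m that bring x close to 1.\<close>

definition ilog :: "'c \<Rightarrow> 'c" where
  "ilog x = (if x = 0 then 0 else
     SOME l. \<exists>n>0. \<exists>m. vabs (x ^ n * of_nat p powi m - 1) < 1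
       \<and> l = plog (x ^ n * of_nat p powi m) / of_nat n)"

text \<open>With \<open>w = x\<^sup>n p\<^sup>m\<close> and \<open>v\<close> the same for the other exponents, \<open>w\<close> to the power n' and \<open>v\<close> to
  the power n are both \<open>x\<close> to the power \<open>n n'\<close> times a power of p.  Having absolute value 1, they
  are equal.\<close>

lemma ilog_unique:
  fixes x :: 'c
  assumes x: "x \<noteq> 0" and n: "n > 0" "n' > 0"
    and w: "vabs (x ^ n * of_nat p powi m - 1) < 1"
    and w': "vabs (x ^ n' * of_nat p powi m' - 1) < 1"
  shows "plog (x ^ n * of_nat p powi m) / of_nat n = plog (x ^ n' * of_nat p powi m') / of_nat n'"
proof -
  let ?w = "x ^ n * of_nat p powi m" and ?w' = "x ^ n' * of_nat p powi m'"
  have pne: "(of_nat p :: 'c) \<noteq> 0" using p_pos by simp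
  have e1: "?w ^ n' = x ^ (n * n') * of_nat p powi (m * int n')"
    by (simp add: power_mult_distrib power_mult power_int_power')
  have e2: "?w' ^ n = x ^ (n * n') * of_nat p powi (m' * int n)"
    by (simp add: power_mult_distrib power_mult power_int_power' flip: power_mult mult.commute[of n])
  have "vabs (?w ^ n') = vabs (?w' ^ n)"
    using vabs_eq_1_if_near[OF w] vabs_eq_1_if_near[OF w'] by (simp only: vabs_power power_one)
  then have "(1 / real p) powi (m * int n') = (1 / real p) powi (m' * int n)"
    unfolding e1 e2 using x by (simp add: vabs_mult vabs_power_int vabs_p vabs_power)
  then have "m * int n' = m' * int n"
    using p_ge_2 power_int_strict_decreasing[of "m * int n'" "m' * int n" "1 / real p"]
      power_int_strict_decreasing[of "m' * int n" "m * int n'" "1 / real p"]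
    by (cases "m * int n'" "m' * int n" rule: linorder_cases) auto
  then have "?w ^ n' = ?w' ^ n" by (simp only: e1 e2)
  then have "of_nat n' * plog ?w = of_nat n * plog ?w'"
    using plog_power[OF w, of n'] plog_power[OF w', of n] by simp
  then show ?thesis using n by (simp add: field_simps)
qed

lemma ilog_eq:
  fixes x :: 'c
  assumes "x \<noteq> 0" "n > 0" "vabs (x ^ n * of_nat p powi m - 1) < 1"
  shows "ilog x = plog (x ^ n * of_nat p powi m) / of_nat n"
proof -
  have "\<exists>n>0. \<exists>m'. vabs (x ^ n * of_nat p powi m' - 1) < 1
       \<and> ilog x = plog (x ^ n * of_nat p powi m') / of_nat n"
    unfolding ilog_def using assms(1)
    by simp (rule someI_ex, use assms in blast)
  then show ?thesis using ilog_unique[OF assms(1)] assms by metis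
qed

lemma ilog_mult:
  assumes "(x :: 'c) \<noteq> 0" "y \<noteq> 0"
  shows "ilog (x * y) = ilog x + ilog y"
proof -
  have pne: "(of_nat p :: 'c) \<noteq> 0" using p_pos by simp
  obtain n m where x: "n > 0" "vabs (x ^ n * of_nat p powi m - 1) < 1"
    using power_near_p_power[OF assms(1)] by auto
  obtain n' m' where y: "n' > 0" "vabs (y ^ n' * of_nat p powi m' - 1) < 1"
    using power_near_p_power[OF assms(2)] by auto
  let ?w = "x ^ n * of_nat p powi m" and ?w' = "y ^ n' * of_nat p powi m'"
  have eq: "(x * y) ^ (n * n') * of_nat p powi (m * int n' + m' * int n) = ?w ^ n' * ?w' ^ n"
  proof -
    have "?w ^ n' * ?w' ^ n = (x ^ n) ^ n' * (y ^ n') ^ n * ((of_nat p powi m) ^ n' * (of_nat p powi m') ^ n)"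
      by (simp add: power_mult_distrib mult_ac)
    also have "(of_nat p powi m) ^ n' * (of_nat p powi m') ^ n = (of_nat p :: 'c) powi (m * int n' + m' * int n)"
      using pne by (simp add: power_int_add power_int_power')
    also have "(x ^ n) ^ n' * (y ^ n') ^ n = (x * y) ^ (n * n')"
      by (simp add: power_mult_distrib mult.commute[of n n'] flip: power_mult)
    finally show ?thesis by simp
  qed
  have near: "vabs (?w ^ n' - 1) < 1" "vabs (?w' ^ n - 1) < 1"
    using x y by (auto intro!: near_1_power)
  have "ilog (x * y) = plog (?w ^ n' * ?w' ^ n) / of_nat (n * n')"
    unfolding eq[symmetric] using assms x(1) y(1)
    by (intro ilog_eq) (auto simp only: eq intro!: near_1_mult near, auto)
  also have "\<dots> = (of_nat n' * plog ?w + of_nat n * plog ?w') / of_nat (n * n')"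
    by (simp only: plog_mult[OF near] plog_power[OF x(2)] plog_power[OF y(2)])
  also have "\<dots> = plog ?w / of_nat n + plog ?w' / of_nat n'"
    using x(1) y(1) by (simp add: field_simps)
  also have "\<dots> = ilog x + ilog y"
    by (simp only: ilog_eq[OF assms(1) x] ilog_eq[OF assms(2) y])
  finally show ?thesis .
qed

lemma ilog_near_1: "vabs (x :: 'c) < 1 \<Longrightarrow> ilog (1 + x) = plog (1 + x)"
proof -
  assume x: "vabs x < 1"
  then have "vabs (1 + x) = 1" by (intro vabs_eq_1_if_near) simp
  then have "1 + x \<noteq> 0" by (metis vabs_0 zero_neq_one)
  then show ?thesis using ilog_eq[of "1 + x" 1 0] x by simp
qed

lemma ilog_p: "ilog (of_nat p :: 'c) = 0"
  using ilog_eq[of "of_nat p" 1 "- 1"] p_pos by (simp add: power_int_minus)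

text \<open>Any function with the defining properties agrees with the series near 1 and kills p, so by
  \<open>power_near_p_power\<close> some positive multiple of its value at x is determined.\<close>

lemma iwasawa_log_eq_ilog: "(iwasawa_log p :: 'c \<Rightarrow> 'c) = ilog"
  unfolding iwasawa_log_def
proof (rule the_equality)
  show "ilog 0 = 0
     \<and> (\<forall>x y. x \<noteq> 0 \<longrightarrow> y \<noteq> 0 \<longrightarrow> ilog (x * y) = ilog x + ilog (y :: 'c))
     \<and> (\<forall>x. vabs x < 1 \<longrightarrow> (\<lambda>n. (- 1) ^ n * x ^ Suc n / of_nat (Suc n)) sums ilog (1 + x))
     \<and> ilog (of_nat p) = 0"
    using plog_sums ilog_near_1 ilog_mult ilog_p by (simp add: ilog_def)
next
  fix L :: "'c \<Rightarrow> 'c"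
  assume L: "L 0 = 0
     \<and> (\<forall>x y. x \<noteq> 0 \<longrightarrow> y \<noteq> 0 \<longrightarrow> L (x * y) = L x + L y)
     \<and> (\<forall>x. vabs x < 1 \<longrightarrow> (\<lambda>n. (- 1) ^ n * x ^ Suc n / of_nat (Suc n)) sums L (1 + x))
     \<and> L (of_nat p) = 0"
  then have mult: "L (x * y) = L x + L y" if "x \<noteq> 0" "y \<noteq> 0" for x y using that by blast
  have L1: "L 1 = 0" using mult[of 1 1] by simp
  have pow: "L (x ^ n) = of_nat n * L x" if "x \<noteq> 0" for x n
    using that by (induction n) (auto simp: L1 mult algebra_simps)
  have inv: "L (inverse x) = - L x" if "x \<noteq> 0" for x
    using mult[of x "inverse x"] that L1 by (simp add: eq_neg_iff_add_eq_0 add.commute)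
  have pne: "(of_nat p :: 'c) \<noteq> 0" using p_pos by simp
  have Lp: "L (of_nat p powi m) = 0" for m
    using L pne by (auto simp: power_int_def pow inv)
  have near: "L u = plog u" if "vabs (u - 1) < 1" for u
  proof -
    have "(\<lambda>n. (- 1) ^ n * (u - 1) ^ Suc n / of_nat (Suc n)) sums L (1 + (u - 1))"
      using L that by blast
    then show ?thesis using sums_unique2[OF _ plog_sums[OF that]] by simp
  qed
  show "L = ilog"
  proof
    fix x
    show "L x = ilog x"
    proof (cases "x = 0")
      case True then show ?thesis using L by (simp add: ilog_def)
    next
      case False
      obtain n m where x: "n > 0" "vabs (x ^ n * of_nat p powi m - 1) < 1"
        using power_near_p_power[OF False] by auto
      have "plog (x ^ n * of_nat p powi m) = L (x ^ n * of_nat p powi m)" using near[OF x(2)] by simp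
      also have "\<dots> = of_nat n * L x" using False pne by (simp add: mult pow Lp power_int_eq_0_iff)
      finally show ?thesis using ilog_eq[OF False x] x(1) by simp
    qed
  qed
qed

lemma iwasawa_log_mult:
  "(x :: 'c) \<noteq> 0 \<Longrightarrow> y \<noteq> 0 \<Longrightarrow> iwasawa_log p (x * y) = iwasawa_log p x + iwasawa_log p y"
  by (simp add: iwasawa_log_eq_ilog ilog_mult)

lemma iwasawa_log_near_1: "vabs (x :: 'c) < 1 \<Longrightarrow> iwasawa_log p (1 + x) = plog (1 + x)"
  by (simp add: iwasawa_log_eq_ilog ilog_near_1)

lemma iwasawa_log_1 [simp]: "iwasawa_log p (1 :: 'c) = 0"
  using iwasawa_log_mult[of 1 1] by simp

end

section \<open>Powers of units and Volkenborn means\<close>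

lemma Ip_1: "1 \<in> Ip p"
  by (simp add: Ip_def)

lemma Ip_mult: "n \<in> Ip p \<Longrightarrow> m \<in> Ip p \<Longrightarrow> n * m \<in> Ip p" by (simp add: Ip_def)

context residue_char
begin

lemma pq_pos: "0 < pq p" using p_pos by (simp add: pq_def)

lemma p_dvd_pq: "p dvd pq p" by (simp add: pq_def)

lemma vabs_pq: "vabs (of_nat (pq p) :: 'c) = 1 / real (pq p)"
proof (cases "p = 2")
  case True
  have "(of_nat 4 :: 'c) = of_nat p * of_nat p" using True by simp
  then show ?thesis using True vabs_p by (simp add: pq_def vabs_mult del: of_nat_numeral)
qed (simp add: pq_def vabs_p)

lemma vabs_of_nat_pq_dvd:
  assumes "pq p dvd f"
  shows "vabs (of_nat f :: 'c) \<le> 1 / real (pq p)"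
proof -
  obtain k where "f = pq p * k" using assms by (elim dvdE)
  then show ?thesis
    using vabs_of_nat_mult_le[of k "of_nat (pq p)"] by (simp add: mult.commute vabs_pq)
qed

lemma pq_rad_gt_1: "1 < real (pq p) * rad"
proof (cases "p = 2")
  case True
  then have "rad = 1 / 2" using rad_power by simp
  then show ?thesis using True by (simp add: pq_def)
next
  case False
  then have p3: "p \<ge> 3" using p_ge_2 by simp
  show ?thesis
  proof (rule ccontr)
    assume "\<not> ?thesis"
    then have "(real p * rad) ^ (p - 1) \<le> 1"
      using False rad_pos by (intro power_le_one) (auto simp: pq_def)
    moreover have "(real p * rad) ^ (p - 1) = real p ^ (p - 2)"
    proof -
      have "p - 1 = Suc (p - 2)" using p3 by simp
      then have "real p ^ (p - 1) * (1 / real p) = real p ^ (p - 2)" using p_pos by simp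
      then show ?thesis by (simp only: power_mult_distrib rad_power)
    qed
    moreover have "real p ^ (p - 2) > 1" using p3 by (intro one_less_power) auto
    ultimately show False by simp
  qed
qed

lemma pq_inverse_less_rad: "1 / real (pq p) < rad"
  using pq_rad_gt_1 pq_pos by (simp add: field_simps)

lemma padic_disc_iff: "(s :: 'c) \<in> padic_disc p \<longleftrightarrow> vabs s < real (pq p) * rad"
  by (simp add: padic_disc_def rad_def)

lemma one_in_padic_disc: "1 \<in> (padic_disc p :: 'c set)"
  using pq_rad_gt_1 by (simp add: padic_disc_iff)

lemma padic_disc_diff: "(s :: 'c) \<in> padic_disc p \<Longrightarrow> t \<in> padic_disc p \<Longrightarrow> s - t \<in> padic_disc p"
  by (simp add: padic_disc_iff vabs_diff_less)

lemma padic_disc_binom_dom: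
  assumes "(s :: 'c) \<in> padic_disc p" "vabs x \<le> 1 / real (pq p)"
  shows "s \<in> binom_dom x"
proof -
  have "max 1 (vabs s) * vabs x \<le> max 1 (vabs s) * (1 / real (pq p))"
    using assms(2) by (intro mult_left_mono) auto
  also have "\<dots> < real (pq p) * rad * (1 / real (pq p))"
    using assms(1) pq_rad_gt_1 pq_pos by (intro mult_strict_right_mono) (auto simp: padic_disc_iff)
  also have "\<dots> = rad" using pq_pos by simp
  finally show ?thesis by (simp add: binom_dom_def)
qed

lemma Ip_iff: "n \<in> Ip p \<longleftrightarrow> n > 0 \<and> \<not> p dvd n"
proof -
  have "coprime n p \<longleftrightarrow> \<not> p dvd n"
    using prime_p by (metis coprime_absorb_left coprime_commute not_prime_unit prime_imp_coprime)
  then show ?thesis by (simp add: Ip_def)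
qed

lemma vabs_Ip: "n \<in> Ip p \<Longrightarrow> vabs (of_nat n :: 'c) = 1"
  by (simp add: Ip_iff vabs_of_nat_not_dvd)

end

context padic_complex
begin

lemma vabs_plog_div_le:
  assumes "x \<noteq> 0" "n > 0" "vabs (x ^ n - 1 :: 'c) \<le> C" "C < rad"
  shows "vabs (iwasawa_log p x) \<le> C / vabs (of_nat n :: 'c)"
proof -
  have *: "vabs (x ^ n - 1) < rad" using assms by simp
  have "ilog x = plog (x ^ n * of_nat p powi 0) / of_nat n"
    using assms vabs_less_1_if_rad[OF *] by (intro ilog_eq) auto
  then have "vabs (iwasawa_log p x) = vabs (plog (1 + (x ^ n - 1))) / vabs (of_nat n :: 'c)"
    by (simp add: iwasawa_log_eq_ilog vabs_divide)
  also have "\<dots> \<le> C / vabs (of_nat n :: 'c)"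
    using vabs_plog_le[OF *] assms(3) by (intro divide_right_mono) auto
  finally show ?thesis .
qed

text \<open>For odd p apply the series to \<open>c\<^sup>p\<^sup>-\<^sup>1\<close>.  For \<open>p = 2\<close> the square of c is 1 mod 8, and division by 2
  leaves \<open>1/4 = 1/q\<close>.\<close>

lemma vabs_log_of_nat_le:
  assumes c: "c \<in> Ip p"
  shows "vabs (iwasawa_log p (of_nat c :: 'c)) \<le> 1 / real (pq p)"
proof (cases "p = 2")
  case False
  have "\<not> p dvd c" using c by (simp add: Ip_iff)
  then have "[c ^ (p - 1) = 1] (mod p)" using fermat_theorem[OF prime_p] by simp
  then have "int p dvd int (c ^ (p - 1)) - 1"
    by (metis cong_iff_dvd_diff cong_int_iff of_nat_1)
  then have "vabs (of_int (int (c ^ (p - 1)) - 1) :: 'c) \<le> 1 / real p" by (rule vabs_of_int_dvd)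
  then have le: "vabs (of_nat c ^ (p - 1) - 1 :: 'c) \<le> 1 / real (pq p)"
    using False by (simp add: pq_def)
  have "vabs (iwasawa_log p (of_nat c :: 'c)) \<le> (1 / real (pq p)) / vabs (of_nat (p - 1) :: 'c)"
    using c le p_ge_2 pq_inverse_less_rad by (intro vabs_plog_div_le) (auto simp: Ip_iff)
  also have "vabs (of_nat (p - 1) :: 'c) = 1"
    using p_ge_2 by (intro vabs_of_nat_not_dvd) (auto dest: dvd_imp_le)
  finally show ?thesis by simp
next
  case True
  have "odd c" using c True unfolding Ip_iff by simp
  then obtain k where k: "c = 2 * k + 1" by (elim oddE)
  have "(8 :: nat) dvd 4 * (k * (k + 1))"
  proof -
    have "2 dvd k * (k + 1)" by simp
    then have "4 * 2 dvd 4 * (k * (k + 1))" by (intro mult_dvd_mono) simp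
    then show ?thesis by simp
  qed
  then obtain l where l: "4 * (k * (k + 1)) = 8 * l" by (elim dvdE)
  have "c ^ 2 = Suc (8 * l)" using l by (simp add: k power2_eq_square algebra_simps)
  then have "(of_nat (c ^ 2) :: 'c) = of_nat (Suc (8 * l))" by (rule arg_cong)
  then have "(of_nat c ^ 2 - 1 :: 'c) = of_nat l * (of_nat p * of_nat p * of_nat p)"
    using True by simp
  then have "vabs (of_nat c ^ 2 - 1 :: 'c) \<le> vabs (of_nat p * of_nat p * of_nat p :: 'c)"
    by (simp only: vabs_of_nat_mult_le)
  also have "\<dots> = 1 / 8" by (simp only: vabs_mult vabs_p) (simp add: True)
  finally have le: "vabs (of_nat c ^ 2 - 1 :: 'c) \<le> 1 / 8" .
  have "vabs (iwasawa_log p (of_nat c :: 'c)) \<le> (1 / 8) / vabs (of_nat 2 :: 'c)"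
    using \<open>odd c\<close> le True pq_inverse_less_rad by (intro vabs_plog_div_le) (auto simp: pq_def elim: oddE)
  also have "vabs (of_nat 2 :: 'c) = 1 / 2" using vabs_p True by simp
  finally show ?thesis using True by (simp add: pq_def)
qed

lemma vabs_mult_log_less:
  assumes "(s :: 'c) \<in> padic_disc p" "vabs l \<le> 1 / real (pq p)"
  shows "vabs (s * l) < rad"
  using binom_dom_mult_less[OF padic_disc_binom_dom[OF assms]] by (simp add: vabs_mult)

definition unit_rat :: "rat set" where
  "unit_rat = {of_nat a / of_nat b | a b. a \<in> Ip p \<and> b \<in> Ip p}"

lemma unit_rat_quotient: "a \<in> Ip p \<Longrightarrow> b \<in> Ip p \<Longrightarrow> of_nat a / of_nat b \<in> unit_rat"
  by (auto simp: unit_rat_def)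

lemma unit_rat_of_nat: "a \<in> Ip p \<Longrightarrow> of_nat a \<in> unit_rat"
  using unit_rat_quotient[of a 1] Ip_1 by simp

lemma unit_rat_inverse: "a \<in> Ip p \<Longrightarrow> 1 / of_nat a \<in> unit_rat"
  using unit_rat_quotient[of 1 a] Ip_1 by simp

lemma unit_rat_nonzero: "r \<in> unit_rat \<Longrightarrow> r \<noteq> 0"
  by (auto simp: unit_rat_def Ip_iff)

lemma vabs_log_unit_rat_le:
  assumes "r \<in> unit_rat"
  shows "vabs (iwasawa_log p (of_rat r :: 'c)) \<le> 1 / real (pq p)"
proof -
  obtain a b where ab: "a \<in> Ip p" "b \<in> Ip p" "r = of_nat a / of_nat b"
    using assms by (auto simp: unit_rat_def)
  have "(of_nat a :: 'c) = of_rat r * of_nat b"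
    using ab by (simp add: of_rat_divide Ip_iff)
  then have "iwasawa_log p (of_nat a :: 'c) = iwasawa_log p (of_rat r) + iwasawa_log p (of_nat b)"
    using ab unit_rat_nonzero[OF assms] by (simp add: Ip_iff iwasawa_log_mult)
  then have "iwasawa_log p (of_rat r :: 'c) = iwasawa_log p (of_nat a) - iwasawa_log p (of_nat b)" by simp
  then show ?thesis using vabs_log_of_nat_le ab by (simp only: vabs_diff_le)
qed

lemma ang_pow_mult:
  assumes "(s :: 'c) \<in> padic_disc p" "r \<in> unit_rat" "t \<in> unit_rat"
  shows "ang_pow p (r * t) s = ang_pow p r s * ang_pow p t s"
proof -
  have "iwasawa_log p (of_rat (r * t) :: 'c) = iwasawa_log p (of_rat r) + iwasawa_log p (of_rat t)"
    using assms(2,3) by (simp add: of_rat_mult iwasawa_log_mult unit_rat_nonzero)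
  then show ?thesis
    unfolding ang_pow_def using assms
    by (simp add: distrib_left padic_exp_add vabs_mult_log_less vabs_log_unit_rat_le)
qed

lemma vabs_ang_pow_minus_1_less:
  assumes "(s :: 'c) \<in> padic_disc p" "r \<in> unit_rat"
  shows "vabs (ang_pow p r s - 1) < rad"
proof -
  have *: "vabs (s * iwasawa_log p (of_rat r)) < rad"
    by (intro vabs_mult_log_less vabs_log_unit_rat_le assms)
  then show ?thesis using vabs_padic_exp_minus_1_le[OF *] by (simp add: ang_pow_def)
qed

lemma vabs_ang_pow:
  assumes "(s :: 'c) \<in> padic_disc p" "r \<in> unit_rat"
  shows "vabs (ang_pow p r s) = 1"
  by (intro vabs_eq_1_if_near vabs_less_1_if_rad vabs_ang_pow_minus_1_less assms)

lemma ang_pow_1 [simp]: "ang_pow p 1 (s :: 'c) = 1"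
  by (simp add: ang_pow_def)

lemma rat_pow_eq: "rat_pow p r \<beta> = of_rat r * ang_pow p r (\<beta> - 1 :: 'c)"
  by (simp add: rat_pow_def ang_pow_def)

text \<open>\<open>c + k f = c (1 + k f / c)\<close>, where the second factor is close enough to 1 for the binomial series.\<close>

lemma ang_pow_shift:
  assumes s: "(s :: 'c) \<in> padic_disc p" and c: "c \<in> Ip p" and f: "pq p dvd f"
  shows "ang_pow p (of_nat (c + k * f)) s
    = ang_pow p (of_nat c) s * binom_series (of_nat k * (of_nat f / of_nat c)) s"
proof -
  let ?x = "of_nat k * (of_nat f / of_nat c) :: 'c"
  have c0: "(of_nat c :: 'c) \<noteq> 0" using c by (simp add: Ip_iff)
  have "vabs ?x \<le> vabs (of_nat f / of_nat c :: 'c)" by (rule vabs_of_nat_mult_le)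
  also have "\<dots> \<le> 1 / real (pq p)" using vabs_of_nat_pq_dvd[OF f] vabs_Ip[OF c] by (simp add: vabs_divide)
  finally have x: "vabs ?x \<le> 1 / real (pq p)" .
  then have x_rad: "vabs ?x < rad" using pq_inverse_less_rad by simp
  have x1: "vabs ?x < 1" by (rule vabs_less_1_if_rad[OF x_rad])
  have nz: "1 + ?x \<noteq> 0" using vabs_eq_1_if_near[of "1 + ?x"] x1 by (metis add_diff_cancel_left' vabs_0 zero_neq_one)
  have "(of_nat (c + k * f) :: 'c) = of_nat c * (1 + ?x)" using c0 by (simp add: field_simps)
  then have "iwasawa_log p (of_nat (c + k * f) :: 'c) = iwasawa_log p (of_nat c) + plog (1 + ?x)"
    by (simp only: iwasawa_log_mult[OF c0 nz] iwasawa_log_near_1[OF x1])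
  moreover have "vabs (s * plog (1 + ?x)) < rad"
    using vabs_plog_le[OF x_rad] x by (intro vabs_mult_log_less s) simp
  moreover have "vabs (s * iwasawa_log p (of_nat c)) < rad"
    by (intro vabs_mult_log_less s vabs_log_of_nat_le c)
  ultimately show ?thesis
    unfolding ang_pow_def binom_series_eq_exp[OF padic_disc_binom_dom[OF s x]]
    by (simp only: of_rat_of_nat_eq distrib_left padic_exp_add)
qed

text \<open>The Bernoulli series in the definition of the zeta values is a Volkenborn integral: a limit of
  means of \<open>\<langle>n\<rangle>\<^sup>s\<close> over the progression \<open>c + k f\<close>.  The factor m in the length leaves room to refine
  two moduli to a common multiple.\<close>

lemma volkenborn_ang_pow:
  assumes s: "(s :: 'c) \<in> padic_disc p" and c: "c \<in> Ip p" and f: "pq p dvd f" and m: "m > 0"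
  shows "(\<lambda>N. (\<Sum>k<m * p ^ N. ang_pow p (of_nat (c + k * f)) s) / of_nat (m * p ^ N))
    \<longlonglongrightarrow> ang_pow p (of_nat c) s
      * suminf (\<lambda>j. (s gchoose j) * (of_nat f / of_nat c) ^ j * of_rat (bernoulli_num j))"
proof -
  define x where "x = (of_nat f / of_nat c :: 'c)"
  let ?t = "\<lambda>j. (s gchoose j) * x ^ j"
  have x: "vabs x \<le> 1 / real (pq p)"
    unfolding x_def using vabs_of_nat_pq_dvd[OF f] vabs_Ip[OF c] by (simp add: vabs_divide)
  have kx: "vabs (of_nat k * x) \<le> 1 / real (pq p)" for k
    using vabs_of_nat_mult_le[of k x] x by simp
  have t0: "?t \<longlonglongrightarrow> 0" by (intro binom_terms_tendsto_0 padic_disc_binom_dom s x)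
  have mean_sums: "(\<lambda>j. ?t j * power_mean j (m * p ^ N))
      sums ((\<Sum>k<m * p ^ N. binom_series (of_nat k * x) s) / of_nat (m * p ^ N))" for N
  proof -
    have "(\<lambda>j. \<Sum>k<m * p ^ N. (s gchoose j) * (of_nat k * x) ^ j)
        sums (\<Sum>k<m * p ^ N. binom_series (of_nat k * x) s)"
      by (intro sums_sum binom_series_sums padic_disc_binom_dom s kx)
    from sums_mult_vabs[OF this, of "1 / of_nat (m * p ^ N)"] show ?thesis
      by (simp add: power_mean_def power_mult_distrib mult_ac flip: sum_distrib_left sum_distrib_right)
  qed
  \<comment> \<open>C bounds all power means, so that the terms of the binomial series dominate.\<close>
  define C where "C = max (real p) (1 / vabs (of_nat m :: 'c))"
  have t_sums: "(\<lambda>j. ?t j * of_rat (bernoulli_num j)) sums suminf (\<lambda>j. ?t j * of_rat (bernoulli_num j))"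
  proof (intro summable_sums summable_vabs tendsto_vabs_le)
    show "(\<lambda>j. vabs (?t j) * real p) \<longlonglongrightarrow> 0"
      by (intro tendsto_mult_left_zero t0[unfolded tendsto_vabs_0_iff])
    show "vabs (?t j * of_rat (bernoulli_num j) - 0) \<le> vabs (?t j) * real p" for j
      using mult_left_mono[OF vabs_bernoulli_le[of j], of "vabs (?t j)"] by (simp add: vabs_mult)
  qed
  have lim: "(\<lambda>N. (\<Sum>k<m * p ^ N. binom_series (of_nat k * x) s) / of_nat (m * p ^ N))
      \<longlonglongrightarrow> suminf (\<lambda>j. ?t j * of_rat (bernoulli_num j))"
  proof (rule tendsto_suminf_dominated[OF _ _ _ mean_sums t_sums])
    show "(\<lambda>N. ?t j * power_mean j (m * p ^ N)) \<longlonglongrightarrow> ?t j * of_rat (bernoulli_num j)" for j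
      using m p_pos by (intro tendsto_mult_left power_mean_tendsto of_nat_mult_p_power_tendsto_0) simp
    show "vabs (?t j * power_mean j (m * p ^ N)) \<le> vabs (?t j) * C" for N j
      unfolding vabs_mult[of "?t j"] C_def by (intro mult_left_mono vabs_power_mean_le m) simp
    show "(\<lambda>j. vabs (?t j) * C) \<longlonglongrightarrow> 0"
      by (intro tendsto_mult_left_zero t0[unfolded tendsto_vabs_0_iff])
  qed
  show ?thesis
    using tendsto_mult_left[OF lim, of "ang_pow p (of_nat c) s"]
    by (simp only: ang_pow_shift[OF s c f] x_def sum_distrib_left times_divide_eq_right)
qed

section \<open>Zeta values\<close>

definition unit_term :: "(nat \<Rightarrow> 'c) \<Rightarrow> 'c \<Rightarrow> nat \<Rightarrow> 'c" where
  "unit_term w s n = (if p dvd n then 0 else w n * ang_pow p (of_nat n) s)"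

text \<open>Every \<open>n < M f\<close> is uniquely \<open>c + k f\<close> with \<open>c < f\<close> and \<open>k < M\<close>; the weight depends only on c, and the
  mean over k is a Volkenborn mean.\<close>

lemma zsum_limit:
  assumes \<beta>: "(\<beta> :: 'c) \<in> padic_disc p" "\<beta> \<noteq> 1"
    and f: "pq p dvd f" "f > 0" and w: "\<And>c k. w (c + k * f) = w c" and m: "m > 0"
  shows "(\<lambda>N. (\<Sum>n<m * p ^ N * f. unit_term w (1 - \<beta>) n) / of_nat (m * p ^ N * f))
    \<longlonglongrightarrow> (\<beta> - 1) * padic_zsum p f w \<beta>"
proof -
  define s where "s = 1 - \<beta>"
  have s: "s \<in> padic_disc p" unfolding s_def by (intro padic_disc_diff one_in_padic_disc \<beta>)
  have pf: "p dvd f" using f p_dvd_pq dvd_trans by blast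
  let ?C = "{c. 1 \<le> c \<and> c < f \<and> \<not> p dvd c}"
  have C: "finite ?C" "?C \<subseteq> {..<f}" by auto
  have block: "(\<Sum>n<M * f. unit_term w s n) = (\<Sum>c\<in>?C. w c * (\<Sum>k<M. ang_pow p (of_nat (c + k * f)) s))" for M
  proof -
    have "(\<Sum>n<M * f. unit_term w s n) = (\<Sum>c<f. \<Sum>k<M. unit_term w s (c + k * f))"
      by (subst sum_lessThan_blocks) (rule sum.swap)
    also have "\<dots> = (\<Sum>c\<in>?C. \<Sum>k<M. unit_term w s (c + k * f))"
      using C pf by (intro sum.mono_neutral_right) (auto simp: unit_term_def Suc_le_eq intro!: gr0I sum.neutral split: if_splits)
    also have "\<dots> = (\<Sum>c\<in>?C. w c * (\<Sum>k<M. ang_pow p (of_nat (c + k * f)) s))"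
      using pf by (intro sum.cong refl) (auto simp: unit_term_def w sum_distrib_left dvd_add_left_iff)
    finally show ?thesis .
  qed
  let ?V = "\<lambda>c. ang_pow p (of_nat c) s
      * suminf (\<lambda>j. (s gchoose j) * (of_nat f / of_nat c) ^ j * of_rat (bernoulli_num j))"
  have "(\<lambda>N. 1 / of_nat f * (\<Sum>c\<in>?C. w c *
        ((\<Sum>k<m * p ^ N. ang_pow p (of_nat (c + k * f)) s) / of_nat (m * p ^ N))))
      \<longlonglongrightarrow> 1 / of_nat f * (\<Sum>c\<in>?C. w c * ?V c)"
    using C by (intro tendsto_mult_left tendsto_sum volkenborn_ang_pow s f m) (auto simp: Ip_iff)
  moreover have "1 / of_nat f * (\<Sum>c\<in>?C. w c *
        ((\<Sum>k<m * p ^ N. ang_pow p (of_nat (c + k * f)) s) / of_nat (m * p ^ N)))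
      = (\<Sum>n<m * p ^ N * f. unit_term w s n) / of_nat (m * p ^ N * f)" for N
  proof -
    have "1 / of_nat f * (\<Sum>c\<in>?C. w c * (A c / of_nat M)) = (\<Sum>c\<in>?C. w c * A c) / of_nat (M * f)"
      for A :: "nat \<Rightarrow> 'c" and M
      by (simp add: sum_distrib_left sum_divide_distrib mult_ac)
    then show ?thesis unfolding block .
  qed
  moreover have "1 / of_nat f * (\<Sum>c\<in>?C. w c * ?V c) = (\<beta> - 1) * padic_zsum p f w \<beta>"
  proof -
    have "(\<beta> - 1) * (w c * (A / (\<beta> - 1)) * B) = w c * (A * B)" for c A B
      using \<beta>(2) by simp
    then have "(\<beta> - 1) * (\<Sum>c\<in>?C. w c * (ang_pow p (of_nat c) s / (\<beta> - 1))
          * suminf (\<lambda>j. (s gchoose j) * (of_nat f / of_nat c) ^ j * of_rat (bernoulli_num j)))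
        = (\<Sum>c\<in>?C. w c * ?V c)"
      by (simp only: sum_distrib_left)
    then show ?thesis by (simp add: padic_zsum_def s_def mult_ac)
  qed
  ultimately show ?thesis by (simp only: s_def)
qed

text \<open>Both values are limits along the same sequence of lengths \<open>f g p\<^sup>N\<close>.\<close>

lemma padic_zsum_indep:
  assumes \<beta>: "(\<beta> :: 'c) \<in> padic_disc p" "\<beta> \<noteq> 1"
    and f: "pq p dvd f" "f > 0" "\<And>c k. w (c + k * f) = w c"
    and g: "pq p dvd g" "g > 0" "\<And>c k. w (c + k * g) = w c"
  shows "padic_zsum p f w \<beta> = padic_zsum p g w \<beta>"
proof -
  have eq: "g * p ^ N * f = f * p ^ N * g" for N by simp
  have "(\<beta> - 1) * padic_zsum p f w \<beta> = (\<beta> - 1) * padic_zsum p g w \<beta>"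
    using zsum_limit[of \<beta> f w g, OF \<beta> f g(2)] zsum_limit[of \<beta> g w f, OF \<beta> g f(2)]
    unfolding eq by (rule LIMSEQ_unique)
  then show ?thesis using \<beta>(2) by simp
qed

end

lemma zeta_root_power: "zeta_root \<gamma> ^ n = cis (2 * pi * (real n * of_rat \<gamma>))"
  by (simp only: zeta_root_def Complex.DeMoivre mult_ac)

lemma zeta_root_periodic:
  assumes "\<gamma> = of_int a / of_nat b" "b > 0" "b dvd f"
  shows "zeta_root \<gamma> ^ (c + k * f) = zeta_root \<gamma> ^ c"
proof -
  obtain d where d: "f = b * d" using assms by (elim dvdE)
  have "zeta_root \<gamma> ^ b = cis (2 * pi * real_of_int a)"
    using assms(1,2) by (simp add: zeta_root_power of_rat_divide)
  also have "\<dots> = 1" by (simp add: cis_multiple_2pi)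
  finally have "zeta_root \<gamma> ^ b = 1" .
  then have "zeta_root \<gamma> ^ f = 1" by (simp add: d power_mult)
  then show ?thesis by (simp add: power_add power_mult mult.commute[of k])
qed

definition root_char :: "(complex \<Rightarrow> 'c) \<Rightarrow> rat \<Rightarrow> nat \<Rightarrow> 'c" where
  "root_char \<rho> \<gamma> c = \<rho> (zeta_root \<gamma> ^ c)"

context padic_complex
begin

lemma root_char_periodic:
  assumes "\<gamma> = of_int a / of_nat b" "b \<in> Ip p" "b * pq p dvd f"
  shows "root_char \<rho> \<gamma> (c + k * f) = root_char \<rho> \<gamma> c"
  using zeta_root_periodic[OF assms(1), of f] assms(2,3) dvd_mult_left
  by (auto simp: root_char_def Ip_iff)

lemma Z_rho_eq:
  assumes \<beta>: "(\<beta> :: 'c) \<in> padic_disc p" "\<beta> \<noteq> 1"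
    and \<gamma>: "\<gamma> = of_int a / of_nat b" "b \<in> Ip p" and f: "b * pq p dvd f" "f > 0"
  shows "Z_rho p \<rho> \<gamma> \<beta> = padic_zsum p f (root_char \<rho> \<gamma>) \<beta>"
  unfolding Z_rho_def
proof (rule the_equality)
  have pq: "pq p dvd f" if "b * pq p dvd f" for b f using that dvd_mult_right by blast
  show "\<forall>a. \<forall>b\<in>Ip p. \<forall>f'>0. \<gamma> = of_int a / of_nat b \<and> b * pq p dvd f' \<longrightarrow>
      padic_zsum p f (root_char \<rho> \<gamma>) \<beta>
        = padic_zsum p f' (\<lambda>c. \<rho> (zeta_root (of_int a / of_nat b) ^ c)) \<beta>"
  proof (intro allI ballI impI)
    fix a' b' f'
    assume *: "b' \<in> Ip p" "f' > 0" "\<gamma> = of_int a' / of_nat b' \<and> b' * pq p dvd f'"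
    have "padic_zsum p f (root_char \<rho> \<gamma>) \<beta> = padic_zsum p f' (root_char \<rho> \<gamma>) \<beta>"
    proof (rule padic_zsum_indep[OF \<beta>])
      show "root_char \<rho> \<gamma> (c + k * f) = root_char \<rho> \<gamma> c" for c k
        by (rule root_char_periodic[OF \<gamma> f(1)])
      show "root_char \<rho> \<gamma> (c + k * f') = root_char \<rho> \<gamma> c" for c k
        using * by (intro root_char_periodic[of \<gamma> a' b']) auto
    qed (use * f pq in auto)
    moreover have "root_char \<rho> \<gamma> = (\<lambda>c. \<rho> (zeta_root (of_int a' / of_nat b') ^ c))"
      using * by (auto simp: root_char_def)
    ultimately show "padic_zsum p f (root_char \<rho> \<gamma>) \<beta>
        = padic_zsum p f' (\<lambda>c. \<rho> (zeta_root (of_int a' / of_nat b') ^ c)) \<beta>" by simp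
  qed
next
  fix z
  assume "\<forall>a. \<forall>b\<in>Ip p. \<forall>f>0. \<gamma> = of_int a / of_nat b \<and> b * pq p dvd f \<longrightarrow>
      z = padic_zsum p f (\<lambda>c. \<rho> (zeta_root (of_int a / of_nat b) ^ c)) \<beta>"
  then have "z = padic_zsum p f (\<lambda>c. \<rho> (zeta_root (of_int a / of_nat b) ^ c)) \<beta>"
    using \<gamma> f by blast
  then show "z = padic_zsum p f (root_char \<rho> \<gamma>) \<beta>"
    unfolding \<gamma>(1) root_char_def .
qed

end

section \<open>The distribution relation\<close>

text \<open>A geometric sum in the n-th root of unity \<open>exp (2 \<pi> i c / n)\<close>.\<close>

lemma sum_cis_fibre:
  assumes n: "n > 0"
  shows "(\<Sum>k<n. zeta_root ((\<delta> + of_nat k) / of_nat n) ^ c)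
    = (if n dvd c then of_nat n * zeta_root \<delta> ^ (c div n) else 0)"
proof -
  define A where "A = cis (2 * pi * (real c * of_rat \<delta> / real n))"
  define \<omega> where "\<omega> = cis (2 * pi * real c / real n)"
  have term_eq: "zeta_root ((\<delta> + of_nat k) / of_nat n) ^ c = A * \<omega> ^ k" for k
  proof -
    have "zeta_root ((\<delta> + of_nat k) / of_nat n) ^ c
        = cis (2 * pi * (real c * of_rat \<delta> / real n) + real k * (2 * pi * real c / real n))"
      using n by (simp add: zeta_root_power of_rat_divide of_rat_add field_simps)
    then show ?thesis by (simp add: A_def \<omega>_def Complex.DeMoivre cis_mult)
  qed
  have sum_eq: "(\<Sum>k<n. zeta_root ((\<delta> + of_nat k) / of_nat n) ^ c) = A * (\<Sum>k<n. \<omega> ^ k)"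
    by (simp only: term_eq sum_distrib_left)
  show ?thesis
  proof (cases "n dvd c")
    case True
    then obtain d where d: "c = n * d" by (elim dvdE)
    have "2 * pi * real c / real n = 2 * pi * real d" using n by (simp add: d)
    then have "\<omega> = 1" unfolding \<omega>_def by simp
    moreover have "A = zeta_root \<delta> ^ d" using n by (simp add: A_def d zeta_root_power)
    ultimately show ?thesis unfolding sum_eq using n by (simp add: d)
  next
    case False
    have "\<omega> ^ n = cis (2 * pi * real c)" using n by (simp add: \<omega>_def Complex.DeMoivre)
    then have "\<omega> ^ n = 1" by simp
    moreover have "\<omega> \<noteq> 1"
    proof
      assume "\<omega> = 1"
      then have "cos (2 * pi * real c / real n) = 1" by (simp add: \<omega>_def complex_eq_iff)
      then obtain z :: int where "2 * pi * real c / real n = of_int z * 2 * pi"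
        using cos_one_2pi_int by blast
      then have "real c = of_int z * real n" using n by (simp add: field_simps)
      then have "int c = z * int n" by (metis of_int_eq_iff of_int_mult of_int_of_nat_eq)
      then have "int n dvd int c" by simp
      then show False using False by simp
    qed
    ultimately have "(\<Sum>k<n. \<omega> ^ k) = 0" by (simp add: sum_gp_strict)
    then show ?thesis unfolding sum_eq using False by simp
  qed
qed

lemma Qcyc_diff: "x \<in> Qcyc p \<Longrightarrow> y \<in> Qcyc p \<Longrightarrow> x - y \<in> Qcyc p"
  and Qcyc_mult: "x \<in> Qcyc p \<Longrightarrow> y \<in> Qcyc p \<Longrightarrow> x * y \<in> Qcyc p"
  and Qcyc_1: "1 \<in> Qcyc p"
  and Qcyc_zeta: "\<gamma> \<in> QZp p \<Longrightarrow> zeta_root \<gamma> \<in> Qcyc p"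
  by (auto simp: Qcyc_def)

lemma Qcyc_0: "0 \<in> Qcyc p"
  using Qcyc_diff[OF Qcyc_1 Qcyc_1] by simp

lemma Qcyc_add: "x \<in> Qcyc p \<Longrightarrow> y \<in> Qcyc p \<Longrightarrow> x + y \<in> Qcyc p"
  using Qcyc_diff[of x p "0 - y"] Qcyc_diff[OF Qcyc_0, of y] by simp

lemma Qcyc_power: "x \<in> Qcyc p \<Longrightarrow> x ^ n \<in> Qcyc p"
  by (induction n) (auto intro: Qcyc_1 Qcyc_mult)

lemma Qcyc_sum: "(\<And>i. i \<in> A \<Longrightarrow> g i \<in> Qcyc p) \<Longrightarrow> sum g A \<in> Qcyc p"
  by (induction A rule: infinite_finite_induct) (auto intro: Qcyc_0 Qcyc_add)

context
  fixes p :: nat and \<rho> :: "complex \<Rightarrow> 'c::field"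
  assumes emb: "is_Qcyc_embedding p \<rho>"
begin

lemma Qcyc_embedding_0: "\<rho> 0 = 0"
proof -
  have "\<rho> (0 + 0) = \<rho> 0 + \<rho> 0" using emb Qcyc_0 unfolding is_Qcyc_embedding_def by blast
  then show ?thesis by (metis add.right_neutral add_left_cancel)
qed

lemma Qcyc_embedding_sum:
  "(\<And>i. i \<in> A \<Longrightarrow> g i \<in> Qcyc p) \<Longrightarrow> \<rho> (sum g A) = (\<Sum>i\<in>A. \<rho> (g i))"
proof (induction A rule: infinite_finite_induct)
  case (insert x A)
  then show ?case
    using emb Qcyc_sum[of A g p] unfolding is_Qcyc_embedding_def by simp
qed (simp_all add: Qcyc_embedding_0)

lemma Qcyc_embedding_of_nat_mult:
  assumes "x \<in> Qcyc p"
  shows "\<rho> (of_nat n * x) = of_nat n * \<rho> x"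
  using Qcyc_embedding_sum[of "{..<n}" "\<lambda>_. x"] assms by simp

end

definition QZp_fibre :: "nat \<Rightarrow> nat \<Rightarrow> rat \<Rightarrow> rat set" where
  "QZp_fibre p n \<delta> = {\<gamma> \<in> QZp p. frac (of_nat n * \<gamma>) = \<delta>}"

lemma frac_eq_if_int_diff: "x - y = of_int k \<Longrightarrow> frac x = frac (y :: rat)"
  by (metis add.commute diff_add_cancel frac_add_of_int_right)

lemma QZp_frac:
  assumes "\<gamma> = of_int a / of_nat b" "b \<in> Ip p"
  shows "frac \<gamma> \<in> QZp p"
proof -
  have "b > 0" using assms(2) by (simp add: Ip_def)
  then have "frac \<gamma> = of_int (a - \<lfloor>\<gamma>\<rfloor> * int b) / of_nat b"
    by (simp add: assms(1) frac_def field_simps)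
  then show ?thesis
    unfolding QZp_def using assms(2) frac_ge_0[of \<gamma>] frac_lt_1[of \<gamma>] by blast
qed

lemma QZp_frac_id: "\<gamma> \<in> QZp p \<Longrightarrow> frac \<gamma> = \<gamma>"
  by (simp add: QZp_def frac_eq)

lemma QZp_0: "0 \<in> QZp p"
proof -
  have "(1 :: nat) \<in> Ip p" by (simp add: Ip_def)
  moreover have "(0 :: rat) = of_int 0 / of_nat 1" by simp
  ultimately have "\<exists>a. \<exists>b\<in>Ip p. (0 :: rat) = of_int a / of_nat b" by blast
  then show ?thesis by (simp add: QZp_def)
qed

lemma QZp_fibre_eq:
  assumes \<delta>: "\<delta> \<in> QZp p" and n: "n \<in> Ip p"
  shows "QZp_fibre p n \<delta> = (\<lambda>k. (\<delta> + of_nat k) / of_nat n) ` {..<n}"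
    and "inj_on (\<lambda>k. (\<delta> + of_nat k) / (of_nat n :: rat)) {..<n}"
proof -
  have n0: "n > 0" using n by (simp add: Ip_def)
  have \<delta>01: "0 \<le> \<delta>" "\<delta> < 1" using \<delta> by (auto simp: QZp_def)
  obtain a b where ab: "b \<in> Ip p" "\<delta> = of_int a / of_nat b" using \<delta> by (auto simp: QZp_def)
  have b0: "b > 0" using ab by (simp add: Ip_def)
  show "inj_on (\<lambda>k. (\<delta> + of_nat k) / (of_nat n :: rat)) {..<n}"
    using n0 by (auto intro!: inj_onI)
  show "QZp_fibre p n \<delta> = (\<lambda>k. (\<delta> + of_nat k) / of_nat n) ` {..<n}"
  proof (intro equalityI subsetI)
    fix \<gamma> assume "\<gamma> \<in> QZp_fibre p n \<delta>"
    then have \<gamma>: "0 \<le> \<gamma>" "\<gamma> < 1" "frac (of_nat n * \<gamma>) = \<delta>" by (auto simp: QZp_fibre_def QZp_def)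
    define k where "k = nat \<lfloor>of_nat n * \<gamma>\<rfloor>"
    have fl: "\<lfloor>of_nat n * \<gamma>\<rfloor> \<ge> 0" using \<gamma> by simp
    then have "of_nat n * \<gamma> = \<delta> + of_nat k"
      using \<gamma>(3) by (simp add: k_def frac_def)
    moreover have "k < n"
    proof -
      have "of_nat n * \<gamma> < of_nat n * 1" using \<gamma> n0 by (intro mult_strict_left_mono) auto
      then have "\<lfloor>of_nat n * \<gamma>\<rfloor> < int n" by (simp add: floor_less_iff)
      then show ?thesis unfolding k_def by (subst nat_less_iff[OF fl])
    qed
    ultimately show "\<gamma> \<in> (\<lambda>k. (\<delta> + of_nat k) / of_nat n) ` {..<n}"
      using n0 by (intro image_eqI[of _ _ k]) (auto simp: field_simps)
  next
    fix \<gamma> assume "\<gamma> \<in> (\<lambda>k. (\<delta> + of_nat k) / of_nat n) ` {..<n}"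
    then obtain k where k: "k < n" "\<gamma> = (\<delta> + of_nat k) / of_nat n" by auto
    have "\<delta> + of_nat k < 1 + of_nat k" using \<delta>01 by simp
    also have "1 + of_nat k \<le> (of_nat n :: rat)" using k(1) by (metis Suc_leI of_nat_Suc of_nat_le_iff)
    finally have "\<gamma> < 1" using n0 k(2) by simp
    moreover have "0 \<le> \<gamma>" using k(2) \<delta>01 by simp
    moreover have "\<gamma> = of_int (a + int (k * b)) / of_nat (b * n)"
      using b0 n0 by (simp add: k(2) ab(2) field_simps)
    moreover have "b * n \<in> Ip p" using ab n by (simp add: Ip_def)
    ultimately have "\<gamma> \<in> QZp p" unfolding QZp_def by blast
    moreover have "frac (of_nat n * \<gamma>) = \<delta>"
    proof -
      have "of_nat n * \<gamma> - \<delta> = of_int (int k)" using n0 by (simp add: k(2))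
      then have "frac (of_nat n * \<gamma>) = frac \<delta>" by (rule frac_eq_if_int_diff)
      then show ?thesis by (simp add: QZp_frac_id[OF \<delta>])
    qed
    ultimately show "\<gamma> \<in> QZp_fibre p n \<delta>" by (simp add: QZp_fibre_def)
  qed
qed

lemma sum_QZp_fibre:
  assumes "\<delta> \<in> QZp p" "n \<in> Ip p"
  shows "(\<Sum>\<gamma>\<in>QZp_fibre p n \<delta>. g \<gamma>) = (\<Sum>k<n. g ((\<delta> + of_nat k) / of_nat n))"
  using sum.reindex[OF QZp_fibre_eq(2)[OF assms], of g] by (simp add: QZp_fibre_eq(1)[OF assms])

lemma finite_QZp_fibre:
  assumes "\<delta> \<in> QZp p" "n \<in> Ip p"
  shows "finite (QZp_fibre p n \<delta>)"
  by (simp add: QZp_fibre_eq(1)[OF assms])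

lemma card_QZp_fibre:
  assumes "\<delta> \<in> QZp p" "n \<in> Ip p"
  shows "card (QZp_fibre p n \<delta>) = n"
  by (simp add: QZp_fibre_eq(1)[OF assms] card_image[OF QZp_fibre_eq(2)[OF assms]])

context padic_complex
begin

lemma sum_root_char_fibre:
  assumes emb: "is_Qcyc_embedding p (\<rho> :: complex \<Rightarrow> 'c)" and \<delta>: "\<delta> \<in> QZp p" and n: "n \<in> Ip p"
  shows "(\<Sum>\<gamma>\<in>QZp_fibre p n \<delta>. root_char \<rho> \<gamma> c)
    = (if n dvd c then of_nat n * root_char \<rho> \<delta> (c div n) else 0)"
proof -
  have n0: "n > 0" using n by (simp add: Ip_def)
  have "(\<Sum>\<gamma>\<in>QZp_fibre p n \<delta>. root_char \<rho> \<gamma> c) = \<rho> (\<Sum>\<gamma>\<in>QZp_fibre p n \<delta>. zeta_root \<gamma> ^ c)"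
    unfolding root_char_def
    by (subst Qcyc_embedding_sum[OF emb]) (auto simp: QZp_fibre_def intro: Qcyc_power Qcyc_zeta)
  also have "(\<Sum>\<gamma>\<in>QZp_fibre p n \<delta>. zeta_root \<gamma> ^ c)
      = (if n dvd c then of_nat n * zeta_root \<delta> ^ (c div n) else 0)"
    by (simp only: sum_QZp_fibre[OF \<delta> n] sum_cis_fibre[OF n0])
  also have "\<rho> \<dots> = (if n dvd c then of_nat n * root_char \<rho> \<delta> (c div n) else 0)"
    using Qcyc_embedding_of_nat_mult[OF emb Qcyc_power[OF Qcyc_zeta[OF \<delta>]]] Qcyc_embedding_0[OF emb]
    by (simp add: root_char_def)
  finally show ?thesis .
qed

text \<open>Only multiples of n survive the sum over the fibre, and \<open>\<langle>n d\<rangle>\<^sup>s = \<langle>n\<rangle>\<^sup>s \<langle>d\<rangle>\<^sup>s\<close>.\<close>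

lemma sum_unit_term_fibre:
  assumes emb: "is_Qcyc_embedding p (\<rho> :: complex \<Rightarrow> 'c)" and \<delta>: "\<delta> \<in> QZp p" and n: "n \<in> Ip p"
    and s: "s \<in> padic_disc p"
  shows "(\<Sum>\<gamma>\<in>QZp_fibre p n \<delta>. \<Sum>c<n * M. unit_term (root_char \<rho> \<gamma>) s c)
    = of_nat n * ang_pow p (of_nat n) s * (\<Sum>d<M. unit_term (root_char \<rho> \<delta>) s d)"
proof -
  have n0: "n > 0" and pn: "\<not> p dvd n" using n by (auto simp: Ip_iff)
  let ?g = "\<lambda>c. unit_term (\<lambda>c. if n dvd c then of_nat n * root_char \<rho> \<delta> (c div n) else 0) s c"
  have "(\<Sum>\<gamma>\<in>QZp_fibre p n \<delta>. \<Sum>c<n * M. unit_term (root_char \<rho> \<gamma>) s c) = (\<Sum>c<n * M. ?g c)"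
    by (subst sum.swap) (auto simp: unit_term_def sum_root_char_fibre[OF emb \<delta> n, symmetric]
        sum_distrib_right intro!: sum.cong)
  also have "\<dots> = (\<Sum>c\<in>(\<lambda>d. n * d) ` {..<M}. ?g c)"
    by (intro sum.mono_neutral_right) (use n0 in \<open>auto simp: unit_term_def elim!: dvdE\<close>)
  also have "\<dots> = (\<Sum>d<M. ?g (n * d))"
    using n0 by (subst sum.reindex) (auto simp: inj_on_def)
  also have "\<dots> = (\<Sum>d<M. of_nat n * ang_pow p (of_nat n) s * unit_term (root_char \<rho> \<delta>) s d)"
  proof (intro sum.cong refl)
    fix d
    show "?g (n * d) = of_nat n * ang_pow p (of_nat n) s * unit_term (root_char \<rho> \<delta>) s d"
    proof (cases "p dvd d")
      case False
      then have d: "d \<in> Ip p" unfolding Ip_iff by (metis dvd_0_right gr0I)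
      have "ang_pow p (of_nat n * of_nat d) s = ang_pow p (of_nat n) s * ang_pow p (of_nat d) s"
        by (intro ang_pow_mult s unit_rat_of_nat n d)
      moreover have "\<not> p dvd n * d" using False pn prime_dvd_mult_iff[OF prime_p] by simp
      ultimately show ?thesis using False n0 by (simp add: unit_term_def mult_ac)
    qed (simp add: unit_term_def)
  qed
  finally show ?thesis by (simp add: sum_distrib_left)
qed

text \<open>The zeta values of the fibre are all computed with one modulus \<open>g = n f\<close>, and that of \<open>\<delta>\<close> with f, so that
  the sum of length \<open>n (p\<^sup>N f)\<close> for the fibre becomes the sum of length \<open>p\<^sup>N f\<close> for \<open>\<delta>\<close>.\<close>

lemma Z_rho_distribution:
  assumes \<beta>: "(\<beta> :: 'c) \<in> padic_disc p" "\<beta> \<noteq> 1" and emb: "is_Qcyc_embedding p \<rho>"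
    and \<delta>: "\<delta> \<in> QZp p" and n: "n \<in> Ip p"
  shows "(\<Sum>\<gamma>\<in>QZp_fibre p n \<delta>. Z_rho p \<rho> \<gamma> \<beta>) = ang_pow p (of_nat n) (1 - \<beta>) * Z_rho p \<rho> \<delta> \<beta>"
proof -
  have n0: "n > 0" using n by (simp add: Ip_def)
  obtain a b where ab: "b \<in> Ip p" "\<delta> = of_int a / of_nat b" using \<delta> by (auto simp: QZp_def)
  have b0: "b > 0" using ab by (simp add: Ip_def)
  define f where "f = b * pq p"
  define g where "g = n * f"
  have f: "f > 0" "pq p dvd f" "b * pq p dvd f" using b0 pq_pos by (auto simp: f_def)
  have g: "g > 0" "pq p dvd g" "(b * n) * pq p dvd g" using f n0 by (auto simp: g_def f_def mult_ac)
  have s: "1 - \<beta> \<in> padic_disc p" by (intro padic_disc_diff one_in_padic_disc \<beta>)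
  have rep: "\<exists>a'. \<gamma> = of_int a' / of_nat (b * n)" if \<gamma>: "\<gamma> \<in> QZp_fibre p n \<delta>" for \<gamma>
  proof -
    obtain k where "\<gamma> = (\<delta> + of_nat k) / of_nat n"
      using \<gamma> unfolding QZp_fibre_eq(1)[OF \<delta> n] by auto
    then have "\<gamma> = of_int (a + int (k * b)) / of_nat (b * n)"
      using b0 n0 by (simp add: ab(2) field_simps)
    then show ?thesis by blast
  qed
  have bn: "b * n \<in> Ip p" using ab(1) n by (rule Ip_mult)
  define S where "S \<gamma> F = (\<Sum>c<F. unit_term (root_char \<rho> \<gamma>) (1 - \<beta>) c)" for \<gamma> F
  have lim_\<gamma>: "(\<lambda>N. S \<gamma> (1 * p ^ N * g) / of_nat (1 * p ^ N * g)) \<longlonglongrightarrow> (\<beta> - 1) * Z_rho p \<rho> \<gamma> \<beta>"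
    if \<gamma>: "\<gamma> \<in> QZp_fibre p n \<delta>" for \<gamma>
  proof -
    obtain a' where a': "\<gamma> = of_int a' / of_nat (b * n)" using rep[OF \<gamma>] by blast
    show ?thesis
      unfolding S_def Z_rho_eq[OF \<beta> a' bn g(3,1)]
      by (intro zsum_limit \<beta> g root_char_periodic[OF a' bn]) simp
  qed
  have "(\<lambda>N. \<Sum>\<gamma>\<in>QZp_fibre p n \<delta>. S \<gamma> (1 * p ^ N * g) / of_nat (1 * p ^ N * g))
      \<longlonglongrightarrow> (\<Sum>\<gamma>\<in>QZp_fibre p n \<delta>. (\<beta> - 1) * Z_rho p \<rho> \<gamma> \<beta>)"
    by (intro tendsto_sum lim_\<gamma>)
  moreover have "(\<Sum>\<gamma>\<in>QZp_fibre p n \<delta>. S \<gamma> (1 * p ^ N * g) / of_nat (1 * p ^ N * g))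
      = ang_pow p (of_nat n) (1 - \<beta>) * (S \<delta> (1 * p ^ N * f) / of_nat (1 * p ^ N * f))" for N
  proof -
    have eq: "1 * p ^ N * g = n * (1 * p ^ N * f)" by (simp add: g_def)
    have "(\<Sum>\<gamma>\<in>QZp_fibre p n \<delta>. S \<gamma> (1 * p ^ N * g))
        = of_nat n * ang_pow p (of_nat n) (1 - \<beta>) * S \<delta> (1 * p ^ N * f)"
      unfolding S_def eq by (rule sum_unit_term_fibre[OF emb \<delta> n s])
    then show ?thesis using n0 by (simp add: g_def flip: sum_divide_distrib)
  qed
  moreover have "(\<lambda>N. S \<delta> (1 * p ^ N * f) / of_nat (1 * p ^ N * f)) \<longlonglongrightarrow> (\<beta> - 1) * Z_rho p \<rho> \<delta> \<beta>"
    unfolding S_def Z_rho_eq[OF \<beta> ab(2,1) f(3,1)]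
    by (intro zsum_limit \<beta> f root_char_periodic[OF ab(2,1)]) simp
  ultimately have "(\<Sum>\<gamma>\<in>QZp_fibre p n \<delta>. (\<beta> - 1) * Z_rho p \<rho> \<gamma> \<beta>)
      = ang_pow p (of_nat n) (1 - \<beta>) * ((\<beta> - 1) * Z_rho p \<rho> \<delta> \<beta>)"
    by (simp only:) (rule LIMSEQ_unique, assumption, erule tendsto_mult_left)
  then have "(\<beta> - 1) * (\<Sum>\<gamma>\<in>QZp_fibre p n \<delta>. Z_rho p \<rho> \<gamma> \<beta>)
      = (\<beta> - 1) * (ang_pow p (of_nat n) (1 - \<beta>) * Z_rho p \<rho> \<delta> \<beta>)"
    by (simp add: sum_distrib_left mult_ac)
  then show ?thesis using \<beta>(2) by simp
qed

lemma Z_rho_0_eq_Lp: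
  assumes \<beta>: "(\<beta> :: 'c) \<in> padic_disc p" "\<beta> \<noteq> 1" and emb: "is_Qcyc_embedding p \<rho>"
  shows "Z_rho p \<rho> 0 \<beta> = Lp_trivial p \<beta>"
proof -
  have "Z_rho p \<rho> 0 \<beta> = padic_zsum p (pq p) (root_char \<rho> 0) \<beta>"
    by (rule Z_rho_eq[OF \<beta>, of _ 0 1]) (use Ip_1 pq_pos in auto)
  also have "root_char \<rho> 0 = (\<lambda>c. 1)"
    using emb by (simp add: fun_eq_iff root_char_def zeta_root_def is_Qcyc_embedding_def)
  finally show ?thesis by (simp add: Lp_trivial_def)
qed

section \<open>Non-vanishing of the p-adic zeta function\<close>

text \<open>With \<open>R = max 1 \<bar>s\<bar>\<close> the term is at most \<open>(R/q)\<^sup>j / \<bar>j!\<bar>\<close>, where \<open>R/q < rad\<close>; insert the two lower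
  bounds for the factorial.\<close>

lemma vabs_gbinomial_pq_power_less:
  assumes s: "(s :: 'c) \<in> padic_disc p" and j: "j > 0"
  shows "vabs ((s gchoose j) * of_nat (pq p) ^ j) < rad"
    and "(p - 1) dvd j \<Longrightarrow> vabs ((s gchoose j) * of_nat (pq p) ^ j) < 1 / real p"
proof -
  define R where "R = max 1 (vabs s)"
  have R: "1 \<le> R" "vabs s \<le> R" by (auto simp: R_def)
  have Rq: "R / real (pq p) < rad"
    using s pq_rad_gt_1 pq_pos by (auto simp: R_def padic_disc_iff field_simps)
  have pow: "(R / real (pq p)) ^ j < rad ^ j"
    using Rq R pq_pos j by (intro power_strict_mono) auto
  have main: "vabs ((s gchoose j) * of_nat (pq p) ^ j) < rad ^ j / rad ^ i"
    if i: "rad ^ i \<le> vabs (fact j :: 'c)" for i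
  proof -
    have f0: "vabs (fact j :: 'c) > 0" by simp
    have "vabs ((s gchoose j) * of_nat (pq p) ^ j) * vabs (fact j :: 'c)
        = vabs (s gchoose j) * vabs (fact j :: 'c) * (1 / real (pq p)) ^ j"
      by (simp add: vabs_mult vabs_power vabs_pq)
    also have "\<dots> \<le> R ^ j * (1 / real (pq p)) ^ j"
      by (intro mult_right_mono vabs_gbinomial_mult_fact_le R) simp
    also have "\<dots> = (R / real (pq p)) ^ j" by (simp add: power_divide)
    also have "\<dots> < rad ^ j" by (rule pow)
    finally have "vabs ((s gchoose j) * of_nat (pq p) ^ j) < rad ^ j / vabs (fact j :: 'c)"
      using f0 by (simp add: field_simps)
    also have "\<dots> \<le> rad ^ j / rad ^ i"
      using i rad_pos by (intro divide_left_mono) auto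
    finally show ?thesis .
  qed
  have "rad ^ j / rad ^ (j - 1) = rad"
    using rad_pos j by (cases j) auto
  then show "vabs ((s gchoose j) * of_nat (pq p) ^ j) < rad"
    using main[OF vabs_fact_ge[OF j]] by simp
  assume dvd: "(p - 1) dvd j"
  then have "p - 1 \<le> j" using j by (intro dvd_imp_le)
  then have "rad ^ j = rad ^ (p - 1) * rad ^ (j - (p - 1))" by (simp flip: power_add)
  then have "rad ^ j / rad ^ (j - (p - 1)) = 1 / real p"
    using rad_pos rad_power by simp
  then show "vabs ((s gchoose j) * of_nat (pq p) ^ j) < 1 / real p"
    using main[OF vabs_fact_ge_dvd[OF j dvd]] by simp
qed

definition unit_residues :: "nat set" where
  "unit_residues = {c. 1 \<le> c \<and> c < pq p \<and> \<not> p dvd c}"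

lemma unit_residues_Ip: "c \<in> unit_residues \<Longrightarrow> c \<in> Ip p"
  by (simp add: unit_residues_def Ip_iff)

lemma unit_residues_odd: "odd p \<Longrightarrow> unit_residues = {1..<p}"
  by (auto simp: unit_residues_def pq_def dest: dvd_imp_le)

lemma unit_residues_2:
  assumes "p = 2"
  shows "unit_residues = {1, 3}"
proof -
  have "unit_residues = {c. 1 \<le> c \<and> c < pq p \<and> \<not> p dvd c}" by (rule unit_residues_def)
  also have "\<dots> = {c. 1 \<le> c \<and> c < 4 \<and> odd c}" using assms by (simp add: pq_def)
  finally have "unit_residues = {c. 1 \<le> c \<and> c < 4 \<and> odd c}" .
  moreover have "1 \<le> c \<and> c < 4 \<and> odd c \<longleftrightarrow> c = 1 \<or> c = 3" for c :: nat by presburger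
  ultimately show ?thesis by (auto simp only: mem_Collect_eq insert_iff empty_iff)
qed

definition unit_power_sum :: "'c \<Rightarrow> nat \<Rightarrow> 'c" where
  "unit_power_sum s j = (\<Sum>c\<in>unit_residues. ang_pow p (of_nat c) s / of_nat c ^ j)"

text \<open>Interchange the finite sum over the residues c with the series over j.\<close>

lemma padic_zsum_eq_unit_power_sums:
  assumes s: "1 - \<beta> \<in> (padic_disc p :: 'c set)" and \<beta>: "\<beta> \<noteq> 1"
  shows "(\<lambda>j. ((1 - \<beta>) gchoose j) * of_nat (pq p) ^ j * of_rat (bernoulli_num j)
      * unit_power_sum (1 - \<beta>) j) sums ((\<beta> - 1) * of_nat (pq p) * Lp_trivial p \<beta>)"
proof -
  let ?q = "of_nat (pq p) :: 'c"
  let ?s = "1 - \<beta>"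
  let ?b = "\<lambda>j. of_rat (bernoulli_num j) :: 'c"
  let ?u = "\<lambda>c j. (?s gchoose j) * (?q / of_nat c) ^ j * ?b j"
  have u_sums: "?u c sums suminf (?u c)" if c: "c \<in> unit_residues" for c
  proof (intro summable_sums summable_vabs tendsto_vabs_le)
    have x: "vabs (?q / of_nat c) \<le> 1 / real (pq p)"
      using vabs_Ip[OF unit_residues_Ip[OF c]] by (simp add: vabs_divide vabs_pq)
    show "(\<lambda>j. vabs ((?s gchoose j) * (?q / of_nat c) ^ j) * real p) \<longlonglongrightarrow> 0"
      using binom_terms_tendsto_0[OF padic_disc_binom_dom[OF s x]]
      by (intro tendsto_mult_left_zero) (simp add: tendsto_vabs_0_iff)
    show "vabs (?u c j - 0) \<le> vabs ((?s gchoose j) * (?q / of_nat c) ^ j) * real p" for j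
      using mult_left_mono[OF vabs_bernoulli_le[of j], of "vabs ((?s gchoose j) * (?q / of_nat c) ^ j)"]
      by (simp add: vabs_mult)
  qed
  have "(\<lambda>j. \<Sum>c\<in>unit_residues. ang_pow p (of_nat c) ?s * ?u c j)
      sums (\<Sum>c\<in>unit_residues. ang_pow p (of_nat c) ?s * suminf (?u c))"
    by (intro sums_sum sums_mult_vabs u_sums)
  moreover have "(\<Sum>c\<in>unit_residues. ang_pow p (of_nat c) ?s * ?u c j)
      = (?s gchoose j) * ?q ^ j * ?b j * unit_power_sum ?s j" for j
    by (simp add: unit_power_sum_def sum_distrib_left power_divide mult_ac)
  moreover have "(\<Sum>c\<in>unit_residues. ang_pow p (of_nat c) ?s * suminf (?u c))
      = (\<beta> - 1) * ?q * Lp_trivial p \<beta>"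
  proof -
    have "(\<beta> - 1) * (1 * (A / (\<beta> - 1)) * B) = A * B" for A B using \<beta> by simp
    then have "(\<beta> - 1) * (\<Sum>c\<in>unit_residues. 1 * (ang_pow p (of_nat c) ?s / (\<beta> - 1)) * suminf (?u c))
        = (\<Sum>c\<in>unit_residues. ang_pow p (of_nat c) ?s * suminf (?u c))"
      by (simp only: sum_distrib_left)
    moreover have "(\<beta> - 1) * ?q * (1 / ?q * T) = (\<beta> - 1) * T" for T using pq_pos by simp
    ultimately show ?thesis
      by (simp only: Lp_trivial_def padic_zsum_def unit_residues_def)
  qed
  ultimately show ?thesis by simp
qed

text \<open>The term of index 0 dominates: it is a unit for odd p and has absolute value 1/2 for \<open>p = 2\<close>.  For
  odd p this uses that a Bernoulli number with denominator divisible by p comes with a factorial of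
  smaller than usual p-adic valuation.  For \<open>p = 2\<close> one gains from the two terms of each
  \<open>unit_power_sum\<close> being congruent mod 2.\<close>

lemma unit_power_sum_term_less:
  assumes s: "(s :: 'c) \<in> padic_disc p" and j: "j > 0"
  shows "vabs ((s gchoose j) * of_nat (pq p) ^ j * of_rat (bernoulli_num j) * unit_power_sum s j)
    < vabs (unit_power_sum s 0)"
proof (cases "p = 2")
  case False
  then have odd: "odd p" using prime_p prime_odd_nat p_ge_2 by (metis le_neq_implies_less)
  have "vabs (unit_power_sum s j) \<le> 1"
    unfolding unit_power_sum_def
    by (intro vabs_sum_le)
      (auto simp: vabs_divide vabs_power vabs_Ip unit_residues_Ip vabs_ang_pow[OF s] unit_rat_of_nat)
  moreover have "vabs ((s gchoose j) * of_nat (pq p) ^ j * of_rat (bernoulli_num j)) < 1"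
  proof (cases "(p - 1) dvd j")
    case True
    have "vabs ((s gchoose j) * of_nat (pq p) ^ j) * vabs (of_rat (bernoulli_num j) :: 'c)
        \<le> vabs ((s gchoose j) * of_nat (pq p) ^ j) * real p"
      by (intro mult_left_mono vabs_bernoulli_le) simp
    also have "\<dots> < 1 / real p * real p"
      using vabs_gbinomial_pq_power_less(2)[OF s j True] p_pos by (intro mult_strict_right_mono) auto
    finally show ?thesis using p_pos by (simp add: vabs_mult)
  next
    case False
    have "vabs ((s gchoose j) * of_nat (pq p) ^ j) * vabs (of_rat (bernoulli_num j) :: 'c)
        \<le> vabs ((s gchoose j) * of_nat (pq p) ^ j) * 1"
      by (intro mult_left_mono vabs_bernoulli_le_1 odd False) simp
    then show ?thesis
      using vabs_gbinomial_pq_power_less(1)[OF s j] rad_less_1 by (simp add: vabs_mult)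
  qed
  ultimately have "vabs ((s gchoose j) * of_nat (pq p) ^ j * of_rat (bernoulli_num j))
      * vabs (unit_power_sum s j) < 1"
    using mult_left_le[of "vabs (unit_power_sum s j)"
        "vabs ((s gchoose j) * of_nat (pq p) ^ j * of_rat (bernoulli_num j))"] by simp
  moreover have "vabs (unit_power_sum s 0) = 1"
  proof -
    have eq: "unit_power_sum s 0 = of_nat (p - 1) + (\<Sum>c\<in>unit_residues. ang_pow p (of_nat c) s - 1)"
      by (simp add: unit_power_sum_def sum_subtractf unit_residues_odd[OF odd])
    have p1: "vabs (of_nat (p - 1) :: 'c) = 1"
      using p_ge_2 by (intro vabs_of_nat_not_dvd) (auto dest: dvd_imp_le)
    have "vabs (\<Sum>c\<in>unit_residues. ang_pow p (of_nat c) s - 1) < 1"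
      by (intro vabs_sum_less vabs_less_1_if_rad vabs_ang_pow_minus_1_less[OF s] unit_rat_of_nat
          unit_residues_Ip) simp_all
    then show ?thesis unfolding eq using p1 by (simp add: vabs_add_eq_left)
  qed
  ultimately show ?thesis by (simp add: vabs_mult)
next
  case True
  have rad: "rad = 1 / 2" using rad_power True by simp
  have v2: "vabs (2 :: 'c) = 1 / 2" using vabs_p True by simp
  have three: "3 \<in> Ip p" unfolding Ip_iff using True by simp
  have v3: "vabs (3 :: 'c) = 1" using vabs_Ip[OF three] by simp
  define u where "u = ang_pow p 3 s"
  have u: "vabs (u - 1) < 1 / 2"
    using vabs_ang_pow_minus_1_less[OF s unit_rat_of_nat[OF three]] by (simp add: u_def rad)
  have E: "unit_power_sum s i = 1 + u / 3 ^ i" for i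
    by (simp add: unit_power_sum_def unit_residues_2[OF True] u_def)
  have E_le: "vabs (unit_power_sum s i) \<le> 1 / 2" for i
  proof -
    have "vabs (3 ^ i - 1 ^ i :: 'c) \<le> vabs (3 - 1 :: 'c)"
      using v3 by (intro vabs_power_diff_le) auto
    then have "vabs (3 ^ i - 1 :: 'c) \<le> 1 / 2" using v2 by simp
    then have "vabs ((u - 1) - (3 ^ i - 1)) \<le> 1 / 2" by (rule vabs_diff_le[OF less_imp_le[OF u]])
    moreover have "u / 3 ^ i - 1 = ((u - 1) - (3 ^ i - 1)) / 3 ^ i" by (simp add: field_simps)
    ultimately have "vabs (u / 3 ^ i - 1) \<le> 1 / 2" by (simp add: vabs_divide vabs_power v3)
    then have "vabs (2 + (u / 3 ^ i - 1)) \<le> 1 / 2" using v2 by (intro vabs_add_le) auto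
    moreover have "2 + (u / 3 ^ i - 1) = 1 + u / 3 ^ i" by simp
    ultimately show ?thesis by (simp only: E)
  qed
  have "vabs ((s gchoose j) * of_nat (pq p) ^ j) * vabs (of_rat (bernoulli_num j) :: 'c)
      \<le> vabs ((s gchoose j) * of_nat (pq p) ^ j) * real p"
    by (intro mult_left_mono vabs_bernoulli_le) simp
  also have "\<dots> < 1 / real p * real p"
    using vabs_gbinomial_pq_power_less(2)[OF s j] True by (intro mult_strict_right_mono) auto
  finally have "vabs ((s gchoose j) * of_nat (pq p) ^ j * of_rat (bernoulli_num j)) < 1"
    using True by (simp add: vabs_mult)
  then have "vabs ((s gchoose j) * of_nat (pq p) ^ j * of_rat (bernoulli_num j))
      * (1 / 2) < 1 * (1 / 2)"
    by (intro mult_strict_right_mono) auto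
  moreover have "vabs ((s gchoose j) * of_nat (pq p) ^ j * of_rat (bernoulli_num j) * unit_power_sum s j)
      \<le> vabs ((s gchoose j) * of_nat (pq p) ^ j * of_rat (bernoulli_num j)) * (1 / 2)"
    unfolding vabs_mult[of _ "unit_power_sum s j"] by (intro mult_left_mono E_le) simp
  moreover have "vabs (unit_power_sum s 0) = 1 / 2"
  proof -
    have "vabs (2 + (u - 1)) = vabs (2 :: 'c)" using u v2 by (intro vabs_add_eq_left) simp
    moreover have "2 + (u - 1) = 1 + u" by simp
    ultimately show ?thesis using v2 by (simp add: E)
  qed
  ultimately show ?thesis by simp
qed

text \<open>If the value were 0, the sum of the terms with \<open>j \<ge> 1\<close>, all strictly smaller than the term with
  \<open>j = 0\<close>, would cancel it.\<close>

lemma Lp_trivial_nonzero: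
  assumes \<beta>: "(\<beta> :: 'c) \<in> padic_disc p" "\<beta> \<noteq> 1"
  shows "Lp_trivial p \<beta> \<noteq> 0"
proof
  assume L0: "Lp_trivial p \<beta> = 0"
  define s where "s = 1 - \<beta>"
  have s: "s \<in> padic_disc p" unfolding s_def by (intro padic_disc_diff one_in_padic_disc \<beta>)
  let ?f = "\<lambda>j. (s gchoose j) * of_nat (pq p) ^ j * of_rat (bernoulli_num j) * unit_power_sum s j"
  have sums: "?f sums 0"
    using padic_zsum_eq_unit_power_sums[of \<beta>] s \<beta>(2) L0 by (simp add: s_def)
  have "?f \<longlonglongrightarrow> 0" by (rule sums_terms_tendsto_0[OF sums])
  then have f_Suc: "(\<lambda>j. ?f (Suc j)) \<longlonglongrightarrow> 0" by (rule LIMSEQ_Suc)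
  have "vabs (0 - ?f 0) < vabs (unit_power_sum s 0)"
    by (rule sums_vabs_less[OF sums_Suc_vabs[OF sums] f_Suc unit_power_sum_term_less[OF s zero_less_Suc]])
  then show False by (simp add: bernoulli_num_0)
qed

end

section \<open>Linear functionals on the free algebra\<close>

lemma letters_0 [simp]: "letters 0 = []"
  by (simp add: zero_bc_word_def)

lemma letters_plus [simp]: "letters (u + v) = letters u @ letters v"
  by (simp add: plus_bc_word_def)

definition bc_words :: "nat \<Rightarrow> bc_word set" where
  "bc_words p = {w. set (letters w) \<subseteq> bc_gens p}"

lemma bc_words_0 [simp]: "0 \<in> bc_words p"
  by (simp add: bc_words_def)

lemma bc_words_plus [simp]: "u + v \<in> bc_words p \<longleftrightarrow> u \<in> bc_words p \<and> v \<in> bc_words p"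
  by (auto simp: bc_words_def)

definition bc_elems :: "nat \<Rightarrow> (bc_word \<Rightarrow>\<^sub>0 'r::comm_ring_1) set" where
  "bc_elems p = {x. Poly_Mapping.keys x \<subseteq> bc_words p}"

lemma carrier_bc_free: "carrier (bc_free p) = bc_elems p"
  by (auto simp: bc_free_def bc_elems_def bc_words_def)

lemma bc_elems_0 [simp]: "0 \<in> bc_elems p" and bc_elems_1 [simp]: "1 \<in> bc_elems p"
  by (auto simp: bc_elems_def)

lemma bc_elems_single: "w \<in> bc_words p \<Longrightarrow> Poly_Mapping.single w c \<in> bc_elems p"
  by (auto simp: bc_elems_def)

lemma bc_elems_const [simp]: "bc_const c \<in> bc_elems p"
  by (simp add: bc_const_def bc_elems_single)

lemma bc_elems_add [simp]: "x \<in> bc_elems p \<Longrightarrow> y \<in> bc_elems p \<Longrightarrow> x + y \<in> bc_elems p"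
  using Poly_Mapping.keys_add[of x y] by (auto simp: bc_elems_def)

lemma bc_elems_uminus [simp]: "x \<in> bc_elems p \<Longrightarrow> - x \<in> bc_elems p"
  by (auto simp: bc_elems_def in_keys_iff subset_iff)

lemma bc_elems_diff [simp]: "x \<in> bc_elems p \<Longrightarrow> y \<in> bc_elems p \<Longrightarrow> x - y \<in> bc_elems p"
  using bc_elems_add[of x p "- y"] bc_elems_uminus[of y p] by simp

lemma bc_elems_mult [simp]: "x \<in> bc_elems p \<Longrightarrow> y \<in> bc_elems p \<Longrightarrow> x * y \<in> bc_elems p"
  using Poly_Mapping.keys_mult[of x y] unfolding bc_elems_def by fastforce

lemma bc_elems_sum [simp]: "(\<And>i. i \<in> A \<Longrightarrow> g i \<in> bc_elems p) \<Longrightarrow> sum g A \<in> bc_elems p"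
  by (induction A rule: infinite_finite_induct) auto

lemma bc_elems_of_nat [simp]: "of_nat n \<in> bc_elems p"
  by (induction n) auto

lemma poly_mapping_sum_singles:
  "x = (\<Sum>w\<in>Poly_Mapping.keys x. Poly_Mapping.single w (Poly_Mapping.lookup x w))"
proof (rule poly_mapping_eqI)
  fix v
  have "Poly_Mapping.lookup (\<Sum>w\<in>Poly_Mapping.keys x. Poly_Mapping.single w (Poly_Mapping.lookup x w)) v
      = (\<Sum>w\<in>Poly_Mapping.keys x. if w = v then Poly_Mapping.lookup x v else 0)"
    unfolding lookup_sum by (intro sum.cong refl) (auto simp: lookup_single when_def)
  then show "Poly_Mapping.lookup x v
      = Poly_Mapping.lookup (\<Sum>w\<in>Poly_Mapping.keys x. Poly_Mapping.single w (Poly_Mapping.lookup x w)) v"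
    by (simp add: not_in_keys_iff_lookup_eq_zero)
qed

lemma bc_elems_induct [consumes 1, case_names add single]:
  assumes "x \<in> bc_elems p"
    and add: "\<And>x y. P x \<Longrightarrow> P y \<Longrightarrow> P (x + y)"
    and single: "\<And>w c. w \<in> bc_words p \<Longrightarrow> P (Poly_Mapping.single w c)"
  shows "P x"
proof -
  have "P (\<Sum>w\<in>A. Poly_Mapping.single w (Poly_Mapping.lookup x w))" if "A \<subseteq> bc_words p" for A
    using that
  proof (induction A rule: infinite_finite_induct)
    case (insert w A) then show ?case by (auto intro!: add single)
  qed (use single[of 0 0] in simp_all)
  then have "P (\<Sum>w\<in>Poly_Mapping.keys x. Poly_Mapping.single w (Poly_Mapping.lookup x w))"
    using assms(1) by (simp add: bc_elems_def)
  then show ?thesis by (simp only: poly_mapping_sum_singles[symmetric])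
qed

lemma bc_const_mult_single: "bc_const c * Poly_Mapping.single w d = Poly_Mapping.single w (c * d)"
  by (simp add: bc_const_def mult_single)

lemma bc_const_add: "bc_const (c + d) = bc_const c + bc_const d"
  by (simp add: bc_const_def single_add)

lemma bc_const_1 [simp]: "bc_const 1 = 1"
  by (simp add: bc_const_def)

lemma bc_const_0 [simp]: "bc_const 0 = 0"
  by (simp add: bc_const_def)

lemma bc_const_of_nat: "bc_const (of_nat n) = of_nat n"
  by (induction n) (simp_all add: bc_const_add)

lemma bc_const_central:
  fixes x :: "bc_word \<Rightarrow>\<^sub>0 'r::comm_ring_1"
  shows "x * bc_const c = bc_const c * x"
proof -
  have "(\<Sum>w\<in>A. Poly_Mapping.single w (Poly_Mapping.lookup x w)) * bc_const c
      = bc_const c * (\<Sum>w\<in>A. Poly_Mapping.single w (Poly_Mapping.lookup x w))" for A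
    by (simp add: sum_distrib_left sum_distrib_right bc_const_def mult_single mult.commute)
  then show ?thesis using poly_mapping_sum_singles[of x] by metis
qed

definition lin :: "(bc_word \<Rightarrow> 'r) \<Rightarrow> (bc_word \<Rightarrow>\<^sub>0 'r::comm_ring_1) \<Rightarrow> 'r" where
  "lin h x = (\<Sum>w\<in>Poly_Mapping.keys x. Poly_Mapping.lookup x w * h w)"

lemma lin_superset:
  assumes "finite A" "Poly_Mapping.keys x \<subseteq> A"
  shows "lin h x = (\<Sum>w\<in>A. Poly_Mapping.lookup x w * h w)"
  unfolding lin_def using assms
  by (intro sum.mono_neutral_left) (auto simp: not_in_keys_iff_lookup_eq_zero)

lemma lin_add: "lin h (x + y) = lin h x + lin h y"
proof -
  let ?A = "Poly_Mapping.keys x \<union> Poly_Mapping.keys y"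
  have "lin h (x + y) = (\<Sum>w\<in>?A. Poly_Mapping.lookup (x + y) w * h w)"
    using Poly_Mapping.keys_add[of x y] by (intro lin_superset) auto
  also have "\<dots> = (\<Sum>w\<in>?A. Poly_Mapping.lookup x w * h w) + (\<Sum>w\<in>?A. Poly_Mapping.lookup y w * h w)"
    by (simp add: lookup_add algebra_simps sum.distrib)
  also have "\<dots> = lin h x + lin h y"
    by (simp add: lin_superset[of ?A])
  finally show ?thesis .
qed

lemma lin_0 [simp]: "lin h 0 = 0"
  by (simp add: lin_def)

lemma lin_single [simp]: "lin h (Poly_Mapping.single w c) = c * h w"
  using lin_superset[of "{w}" "Poly_Mapping.single w c" h] by simp

lemma lin_1 [simp]: "lin h 1 = h 0"
  using lin_single[of h 0 1] by simp

lemma lin_uminus: "lin h (- x) = - lin h x"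
  using lin_add[of h x "- x"] by (simp add: eq_neg_iff_add_eq_0 add.commute)

lemma lin_diff: "lin h (x - y) = lin h x - lin h y"
  using lin_add[of h x "- y"] by (simp add: lin_uminus)

lemma lin_sum: "lin h (sum g A) = (\<Sum>i\<in>A. lin h (g i))"
  by (induction A rule: infinite_finite_induct) (auto simp: lin_add)

lemma lin_cong: "(\<And>w. w \<in> bc_words p \<Longrightarrow> h w = k w) \<Longrightarrow> x \<in> bc_elems p \<Longrightarrow> lin h x = lin k x"
  unfolding lin_def bc_elems_def by (intro sum.cong) auto

lemma lin_eq_0: "(\<And>w. w \<in> bc_words p \<Longrightarrow> h w = 0) \<Longrightarrow> x \<in> bc_elems p \<Longrightarrow> lin h x = 0"
  using lin_cong[of p h "\<lambda>_. 0" x] by (simp add: lin_def)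

lemma lin_mult: "lin h (x * y) = lin (\<lambda>u. lin (\<lambda>v. h (u + v)) y) x"
proof -
  let ?s = "\<lambda>x w. Poly_Mapping.single w (Poly_Mapping.lookup x w)"
  have "x * y = (\<Sum>u\<in>Poly_Mapping.keys x. ?s x u) * (\<Sum>v\<in>Poly_Mapping.keys y. ?s y v)"
    using poly_mapping_sum_singles[of x] poly_mapping_sum_singles[of y] by simp
  also have "\<dots> = (\<Sum>u\<in>Poly_Mapping.keys x. \<Sum>v\<in>Poly_Mapping.keys y.
      Poly_Mapping.single (u + v) (Poly_Mapping.lookup x u * Poly_Mapping.lookup y v))"
    by (simp add: sum_product mult_single)
  finally show ?thesis
    by (simp add: lin_sum lin_def[of _ x] lin_def[of _ y] sum_distrib_left mult.assoc)
qed

lemma lin_const_mult: "lin h (bc_const c * x) = c * lin h x"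
  by (simp add: lin_mult bc_const_def)

lemma lin_swap: "lin (\<lambda>u. lin (\<lambda>v. h u v) y) x = lin (\<lambda>v. lin (\<lambda>u. h u v) x) y"
  unfolding lin_def sum_distrib_left by (subst sum.swap) (simp add: mult_ac)

section \<open>The algebra as a quotient\<close>

lemma bc_free_ops [simp]:
  "x \<oplus>\<^bsub>bc_free p\<^esub> y = x + y" "x \<otimes>\<^bsub>bc_free p\<^esub> y = x * y"
  "\<zero>\<^bsub>bc_free p\<^esub> = 0" "\<one>\<^bsub>bc_free p\<^esub> = 1"
  by (simp_all add: bc_free_def)

lemma ring_bc_free: "ring (bc_free p :: (bc_word \<Rightarrow>\<^sub>0 'r::comm_ring_1) ring)"
proof (rule ringI)
  show "abelian_group (bc_free p :: (bc_word \<Rightarrow>\<^sub>0 'r) ring)"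
  proof (rule abelian_groupI)
    fix x assume "x \<in> carrier (bc_free p :: (bc_word \<Rightarrow>\<^sub>0 'r) ring)"
    then show "\<exists>y\<in>carrier (bc_free p). y \<oplus>\<^bsub>bc_free p\<^esub> x = \<zero>\<^bsub>bc_free p\<^esub>"
      by (intro bexI[of _ "- x"]) (auto simp: carrier_bc_free)
  qed (auto simp: carrier_bc_free add_ac)
  show "monoid (bc_free p :: (bc_word \<Rightarrow>\<^sub>0 'r) ring)"
    by (rule monoidI) (auto simp: carrier_bc_free mult.assoc)
qed (simp_all add: algebra_simps)

lemma bc_free_minus:
  assumes "x \<in> bc_elems p" "y \<in> bc_elems p"
  shows "x \<ominus>\<^bsub>bc_free p\<^esub> y = (x - y :: bc_word \<Rightarrow>\<^sub>0 'r::comm_ring_1)"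
proof -
  interpret ring "bc_free p :: (bc_word \<Rightarrow>\<^sub>0 'r) ring" by (rule ring_bc_free)
  have "- y \<oplus>\<^bsub>bc_free p\<^esub> y = \<zero>\<^bsub>bc_free p\<^esub>" by simp
  then have "\<ominus>\<^bsub>bc_free p\<^esub> y = - y"
    using assms by (intro minus_equality) (auto simp: carrier_bc_free)
  then show ?thesis by (simp add: a_minus_def)
qed

lemma bc_e_in: "\<gamma> \<in> QZp p \<Longrightarrow> bc_e \<gamma> \<in> bc_elems p"
  and bc_mu_in: "n \<in> Ip p \<Longrightarrow> bc_mu n \<in> bc_elems p"
  and bc_mustar_in: "n \<in> Ip p \<Longrightarrow> bc_mustar n \<in> bc_elems p"
  by (auto simp: bc_e_def bc_mu_def bc_mustar_def bc_words_def bc_gens_def intro!: bc_elems_single)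

lemmas bc_gen_in = bc_e_in bc_mu_in bc_mustar_in

lemma QZp_frac_add: "\<gamma> \<in> QZp p \<Longrightarrow> \<delta> \<in> QZp p \<Longrightarrow> frac (\<gamma> + \<delta>) \<in> QZp p"
proof -
  assume "\<gamma> \<in> QZp p" "\<delta> \<in> QZp p"
  then obtain a b c d where *: "b \<in> Ip p" "\<gamma> = of_int a / of_nat b" "d \<in> Ip p" "\<delta> = of_int c / of_nat d"
    by (auto simp: QZp_def)
  have "\<gamma> + \<delta> = of_int (a * int d + c * int b) / of_nat (b * d)"
    using * by (simp add: Ip_def field_simps)
  then show ?thesis by (rule QZp_frac) (intro Ip_mult *)
qed

lemma QZp_frac_mult: "\<gamma> \<in> QZp p \<Longrightarrow> frac (of_nat n * \<gamma>) \<in> QZp p"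
proof -
  assume "\<gamma> \<in> QZp p"
  then obtain a b where *: "b \<in> Ip p" "\<gamma> = of_int a / of_nat b" by (auto simp: QZp_def)
  have "of_nat n * \<gamma> = of_int (int n * a) / of_nat b" using * by simp
  then show ?thesis by (rule QZp_frac) (rule *)
qed

lemma bc_relators_in: "bc_relators p \<subseteq> bc_elems p"
  unfolding bc_relators_def
  by (auto intro!: bc_elems_diff bc_elems_mult bc_elems_sum bc_gen_in QZp_frac_add QZp_frac_mult
      QZp_0 Ip_mult)

lemma ideal_bc_ideal: "ideal (bc_ideal p) (bc_free p :: (bc_word \<Rightarrow>\<^sub>0 'r::comm_ring_1) ring)"
proof -
  interpret ring "bc_free p :: (bc_word \<Rightarrow>\<^sub>0 'r) ring" by (rule ring_bc_free)
  show ?thesis unfolding bc_ideal_def by (rule genideal_ideal) (simp add: carrier_bc_free bc_relators_in)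
qed

lemma bc_relators_ideal: "x \<in> bc_relators p \<Longrightarrow> (x :: bc_word \<Rightarrow>\<^sub>0 'r::comm_ring_1) \<in> bc_ideal p"
proof -
  interpret ring "bc_free p :: (bc_word \<Rightarrow>\<^sub>0 'r) ring" by (rule ring_bc_free)
  assume "x \<in> bc_relators p"
  then show ?thesis
    unfolding bc_ideal_def using genideal_self[of "bc_relators p"] bc_relators_in[of p]
    by (auto simp: carrier_bc_free)
qed

text \<open>The form in which generation by the relators is applied: to show that a condition stable under the
  ideal operations holds throughout the ideal.\<close>

lemma bc_ideal_minimal:
  fixes J :: "(bc_word \<Rightarrow>\<^sub>0 'r::comm_ring_1) set"
  assumes J: "J \<subseteq> bc_elems p" "0 \<in> J" "\<And>x y. x \<in> J \<Longrightarrow> y \<in> J \<Longrightarrow> x - y \<in> J"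
    and l: "\<And>x a. x \<in> J \<Longrightarrow> a \<in> bc_elems p \<Longrightarrow> a * x \<in> J"
    and r: "\<And>x a. x \<in> J \<Longrightarrow> a \<in> bc_elems p \<Longrightarrow> x * a \<in> J"
    and rel: "bc_relators p \<subseteq> J"
  shows "bc_ideal p \<subseteq> J"
proof -
  interpret ring "bc_free p :: (bc_word \<Rightarrow>\<^sub>0 'r) ring" by (rule ring_bc_free)
  have minus: "- x \<in> J" if "x \<in> J" for x using J(3)[OF J(2) that] by simp
  have plus: "x + y \<in> J" if "x \<in> J" "y \<in> J" for x y using J(3)[OF that(1) minus[OF that(2)]] by simp
  have "ideal J (bc_free p)"
  proof (rule idealI[OF ring_bc_free])
    show "subgroup J (add_monoid (bc_free p))"
    proof (rule add.subgroupI)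
      show "\<ominus>\<^bsub>bc_free p\<^esub> x \<in> J" if "x \<in> J" for x
      proof -
        have "x \<in> bc_elems p" using that J(1) by blast
        then have "\<ominus>\<^bsub>bc_free p\<^esub> x = - x" by (intro minus_equality) (auto simp: carrier_bc_free)
        then show ?thesis using minus[OF that] by simp
      qed
    qed (use J plus in \<open>auto simp: carrier_bc_free\<close>)
  qed (use l r in \<open>auto simp: carrier_bc_free\<close>)
  then show ?thesis unfolding bc_ideal_def by (rule genideal_minimal[OF _ rel])
qed

lemma bc_ideal_0: "0 \<in> bc_ideal p"
  using additive_subgroup.zero_closed[OF ideal.axioms(1)[OF ideal_bc_ideal]] by simp

lemma bc_ideal_add: "x \<in> bc_ideal p \<Longrightarrow> y \<in> bc_ideal p \<Longrightarrow>
    x + (y :: bc_word \<Rightarrow>\<^sub>0 'r::comm_ring_1) \<in> bc_ideal p"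
  using additive_subgroup.a_closed[OF ideal.axioms(1)[OF ideal_bc_ideal]] by fastforce

lemma bc_ideal_l: "x \<in> bc_ideal p \<Longrightarrow> a \<in> bc_elems p \<Longrightarrow>
    a * (x :: bc_word \<Rightarrow>\<^sub>0 'r::comm_ring_1) \<in> bc_ideal p"
  using ideal.I_l_closed[OF ideal_bc_ideal] by (fastforce simp: carrier_bc_free)

lemma bc_ideal_r: "x \<in> bc_ideal p \<Longrightarrow> a \<in> bc_elems p \<Longrightarrow>
    (x :: bc_word \<Rightarrow>\<^sub>0 'r::comm_ring_1) * a \<in> bc_ideal p"
  using ideal.I_r_closed[OF ideal_bc_ideal] by (fastforce simp: carrier_bc_free)

text \<open>Equality in the algebra, as a congruence on representatives; calculations with it use the type class
  operations.\<close>

definition bc_eqv :: "nat \<Rightarrow> (bc_word \<Rightarrow>\<^sub>0 'r::comm_ring_1) \<Rightarrow> (bc_word \<Rightarrow>\<^sub>0 'r) \<Rightarrow> bool" where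
  "bc_eqv p x y \<longleftrightarrow> x \<in> bc_elems p \<and> y \<in> bc_elems p \<and> x - y \<in> bc_ideal p"

lemma bc_eqvD: "bc_eqv p x y \<Longrightarrow> x \<in> bc_elems p" "bc_eqv p x y \<Longrightarrow> y \<in> bc_elems p"
  by (auto simp: bc_eqv_def)

lemma bc_eqv_refl: "x \<in> bc_elems p \<Longrightarrow> bc_eqv p x x"
  by (simp add: bc_eqv_def bc_ideal_0)

lemma bc_eqv_sym: "bc_eqv p x y \<Longrightarrow> bc_eqv p y x"
  using bc_ideal_l[of "x - y" p "- 1"] by (simp add: bc_eqv_def)

lemma bc_eqv_trans [trans]: "bc_eqv p x y \<Longrightarrow> bc_eqv p y z \<Longrightarrow> bc_eqv p x z"
  using bc_ideal_add[of "x - y" p "y - z"] by (auto simp: bc_eqv_def)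

lemma bc_eqv_add: "bc_eqv p x x' \<Longrightarrow> bc_eqv p y y' \<Longrightarrow> bc_eqv p (x + y) (x' + y')"
  using bc_ideal_add[of "x - x'" p "y - y'"] by (simp add: bc_eqv_def algebra_simps)

lemma bc_eqv_mult: 
  assumes "bc_eqv p x x'" "bc_eqv p y y'"
  shows "bc_eqv p (x * y) (x' * y')"
proof -
  have "(x - x') * y + x' * (y - y') \<in> bc_ideal p"
    using assms by (intro bc_ideal_add bc_ideal_r bc_ideal_l) (auto simp: bc_eqv_def)
  then show ?thesis using assms by (simp add: bc_eqv_def algebra_simps)
qed

lemma bc_eqv_relator: "x - y \<in> bc_relators p \<Longrightarrow> x \<in> bc_elems p \<Longrightarrow> y \<in> bc_elems p \<Longrightarrow> bc_eqv p x y"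
  by (simp add: bc_eqv_def bc_relators_ideal)

lemma carrier_bc_algebra: "carrier (bc_algebra p) = bc_cls p ` (bc_elems p :: (bc_word \<Rightarrow>\<^sub>0 'r::comm_ring_1) set)"
  by (auto simp: bc_algebra_def FactRing_def A_RCOSETS_def RCOSETS_def bc_cls_def a_r_coset_def
      carrier_bc_free[symmetric])

lemma bc_cls_hom: "bc_cls p \<in> ring_hom (bc_free p) (bc_algebra p :: (bc_word \<Rightarrow>\<^sub>0 'r::comm_ring_1) set ring)"
proof -
  have "bc_cls p = a_r_coset (bc_free p) (bc_ideal p :: (bc_word \<Rightarrow>\<^sub>0 'r) set)"
    by (simp add: fun_eq_iff bc_cls_def)
  then show ?thesis
    using ideal.rcos_ring_hom[OF ideal_bc_ideal, of p] by (simp add: bc_algebra_def)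
qed

lemma bc_cls_mult:
  "x \<in> bc_elems p \<Longrightarrow> y \<in> bc_elems p \<Longrightarrow> bc_cls p x \<otimes>\<^bsub>bc_algebra p\<^esub> bc_cls p y = bc_cls p (x * y)"
  using ring_hom_mult[OF bc_cls_hom, of x p y] by (simp add: carrier_bc_free)

lemma bc_cls_add:
  "x \<in> bc_elems p \<Longrightarrow> y \<in> bc_elems p \<Longrightarrow> bc_cls p x \<oplus>\<^bsub>bc_algebra p\<^esub> bc_cls p y = bc_cls p (x + y)"
  using ring_hom_add[OF bc_cls_hom, of x p y] by (simp add: carrier_bc_free)

lemma bc_cls_1: "\<one>\<^bsub>bc_algebra p\<^esub> = bc_cls p 1"
  by (rule ring_hom_one[OF bc_cls_hom, unfolded bc_free_ops, symmetric])

lemma bc_cls_eq_iff: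
  assumes "x \<in> bc_elems p" "y \<in> bc_elems p"
  shows "bc_cls p x = bc_cls p (y :: bc_word \<Rightarrow>\<^sub>0 'r::comm_ring_1) \<longleftrightarrow> bc_eqv p x y"
  using ring.quotient_eq_iff_same_a_r_cos[OF ring_bc_free ideal_bc_ideal, of x p y] assms
  by (simp add: carrier_bc_free bc_cls_def bc_eqv_def bc_free_minus)

lemma bc_scale_cls: "x \<in> bc_elems p \<Longrightarrow> bc_scale p c (bc_cls p x) = bc_cls p (bc_const c * x)"
  by (simp add: bc_scale_def bc_cls_mult)

section \<open>Relations and the spanning monomials\<close>

lemma QZp_fibre_in: "\<gamma> \<in> QZp_fibre p n \<delta> \<Longrightarrow> \<gamma> \<in> QZp p"
  by (simp add: QZp_fibre_def)

context
  fixes p :: nat and ty :: "'r::comm_ring_1 itself"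
begin

abbreviation eqv :: "(bc_word \<Rightarrow>\<^sub>0 'r) \<Rightarrow> (bc_word \<Rightarrow>\<^sub>0 'r) \<Rightarrow> bool" (infix "\<doteq>" 50) where
  "x \<doteq> y \<equiv> bc_eqv p x y"

lemma rel_e_0: "bc_e 0 \<doteq> 1"
  by (rule bc_eqv_relator[OF _ bc_e_in[OF QZp_0] bc_elems_1]) (unfold bc_relators_def, blast)

lemma rel_e_mult:
  assumes "\<gamma> \<in> QZp p" "\<delta> \<in> QZp p"
  shows "bc_e \<gamma> * bc_e \<delta> \<doteq> bc_e (frac (\<gamma> + \<delta>))"
proof (rule bc_eqv_relator)
  show "bc_e \<gamma> * bc_e \<delta> - bc_e (frac (\<gamma> + \<delta>)) \<in> bc_relators p"
    unfolding bc_relators_def using assms by blast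
qed (intro bc_e_in bc_elems_mult QZp_frac_add assms)+

lemma rel_mu_mult:
  assumes "n \<in> Ip p" "m \<in> Ip p"
  shows "bc_mu (n * m) \<doteq> bc_mu n * bc_mu m"
proof (rule bc_eqv_relator)
  show "bc_mu (n * m) - bc_mu n * bc_mu m \<in> bc_relators p"
    unfolding bc_relators_def using assms by blast
qed (intro bc_mu_in bc_elems_mult Ip_mult assms)+

lemma rel_mustar_mult:
  assumes "n \<in> Ip p" "m \<in> Ip p"
  shows "bc_mustar (n * m) \<doteq> bc_mustar n * bc_mustar m"
proof (rule bc_eqv_relator)
  show "bc_mustar (n * m) - bc_mustar n * bc_mustar m \<in> bc_relators p"
    unfolding bc_relators_def using assms by blast
qed (intro bc_mustar_in bc_elems_mult Ip_mult assms)+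

lemma rel_mustar_mu:
  assumes "n \<in> Ip p"
  shows "bc_mustar n * bc_mu n \<doteq> of_nat n"
proof (rule bc_eqv_relator)
  show "bc_mustar n * bc_mu n - of_nat n \<in> bc_relators p"
    unfolding bc_relators_def using assms by blast
qed (intro bc_mu_in bc_mustar_in bc_elems_mult bc_elems_of_nat assms)+

lemma rel_mu_mustar:
  assumes "n \<in> Ip p" "m \<in> Ip p" "coprime n m"
  shows "bc_mu n * bc_mustar m \<doteq> bc_mustar m * bc_mu n"
proof (rule bc_eqv_relator)
  show "bc_mu n * bc_mustar m - bc_mustar m * bc_mu n \<in> bc_relators p"
    unfolding bc_relators_def using assms by blast
qed (intro bc_mu_in bc_mustar_in bc_elems_mult assms)+

lemma rel_mu_e_mustar:
  assumes "n \<in> Ip p" "\<gamma> \<in> QZp p"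
  shows "bc_mu n * bc_e \<gamma> * bc_mustar n \<doteq> (\<Sum>\<delta>\<in>QZp_fibre p n \<gamma>. bc_e \<delta>)"
proof (rule bc_eqv_relator)
  show "bc_mu n * bc_e \<gamma> * bc_mustar n - (\<Sum>\<delta>\<in>QZp_fibre p n \<gamma>. bc_e \<delta>) \<in> bc_relators p"
    unfolding bc_relators_def QZp_fibre_def using assms by blast
qed (intro bc_gen_in bc_elems_mult bc_elems_sum assms | erule QZp_fibre_in)+

lemma rel_mustar_e:
  assumes "n \<in> Ip p" "\<gamma> \<in> QZp p"
  shows "bc_mustar n * bc_e \<gamma> \<doteq> bc_e (frac (of_nat n * \<gamma>)) * bc_mustar n"
proof (rule bc_eqv_relator)
  show "bc_mustar n * bc_e \<gamma> - bc_e (frac (of_nat n * \<gamma>)) * bc_mustar n \<in> bc_relators p"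
    unfolding bc_relators_def using assms by blast
qed (intro bc_gen_in bc_elems_mult QZp_frac_mult assms)+

lemma rel_e_mu:
  assumes "n \<in> Ip p" "\<gamma> \<in> QZp p"
  shows "bc_e \<gamma> * bc_mu n \<doteq> bc_mu n * bc_e (frac (of_nat n * \<gamma>))"
proof (rule bc_eqv_relator)
  show "bc_e \<gamma> * bc_mu n - bc_mu n * bc_e (frac (of_nat n * \<gamma>)) \<in> bc_relators p"
    unfolding bc_relators_def using assms by blast
qed (intro bc_gen_in bc_elems_mult QZp_frac_mult assms)+

lemma eqv_mult_left: "y \<doteq> y' \<Longrightarrow> x \<in> bc_elems p \<Longrightarrow> x * y \<doteq> x * y'"
  by (intro bc_eqv_mult bc_eqv_refl)

lemma eqv_mult_right: "x \<doteq> x' \<Longrightarrow> y \<in> bc_elems p \<Longrightarrow> x * y \<doteq> x' * y"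
  by (intro bc_eqv_mult bc_eqv_refl)

lemma rel_mu_1: "bc_mu 1 \<doteq> 1"
proof -
  note 1 = Ip_1[of p]
  note in' = bc_mu_in[OF 1] bc_mustar_in[OF 1]
  have inv: "bc_mustar 1 * bc_mu 1 \<doteq> 1" using rel_mustar_mu[OF 1] by simp
  have "bc_mu 1 \<doteq> 1 * bc_mu 1" using bc_eqv_refl[OF in'(1)] by simp
  also have "1 * bc_mu 1 \<doteq> (bc_mustar 1 * bc_mu 1) * bc_mu 1"
    by (intro eqv_mult_right bc_eqv_sym[OF inv] in')
  also have "(bc_mustar 1 * bc_mu 1) * bc_mu 1 = bc_mustar 1 * (bc_mu 1 * bc_mu 1)"
    by (simp add: mult.assoc)
  also have "bc_mustar 1 * (bc_mu 1 * bc_mu 1) \<doteq> bc_mustar 1 * bc_mu 1"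
    using bc_eqv_sym[OF rel_mu_mult[OF 1 1]] by (intro eqv_mult_left in') simp
  also note inv
  finally show ?thesis .
qed

lemma rel_mustar_1: "bc_mustar 1 \<doteq> 1"
proof -
  note 1 = Ip_1[of p]
  note in' = bc_mu_in[OF 1] bc_mustar_in[OF 1]
  have "bc_mustar 1 \<doteq> bc_mustar 1 * 1" using bc_eqv_refl[OF in'(2)] by simp
  also have "bc_mustar 1 * 1 \<doteq> bc_mustar 1 * bc_mu 1"
    by (intro eqv_mult_left bc_eqv_sym[OF rel_mu_1] in')
  also have "bc_mustar 1 * bc_mu 1 \<doteq> 1" using rel_mustar_mu[OF 1] by simp
  finally show ?thesis .
qed

definition bc_mono :: "nat \<Rightarrow> rat \<Rightarrow> nat \<Rightarrow> bc_word \<Rightarrow>\<^sub>0 'r" where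
  "bc_mono a \<gamma> b = bc_mu a * bc_e \<gamma> * bc_mustar b"

lemma mono_in: "a \<in> Ip p \<Longrightarrow> \<gamma> \<in> QZp p \<Longrightarrow> b \<in> Ip p \<Longrightarrow> bc_mono a \<gamma> b \<in> bc_elems p"
  unfolding bc_mono_def by (intro bc_elems_mult bc_gen_in)

text \<open>The module generated by the monomials with coprime indices; it is shown to be everything, which
  makes its induction rule a normal form principle for the algebra.\<close>

inductive_set bc_span :: "(bc_word \<Rightarrow>\<^sub>0 'r) set" where
  mono: "a \<in> Ip p \<Longrightarrow> b \<in> Ip p \<Longrightarrow> \<gamma> \<in> QZp p \<Longrightarrow> coprime a b \<Longrightarrow> bc_mono a \<gamma> b \<in> bc_span"
| add: "x \<in> bc_span \<Longrightarrow> y \<in> bc_span \<Longrightarrow> x + y \<in> bc_span"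
| scale: "x \<in> bc_span \<Longrightarrow> bc_const c * x \<in> bc_span"
| eqv: "x \<in> bc_span \<Longrightarrow> x \<doteq> y \<Longrightarrow> y \<in> bc_span"

lemma bc_span_in: "x \<in> bc_span \<Longrightarrow> x \<in> bc_elems p"
  by (induction rule: bc_span.induct) (auto intro: mono_in dest: bc_eqvD)

lemma mono_1_eqv: "bc_mono 1 0 1 \<doteq> 1"
proof -
  note 1 = Ip_1[of p]
  have "bc_mono 1 0 1 \<doteq> 1 * 1 * 1"
    unfolding bc_mono_def by (intro bc_eqv_mult rel_mu_1 rel_mustar_1 rel_e_0)
  then show ?thesis by simp
qed

lemma bc_span_1: "1 \<in> bc_span"
  using bc_span.mono[of 1 1 0] mono_1_eqv by (auto intro: bc_span.eqv simp: Ip_def QZp_0)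

lemma bc_span_0: "0 \<in> bc_span"
  using bc_span.scale[OF bc_span_1, of 0] by simp

lemma bc_span_sum: "(\<And>i. i \<in> A \<Longrightarrow> g i \<in> bc_span) \<Longrightarrow> sum g A \<in> bc_span"
  by (induction A rule: infinite_finite_induct) (auto intro: bc_span_0 bc_span.add)

lemma Ip_div:
  assumes "a \<in> Ip p" "a = d * a'"
  shows "d \<in> Ip p" "a' \<in> Ip p"
  using assms by (auto simp: Ip_def)

text \<open>A common factor d of the indices is absorbed by the relation for \<open>\<mu>\<^sub>d e(\<gamma>) \<mu>*\<^sub>d\<close>.\<close>

lemma bc_span_mono:
  assumes "a \<in> Ip p" "\<gamma> \<in> QZp p" "b \<in> Ip p"
  shows "bc_mono a \<gamma> b \<in> bc_span"
proof -
  have ab0: "a > 0" "b > 0" using assms by (auto simp: Ip_def)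
  define d where "d = gcd a b"
  have "gcd a b \<noteq> 0" using ab0 by simp
  then obtain a' b' where ab: "a = a' * d" "b = b' * d" "coprime a' b'"
    unfolding d_def by (rule gcd_coprime_exists[THEN exE]) blast
  have in': "a' \<in> Ip p" "b' \<in> Ip p" "d \<in> Ip p"
    using Ip_div[of a d a'] Ip_div[of b d b'] ab assms by (auto simp: mult.commute)
  note gens = bc_mu_in[OF in'(1)] bc_mu_in[OF in'(3)] bc_mustar_in[OF in'(2)] bc_mustar_in[OF in'(3)]
    bc_e_in[OF assms(2)]
  have "bc_mono a \<gamma> b \<doteq> (bc_mu a' * bc_mu d) * bc_e \<gamma> * (bc_mustar d * bc_mustar b')"
    unfolding bc_mono_def ab(1,2) mult.commute[of b']
    by (intro bc_eqv_mult rel_mu_mult rel_mustar_mult bc_eqv_refl in' gens)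
  also have "\<dots> = bc_mu a' * (bc_mu d * bc_e \<gamma> * bc_mustar d) * bc_mustar b'"
    by (simp add: mult.assoc)
  also have "\<dots> \<doteq> bc_mu a' * (\<Sum>\<delta>\<in>QZp_fibre p d \<gamma>. bc_e \<delta>) * bc_mustar b'"
    by (intro eqv_mult_right eqv_mult_left rel_mu_e_mustar in' assms gens)
  also have "\<dots> = (\<Sum>\<delta>\<in>QZp_fibre p d \<gamma>. bc_mono a' \<delta> b')"
    by (simp add: bc_mono_def sum_distrib_left sum_distrib_right)
  finally have "bc_mono a \<gamma> b \<doteq> (\<Sum>\<delta>\<in>QZp_fibre p d \<gamma>. bc_mono a' \<delta> b')" .
  moreover have "(\<Sum>\<delta>\<in>QZp_fibre p d \<gamma>. bc_mono a' \<delta> b') \<in> bc_span"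
    by (intro bc_span_sum bc_span.mono in' ab QZp_fibre_in)
  ultimately show ?thesis by (blast intro: bc_span.eqv bc_eqv_sym)
qed

lemma e_mult_mono:
  assumes "a \<in> Ip p" "\<gamma> \<in> QZp p" "b \<in> Ip p" "\<delta> \<in> QZp p"
  shows "bc_e \<delta> * bc_mono a \<gamma> b \<doteq> bc_mono a (frac (frac (of_nat a * \<delta>) + \<gamma>)) b"
proof -
  note gens = bc_mu_in[OF assms(1)] bc_mustar_in[OF assms(3)] bc_e_in[OF assms(2)] bc_e_in[OF assms(4)]
    bc_e_in[OF QZp_frac_mult[OF assms(4), of a]]
  have "bc_e \<delta> * bc_mono a \<gamma> b = (bc_e \<delta> * bc_mu a) * (bc_e \<gamma> * bc_mustar b)"
    by (simp add: bc_mono_def mult.assoc)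
  also have "\<dots> \<doteq> (bc_mu a * bc_e (frac (of_nat a * \<delta>))) * (bc_e \<gamma> * bc_mustar b)"
    by (intro eqv_mult_right rel_e_mu bc_elems_mult gens assms)
  also have "\<dots> = bc_mu a * (bc_e (frac (of_nat a * \<delta>)) * bc_e \<gamma>) * bc_mustar b"
    by (simp add: mult.assoc)
  also have "\<dots> \<doteq> bc_mono a (frac (frac (of_nat a * \<delta>) + \<gamma>)) b"
    unfolding bc_mono_def
    by (intro eqv_mult_right eqv_mult_left rel_e_mult QZp_frac_mult gens assms)
  finally show ?thesis .
qed

lemma mu_mult_mono:
  assumes "a \<in> Ip p" "\<gamma> \<in> QZp p" "b \<in> Ip p" "n \<in> Ip p"
  shows "bc_mu n * bc_mono a \<gamma> b \<doteq> bc_mono (n * a) \<gamma> b"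
proof -
  note gens = bc_mu_in[OF assms(1)] bc_mustar_in[OF assms(3)] bc_e_in[OF assms(2)] bc_mu_in[OF assms(4)]
  have "bc_mu n * bc_mono a \<gamma> b = (bc_mu n * bc_mu a) * (bc_e \<gamma> * bc_mustar b)"
    by (simp add: bc_mono_def mult.assoc)
  also have "\<dots> \<doteq> bc_mu (n * a) * (bc_e \<gamma> * bc_mustar b)"
    by (intro eqv_mult_right bc_eqv_sym[OF rel_mu_mult] bc_elems_mult gens assms)
  also have "\<dots> = bc_mono (n * a) \<gamma> b" by (simp add: bc_mono_def mult.assoc)
  finally show ?thesis .
qed

text \<open>With \<open>d = gcd n a\<close> the adjacent factors \<open>\<mu>*\<^sub>d \<mu>\<^sub>d\<close> become the number d, and the remaining \<open>\<mu>*\<close>, of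
  index prime to that of the remaining \<open>\<mu>\<close>, moves to the right.\<close>

lemma mustar_mult_mono:
  assumes a: "a \<in> Ip p" and \<gamma>: "\<gamma> \<in> QZp p" and b: "b \<in> Ip p" and n: "n \<in> Ip p"
  shows "bc_mustar n * bc_mono a \<gamma> b \<in> bc_span"
proof -
  define d where "d = gcd n a"
  have "gcd n a \<noteq> 0" using a by (simp add: Ip_def)
  then obtain n' a' where na: "n = n' * d" "a = a' * d" "coprime n' a'"
    unfolding d_def by (rule gcd_coprime_exists[THEN exE]) blast
  have in': "a' \<in> Ip p" "n' \<in> Ip p" "d \<in> Ip p"
    using Ip_div[of a d a'] Ip_div[of n d n'] na a n by (auto simp: mult.commute)
  define \<gamma>' where "\<gamma>' = frac (of_nat n' * \<gamma>)"
  have \<gamma>': "\<gamma>' \<in> QZp p" unfolding \<gamma>'_def by (rule QZp_frac_mult[OF \<gamma>])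
  note gens = bc_mu_in[OF in'(1)] bc_mu_in[OF in'(3)] bc_mustar_in[OF in'(2)] bc_mustar_in[OF in'(3)]
    bc_mustar_in[OF b] bc_e_in[OF \<gamma>] bc_e_in[OF \<gamma>'] bc_elems_of_nat
  have "bc_mustar n * bc_mono a \<gamma> b
      \<doteq> (bc_mustar n' * bc_mustar d) * ((bc_mu d * bc_mu a') * bc_e \<gamma> * bc_mustar b)"
    unfolding bc_mono_def na(1,2) mult.commute[of a']
    by (intro bc_eqv_mult rel_mu_mult rel_mustar_mult bc_eqv_refl in' gens)
  also have "\<dots> = bc_mustar n' * (bc_mustar d * bc_mu d) * (bc_mu a' * (bc_e \<gamma> * bc_mustar b))"
    by (simp add: mult.assoc)
  also have "\<dots> \<doteq> bc_mustar n' * of_nat d * (bc_mu a' * (bc_e \<gamma> * bc_mustar b))"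
    by (intro eqv_mult_right eqv_mult_left rel_mustar_mu in' gens bc_elems_mult)
  also have "\<dots> = of_nat d * ((bc_mustar n' * bc_mu a') * (bc_e \<gamma> * bc_mustar b))"
    by (simp add: mult.assoc bc_const_of_nat[symmetric] bc_const_central)
  also have "\<dots> \<doteq> of_nat d * ((bc_mu a' * bc_mustar n') * (bc_e \<gamma> * bc_mustar b))"
    using na(3) by (intro eqv_mult_right eqv_mult_left bc_eqv_sym[OF rel_mu_mustar] in' gens bc_elems_mult)
      (simp add: coprime_commute)
  also have "\<dots> = of_nat d * (bc_mu a' * (bc_mustar n' * bc_e \<gamma>) * bc_mustar b)"
    by (simp add: mult.assoc)
  also have "\<dots> \<doteq> of_nat d * (bc_mu a' * (bc_e \<gamma>' * bc_mustar n') * bc_mustar b)"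
    unfolding \<gamma>'_def
    by (intro eqv_mult_right eqv_mult_left rel_mustar_e in' gens bc_elems_mult \<gamma>)
  also have "\<dots> = of_nat d * (bc_mu a' * bc_e \<gamma>' * (bc_mustar n' * bc_mustar b))"
    by (simp add: mult.assoc)
  also have "\<dots> \<doteq> of_nat d * bc_mono a' \<gamma>' (n' * b)"
    unfolding bc_mono_def
    by (intro eqv_mult_left bc_eqv_sym[OF rel_mustar_mult] in' gens bc_elems_mult b)
  finally have "bc_mustar n * bc_mono a \<gamma> b \<doteq> bc_const (of_nat d) * bc_mono a' \<gamma>' (n' * b)"
    by (simp only: bc_const_of_nat)
  moreover have "bc_const (of_nat d) * bc_mono a' \<gamma>' (n' * b) \<in> bc_span"
    by (intro bc_span.scale bc_span_mono in' \<gamma>' Ip_mult b)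
  ultimately show ?thesis by (blast intro: bc_span.eqv bc_eqv_sym)
qed

lemma gen_mult_bc_span:
  assumes "x \<in> bc_span" "g \<in> bc_gens p"
  shows "Poly_Mapping.single (Word [g]) 1 * x \<in> bc_span"
  using assms(1)
proof (induction rule: bc_span.induct)
  case (mono a b \<gamma>)
  from assms(2) show ?case unfolding bc_gens_def
  proof (elim UnE imageE)
    fix \<delta> assume g: "g = Gen_e \<delta>" and \<delta>: "\<delta> \<in> QZp p"
    have "bc_e \<delta> * bc_mono a \<gamma> b \<in> bc_span"
      by (rule bc_span.eqv[OF _ bc_eqv_sym[OF e_mult_mono[OF mono(1,3,2) \<delta>]]])
        (intro bc_span_mono mono QZp_frac_add QZp_frac_mult \<delta>)
    then show ?thesis by (simp add: g bc_e_def)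
  next
    fix n assume g: "g = Gen_mu n" and n: "n \<in> Ip p"
    have "bc_mu n * bc_mono a \<gamma> b \<in> bc_span"
      by (rule bc_span.eqv[OF _ bc_eqv_sym[OF mu_mult_mono[OF mono(1,3,2) n]]])
        (intro bc_span_mono mono Ip_mult n)
    then show ?thesis by (simp add: g bc_mu_def)
  next
    fix n assume "g = Gen_mustar n" "n \<in> Ip p"
    then show ?thesis using mustar_mult_mono[OF mono(1,3,2), of n] by (simp add: bc_mustar_def)
  qed
next
  case (add x y)
  then show ?case by (simp add: distrib_left bc_span.add)
next
  case (scale x c)
  have "Poly_Mapping.single (Word [g]) 1 * (bc_const c * x)
      = bc_const c * (Poly_Mapping.single (Word [g]) 1 * x)"
    by (simp add: mult.assoc[symmetric] bc_const_central)
  then show ?case using scale by (simp add: bc_span.scale)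
next
  case (eqv x y)
  have "Poly_Mapping.single (Word [g]) 1 \<in> (bc_elems p :: (bc_word \<Rightarrow>\<^sub>0 'r) set)"
    using assms(2) by (intro bc_elems_single) (simp add: bc_words_def)
  then show ?case using eqv by (blast intro: bc_span.eqv eqv_mult_left)
qed

lemma bc_span_word: "w \<in> bc_words p \<Longrightarrow> Poly_Mapping.single w 1 \<in> bc_span"
proof (induction "letters w" arbitrary: w)
  case Nil
  then have "w = 0" by (cases w) (simp add: zero_bc_word_def)
  then show ?case using bc_span_1 by simp
next
  case (Cons g gs)
  have w: "w = Word [g] + Word gs" using Cons(2) by (cases w) (simp add: plus_bc_word_def)
  have "Poly_Mapping.single (Word gs) 1 \<in> bc_span"
    using Cons(1)[of "Word gs"] Cons(3) w by (simp add: bc_words_def)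
  then have "Poly_Mapping.single (Word [g]) 1 * Poly_Mapping.single (Word gs) 1 \<in> bc_span"
    using Cons(3) w by (intro gen_mult_bc_span) (simp_all add: bc_words_def)
  then show ?case by (simp add: w mult_single)
qed

lemma bc_span_all: "x \<in> bc_elems p \<Longrightarrow> x \<in> bc_span"
proof (induction rule: bc_elems_induct)
  case (single w c)
  then show ?case
    using bc_span.scale[OF bc_span_word, of w c] by (simp add: bc_const_mult_single)
qed (rule bc_span.add)

end

lemma bc_normal_form_induct [consumes 1, case_names mono add scale eqv]:
  fixes x :: "bc_word \<Rightarrow>\<^sub>0 'r::comm_ring_1"
  assumes "x \<in> bc_elems p"
    and "\<And>a b \<gamma>. a \<in> Ip p \<Longrightarrow> b \<in> Ip p \<Longrightarrow> \<gamma> \<in> QZp p \<Longrightarrow> coprime a b \<Longrightarrow> P (bc_mono a \<gamma> b)"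
    and "\<And>x y. x \<in> bc_elems p \<Longrightarrow> P x \<Longrightarrow> y \<in> bc_elems p \<Longrightarrow> P y \<Longrightarrow> P (x + y)"
    and "\<And>x c. x \<in> bc_elems p \<Longrightarrow> P x \<Longrightarrow> P (bc_const c * x)"
    and "\<And>x y. P x \<Longrightarrow> bc_eqv p x y \<Longrightarrow> P y"
  shows "P x"
  using bc_span_all[OF assms(1)]
  by (induction rule: bc_span.induct) (use assms bc_span_in in blast)+

section \<open>A representation and the linear forms\<close>

text \<open>The representation behind the linear form.  On the group ring of the fractions, \<open>e(\<gamma>)\<close> acts by
  multiplication, \<open>\<mu>*\<^sub>n\<close> by \<open>\<sigma>\<^sub>n\<close> and \<open>\<mu>\<^sub>n\<close> by \<open>\<rho>\<^sub>n\<close>, the latter two also shifting a degree r by a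
  factor n.  What is defined here is the transposed action on functions h of a fraction and a
  degree; it avoids a second type of formal sums, and the letters of a word act from left to
  right.\<close>

primrec gen_act :: "nat \<Rightarrow> bc_gen \<Rightarrow> (rat \<Rightarrow> rat \<Rightarrow> 'r::comm_ring_1) \<Rightarrow> rat \<Rightarrow> rat \<Rightarrow> 'r" where
  "gen_act p (Gen_e \<gamma>) h = (\<lambda>\<delta> r. h (frac (\<gamma> + \<delta>)) r)"
| "gen_act p (Gen_mu n) h = (\<lambda>\<delta> r. \<Sum>\<delta>'\<in>QZp_fibre p n \<delta>. h \<delta>' (r * of_nat n))"
| "gen_act p (Gen_mustar n) h = (\<lambda>\<delta> r. h (frac (of_nat n * \<delta>)) (r / of_nat n))"

definition word_act :: "nat \<Rightarrow> bc_word \<Rightarrow> (rat \<Rightarrow> rat \<Rightarrow> 'r::comm_ring_1) \<Rightarrow> rat \<Rightarrow> rat \<Rightarrow> 'r" where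
  "word_act p w h = fold (gen_act p) (letters w) h"

lemma word_act_0 [simp]: "word_act p 0 h = h"
  by (simp add: word_act_def)

lemma word_act_plus: "word_act p (u + v) h = word_act p v (word_act p u h)"
  by (simp add: word_act_def)

lemma word_act_Word:
  "word_act p (Word []) h = h"
  "word_act p (Word (g # gs)) h = word_act p (Word gs) (gen_act p g h)"
  by (simp_all add: word_act_def)

lemma gen_act_sum:
  "gen_act p g (\<lambda>\<delta> r. \<Sum>i\<in>A. c i * k i \<delta> r) = (\<lambda>\<delta> r. \<Sum>i\<in>A. c i * gen_act p g (k i) \<delta> r)"
proof (cases g)
  case (Gen_mu n)
  then show ?thesis by (simp add: fun_eq_iff sum_distrib_left) (auto intro!: sum.swap)
qed simp_all

lemma word_act_sum:
  "word_act p w (\<lambda>\<delta> r. \<Sum>i\<in>A. c i * k i \<delta> r) = (\<lambda>\<delta> r. \<Sum>i\<in>A. c i * word_act p w (k i) \<delta> r)"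
proof -
  have "fold (gen_act p) gs (\<lambda>\<delta> r. \<Sum>i\<in>A. c i * k i \<delta> r)
      = (\<lambda>\<delta> r. \<Sum>i\<in>A. c i * fold (gen_act p) gs (k i) \<delta> r)" for gs
    by (induction gs arbitrary: k) (simp_all add: gen_act_sum)
  then show ?thesis by (simp add: word_act_def)
qed

text \<open>Only values at fractions in [0,1) with denominator prime to p are meaningful: the relations hold
  for these, and the action never leads from them to other arguments.\<close>

lemma gen_act_eq_0:
  assumes "\<And>\<delta> r. \<delta> \<in> QZp p \<Longrightarrow> h \<delta> r = 0" "g \<in> bc_gens p" "\<delta> \<in> QZp p"
  shows "gen_act p g h \<delta> r = 0"
proof (cases g)
  case (Gen_e \<gamma>)
  then have "\<gamma> \<in> QZp p" using assms(2) by (auto simp: bc_gens_def)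
  then show ?thesis using Gen_e assms by (simp add: QZp_frac_add)
next
  case (Gen_mu n)
  then show ?thesis using assms QZp_fibre_in by (auto intro!: sum.neutral)
next
  case (Gen_mustar n)
  then show ?thesis using assms QZp_frac_mult by simp
qed

lemma word_act_eq_0:
  fixes h :: "rat \<Rightarrow> rat \<Rightarrow> 'r::comm_ring_1"
  assumes "\<And>\<delta> r. \<delta> \<in> QZp p \<Longrightarrow> h \<delta> r = 0" "w \<in> bc_words p" "\<delta> \<in> QZp p"
  shows "word_act p w h \<delta> r = 0"
proof -
  have "fold (gen_act p) gs h \<delta> r = 0" if "set gs \<subseteq> bc_gens p" "\<And>\<delta> r. \<delta> \<in> QZp p \<Longrightarrow> h \<delta> r = 0"
    for gs and h :: "rat \<Rightarrow> rat \<Rightarrow> 'r"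
    using that assms(3)
  proof (induction gs arbitrary: h \<delta> r)
    case (Cons g gs)
    then show ?case using gen_act_eq_0[of p h g] by simp
  qed simp
  then show ?thesis using assms by (simp add: word_act_def bc_words_def)
qed

lemma lin_word_act_shift:
  "lin (\<lambda>w. word_act p (u + w + v) h \<delta> r) x
    = word_act p v (\<lambda>\<delta> r. lin (\<lambda>w. word_act p w (word_act p u h) \<delta> r) x) \<delta> r"
  unfolding lin_def word_act_sum by (simp add: word_act_plus)

lemma frac_add_frac: "frac (x + frac y) = frac (x + y :: rat)" "frac (frac x + y) = frac (x + y :: rat)"
proof -
  show "frac (x + frac y) = frac (x + y)"
    by (rule frac_eq_if_int_diff[of _ _ "- \<lfloor>y\<rfloor>"]) (simp add: frac_def)
  show "frac (frac x + y) = frac (x + y)"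
    by (rule frac_eq_if_int_diff[of _ _ "- \<lfloor>x\<rfloor>"]) (simp add: frac_def)
qed

lemma frac_mult_frac: "frac (of_nat n * frac y) = frac (of_nat n * y :: rat)"
proof (rule frac_eq_if_int_diff)
  show "of_nat n * frac y - of_nat n * y = of_int (- int n * \<lfloor>y\<rfloor>)"
    by (simp add: frac_def algebra_simps)
qed

text \<open>Source and target both have n elements, so injectivity suffices; likewise in
  \<open>QZp_fibre_mult_coprime\<close>.\<close>

lemma QZp_fibre_translate:
  assumes \<gamma>: "\<gamma> \<in> QZp p" and \<delta>: "\<delta> \<in> QZp p" and n: "n \<in> Ip p"
  shows "bij_betw (\<lambda>x. frac (x + \<gamma>)) (QZp_fibre p n \<delta>) (QZp_fibre p n (frac (\<delta> + of_nat n * \<gamma>)))"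
proof -
  have inj: "inj_on (\<lambda>x. frac (x + \<gamma>)) (QZp_fibre p n \<delta>)"
  proof (rule inj_onI)
    fix x y assume xy: "x \<in> QZp_fibre p n \<delta>" "y \<in> QZp_fibre p n \<delta>" "frac (x + \<gamma>) = frac (y + \<gamma>)"
    have "frac (frac (x + \<gamma>) + (- \<gamma>)) = frac (frac (y + \<gamma>) + (- \<gamma>))" using xy by simp
    then have "frac x = frac y" unfolding frac_add_frac(2) by simp
    then show "x = y" using xy QZp_frac_id QZp_fibre_in by metis
  qed
  have sub: "(\<lambda>x. frac (x + \<gamma>)) ` QZp_fibre p n \<delta> \<subseteq> QZp_fibre p n (frac (\<delta> + of_nat n * \<gamma>))"
  proof (rule image_subsetI)
    fix x assume x: "x \<in> QZp_fibre p n \<delta>"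
    then have "frac (of_nat n * x) = \<delta>" by (simp add: QZp_fibre_def)
    then have "frac (of_nat n * frac (x + \<gamma>)) = frac (\<delta> + of_nat n * \<gamma>)"
      using frac_add_frac(2)[of "of_nat n * x" "of_nat n * \<gamma>"]
      by (simp add: frac_mult_frac distrib_left)
    then show "frac (x + \<gamma>) \<in> QZp_fibre p n (frac (\<delta> + of_nat n * \<gamma>))"
      using x \<gamma> by (simp add: QZp_fibre_def QZp_frac_add)
  qed
  have tgt: "frac (\<delta> + of_nat n * \<gamma>) \<in> QZp p"
    using QZp_frac_add[OF \<delta> QZp_frac_mult[OF \<gamma>, of n]] by (simp add: frac_add_frac)
  have "(\<lambda>x. frac (x + \<gamma>)) ` QZp_fibre p n \<delta> = QZp_fibre p n (frac (\<delta> + of_nat n * \<gamma>))"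
    by (rule card_subset_eq[OF finite_QZp_fibre[OF tgt n] sub])
      (simp add: card_image[OF inj] card_QZp_fibre tgt \<delta> n)
  then show ?thesis using inj by (simp add: bij_betw_def)
qed

lemma QZp_eq_if_coprime_multiples:
  assumes x: "x \<in> QZp p" "y \<in> QZp p" and nm: "coprime n m"
    and n: "frac (of_nat n * x) = frac (of_nat n * y)" and m: "frac (of_nat m * x) = frac (of_nat m * y)"
  shows "x = y"
proof -
  have int: "frac a = frac b \<Longrightarrow> \<exists>k. a - b = of_int k" for a b :: rat
    by (metis (no_types) add_diff_cancel_left' diff_diff_eq2 frac_def of_int_diff)
  obtain k l where k: "of_nat n * x - of_nat n * y = of_int k" and l: "of_nat m * x - of_nat m * y = of_int l"
    using int[OF n] int[OF m] by auto
  obtain u v where uv: "u * int n + v * int m = 1"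
    using bezout_int[of "int n" "int m"] nm by (metis coprime_int_iff coprime_iff_gcd_eq_1)
  have "x - y = of_int (u * int n + v * int m) * (x - y)" by (simp add: uv)
  also have "\<dots> = of_int u * (of_nat n * x - of_nat n * y) + of_int v * (of_nat m * x - of_nat m * y)"
    by (simp add: algebra_simps)
  also have "\<dots> = of_int (u * k + v * l)" by (simp add: k l)
  finally have "frac x = frac y" by (rule frac_eq_if_int_diff)
  then show ?thesis using x by (simp add: QZp_frac_id)
qed

lemma QZp_fibre_mult_coprime:
  assumes \<delta>: "\<delta> \<in> QZp p" and n: "n \<in> Ip p" and nm: "coprime n m"
  shows "bij_betw (\<lambda>x. frac (of_nat m * x)) (QZp_fibre p n \<delta>) (QZp_fibre p n (frac (of_nat m * \<delta>)))"
proof -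
  have inj: "inj_on (\<lambda>x. frac (of_nat m * x)) (QZp_fibre p n \<delta>)"
    by (rule inj_onI, rule QZp_eq_if_coprime_multiples[OF _ _ nm]) (auto simp: QZp_fibre_def)
  have sub: "(\<lambda>x. frac (of_nat m * x)) ` QZp_fibre p n \<delta> \<subseteq> QZp_fibre p n (frac (of_nat m * \<delta>))"
  proof (rule image_subsetI)
    fix x assume x: "x \<in> QZp_fibre p n \<delta>"
    have "frac (of_nat n * frac (of_nat m * x)) = frac (of_nat m * frac (of_nat n * x))"
      by (simp add: frac_mult_frac mult.left_commute)
    then show "frac (of_nat m * x) \<in> QZp_fibre p n (frac (of_nat m * \<delta>))"
      using x by (simp add: QZp_fibre_def QZp_frac_mult)
  qed
  have tgt: "frac (of_nat m * \<delta>) \<in> QZp p" by (rule QZp_frac_mult[OF \<delta>])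
  have "(\<lambda>x. frac (of_nat m * x)) ` QZp_fibre p n \<delta> = QZp_fibre p n (frac (of_nat m * \<delta>))"
    by (rule card_subset_eq[OF finite_QZp_fibre[OF tgt n] sub])
      (simp add: card_image[OF inj] card_QZp_fibre tgt \<delta> n)
  then show ?thesis using inj by (simp add: bij_betw_def)
qed

lemma sum_QZp_fibre_mult:
  fixes g :: "rat \<Rightarrow> 'r::comm_monoid_add"
  assumes \<delta>: "\<delta> \<in> QZp p" and n: "n \<in> Ip p" and m: "m \<in> Ip p"
  shows "(\<Sum>x\<in>QZp_fibre p n \<delta>. \<Sum>y\<in>QZp_fibre p m x. g y) = (\<Sum>y\<in>QZp_fibre p (n * m) \<delta>. g y)"
proof -
  have mult: "frac (of_nat (n * m) * y) = frac (of_nat n * frac (of_nat m * y))" for y :: rat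
    by (simp add: frac_mult_frac mult.assoc)
  have "y \<in> QZp_fibre p (n * m) \<delta> \<longleftrightarrow> (\<exists>x\<in>QZp_fibre p n \<delta>. y \<in> QZp_fibre p m x)" for y
    unfolding QZp_fibre_def mem_Collect_eq mult using QZp_frac_mult[of y p m] by blast
  then have "QZp_fibre p (n * m) \<delta> = (\<Union>x\<in>QZp_fibre p n \<delta>. QZp_fibre p m x)" by blast
  moreover have "(\<Sum>y\<in>(\<Union>x\<in>QZp_fibre p n \<delta>. QZp_fibre p m x). g y)
      = (\<Sum>x\<in>QZp_fibre p n \<delta>. \<Sum>y\<in>QZp_fibre p m x. g y)"
    by (rule sum.UNION_disjoint)
      (use finite_QZp_fibre[OF \<delta> n] finite_QZp_fibre[OF QZp_fibre_in m] in \<open>auto simp: QZp_fibre_def\<close>)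
  ultimately show ?thesis by simp
qed

lemma gens_product:
  "bc_e \<gamma> * bc_e \<delta> = Poly_Mapping.single (Word [Gen_e \<gamma>, Gen_e \<delta>]) 1"
  "bc_mu n * bc_mu m = Poly_Mapping.single (Word [Gen_mu n, Gen_mu m]) 1"
  "bc_mustar n * bc_mustar m = Poly_Mapping.single (Word [Gen_mustar n, Gen_mustar m]) 1"
  "bc_mustar n * bc_mu m = Poly_Mapping.single (Word [Gen_mustar n, Gen_mu m]) 1"
  "bc_mu n * bc_mustar m = Poly_Mapping.single (Word [Gen_mu n, Gen_mustar m]) 1"
  "bc_mustar n * bc_e \<gamma> = Poly_Mapping.single (Word [Gen_mustar n, Gen_e \<gamma>]) 1"
  "bc_e \<gamma> * bc_mustar n = Poly_Mapping.single (Word [Gen_e \<gamma>, Gen_mustar n]) 1"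
  "bc_mu n * bc_e \<gamma> = Poly_Mapping.single (Word [Gen_mu n, Gen_e \<gamma>]) 1"
  "bc_e \<gamma> * bc_mu n = Poly_Mapping.single (Word [Gen_e \<gamma>, Gen_mu n]) 1"
  "Poly_Mapping.single (Word [Gen_mu n, Gen_e \<gamma>]) 1 * bc_mustar m
    = Poly_Mapping.single (Word [Gen_mu n, Gen_e \<gamma>, Gen_mustar m]) 1"
  by (simp_all add: bc_e_def bc_mu_def bc_mustar_def mult_single plus_bc_word_def)

lemma lin_gens:
  "lin h (bc_e \<gamma>) = h (Word [Gen_e \<gamma>])"
  "lin h (bc_mu n) = h (Word [Gen_mu n])"
  "lin h (bc_mustar n) = h (Word [Gen_mustar n])"
  by (simp_all add: bc_e_def bc_mu_def bc_mustar_def)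

lemma lin_of_nat: "lin h (of_nat n) = of_nat n * h 0"
  using lin_const_mult[of h "of_nat n" 1] by (simp add: bc_const_of_nat)

text \<open>For each relation the two sides act in the same way.  After evaluation this is a reindexing of
  sums over fibres, or that a fibre has n elements.\<close>

lemma word_act_relator:
  fixes k :: "rat \<Rightarrow> rat \<Rightarrow> 'r::comm_ring_1"
  assumes R: "R \<in> bc_relators p" and \<delta>: "\<delta> \<in> QZp p"
  shows "lin (\<lambda>w. word_act p w k \<delta> r) R = 0"
  using R unfolding bc_relators_def
proof (elim UnE CollectE exE conjE)
  assume "R \<in> {bc_e 0 - 1}"
  then show ?thesis using \<delta> by (simp add: lin_diff lin_gens word_act_Word QZp_frac_id)
next
  fix \<gamma> \<epsilon> assume "R = bc_e \<gamma> * bc_e \<epsilon> - bc_e (frac (\<gamma> + \<epsilon>))"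
  then show ?thesis by (simp add: lin_diff lin_gens gens_product word_act_Word frac_add_frac add.assoc)
next
  fix n m assume *: "R = bc_mu (n * m) - bc_mu n * bc_mu m" "n \<in> Ip p" "m \<in> Ip p"
  have "(\<Sum>x\<in>QZp_fibre p (m * n) \<delta>. k x (r * (of_nat m * of_nat n)))
      = (\<Sum>x\<in>QZp_fibre p m \<delta>. \<Sum>y\<in>QZp_fibre p n x. k y (r * (of_nat m * of_nat n)))"
    by (rule sum_QZp_fibre_mult[symmetric]) (use * \<delta> in auto)
  then show ?thesis
    using * by (simp add: lin_diff lin_gens gens_product word_act_Word mult.assoc mult.commute[of n m]
        mult.commute[of "of_nat n" "of_nat m"])
next
  fix n m assume "R = bc_mustar (n * m) - bc_mustar n * bc_mustar m"
  then show ?thesis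
    by (simp add: lin_diff lin_gens gens_product word_act_Word frac_mult_frac mult.assoc mult.commute[of n m]
        mult.commute[of "of_nat n" "of_nat m"] mult.left_commute)
next
  fix n assume *: "R = bc_mustar n * bc_mu n - of_nat n" "n \<in> Ip p"
  have "(\<Sum>x\<in>QZp_fibre p n \<delta>. k (frac (of_nat n * x)) r) = (\<Sum>x\<in>QZp_fibre p n \<delta>. k \<delta> r)"
    by (rule sum.cong) (auto simp: QZp_fibre_def)
  also have "\<dots> = of_nat n * k \<delta> r" using * \<delta> by (simp add: card_QZp_fibre)
  finally show ?thesis
    using * by (simp add: lin_diff lin_of_nat gens_product word_act_Word Ip_def)
next
  fix n m assume *: "R = bc_mu n * bc_mustar m - bc_mustar m * bc_mu n" "n \<in> Ip p" "m \<in> Ip p" "coprime n m"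
  have "(\<Sum>x\<in>QZp_fibre p n (frac (of_nat m * \<delta>)). k x (r / of_nat m * of_nat n))
      = (\<Sum>x\<in>QZp_fibre p n \<delta>. k (frac (of_nat m * x)) (r / of_nat m * of_nat n))"
    by (rule sum.reindex_bij_betw[OF QZp_fibre_mult_coprime[OF \<delta>], symmetric]) (use * in auto)
  then show ?thesis
    using * by (simp add: lin_diff gens_product word_act_Word)
next
  fix n \<gamma>
  assume *: "R = bc_mu n * bc_e \<gamma> * bc_mustar n - (\<Sum>\<gamma>' \<in> {\<gamma>' \<in> QZp p. frac (of_nat n * \<gamma>') = \<gamma>}. bc_e \<gamma>')"
    "n \<in> Ip p" "\<gamma> \<in> QZp p"
  have "(\<Sum>x\<in>QZp_fibre p n (frac (\<gamma> + of_nat n * \<delta>)). k x r) = (\<Sum>x\<in>QZp_fibre p n \<gamma>. k (frac (x + \<delta>)) r)"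
    by (rule sum.reindex_bij_betw[OF QZp_fibre_translate, symmetric]) (use * \<delta> in auto)
  then show ?thesis
    using * by (simp add: lin_diff lin_sum lin_gens gens_product word_act_Word frac_add_frac QZp_fibre_def[symmetric] Ip_def)
next
  fix n \<gamma> assume "R = bc_mustar n * bc_e \<gamma> - bc_e (frac (of_nat n * \<gamma>)) * bc_mustar n"
  then show ?thesis
    by (simp add: lin_diff gens_product word_act_Word frac_add_frac frac_mult_frac distrib_left)
next
  fix n \<gamma> assume *: "R = bc_e \<gamma> * bc_mu n - bc_mu n * bc_e (frac (of_nat n * \<gamma>))" "n \<in> Ip p" "\<gamma> \<in> QZp p"
  have "(\<Sum>x\<in>QZp_fibre p n (frac (\<delta> + of_nat n * \<gamma>)). k x (r * of_nat n))
      = (\<Sum>x\<in>QZp_fibre p n \<delta>. k (frac (x + \<gamma>)) (r * of_nat n))"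
    by (rule sum.reindex_bij_betw[OF QZp_fibre_translate, symmetric]) (use * \<delta> in auto)
  then show ?thesis
    using * by (simp add: lin_diff gens_product word_act_Word frac_add_frac add.commute)
qed

text \<open>The functional that extracts the part of degree 1 and evaluates it by Z.\<close>

definition vacuum :: "(rat \<Rightarrow> 'r) \<Rightarrow> rat \<Rightarrow> rat \<Rightarrow> 'r::comm_ring_1" where
  "vacuum Z = (\<lambda>\<delta> r. if r = 1 then Z \<delta> else 0)"

definition bc_form :: "nat \<Rightarrow> (rat \<Rightarrow> 'r) \<Rightarrow> (bc_word \<Rightarrow>\<^sub>0 'r::comm_ring_1) \<Rightarrow> 'r" where
  "bc_form p Z x = lin (\<lambda>w. word_act p w (vacuum Z) 0 1) x"

lemma bc_form_add: "bc_form p Z (x + y) = bc_form p Z x + bc_form p Z y"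
  and bc_form_diff: "bc_form p Z (x - y) = bc_form p Z x - bc_form p Z y"
  and bc_form_const: "bc_form p Z (bc_const c * x) = c * bc_form p Z x"
  by (simp_all add: bc_form_def lin_add lin_diff lin_const_mult)

text \<open>J is the largest two-sided ideal on which the form vanishes.  It contains the relators since they act
  as 0 on every function, in particular on \<open>vacuum Z\<close> moved by a word u.\<close>

lemma bc_form_ideal:
  assumes "x \<in> bc_ideal p"
  shows "bc_form p Z x = 0"
proof -
  let ?h = "\<lambda>u v w. word_act p (u + w + v) (vacuum Z) 0 1"
  define J where "J = {x \<in> bc_elems p. \<forall>u\<in>bc_words p. \<forall>v\<in>bc_words p. lin (?h u v) x = 0}"
  have "bc_ideal p \<subseteq> J"
  proof (rule bc_ideal_minimal)
    show "x - y \<in> J" if "x \<in> J" "y \<in> J" for x y using that by (simp add: J_def lin_diff)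
    show "a * x \<in> J" if x: "x \<in> J" and a: "a \<in> bc_elems p" for x a
    proof -
      have "lin (?h u v) (a * x) = 0" if uv: "u \<in> bc_words p" "v \<in> bc_words p" for u v
      proof -
        have "lin (?h u v) (a * x) = lin (\<lambda>\<alpha>. lin (?h (u + \<alpha>) v) x) a"
          by (simp add: lin_mult add.assoc)
        also have "\<dots> = 0" using x uv by (intro lin_eq_0[OF _ a]) (simp add: J_def)
        finally show ?thesis .
      qed
      then show ?thesis using x a by (simp add: J_def)
    qed
    show "x * a \<in> J" if x: "x \<in> J" and a: "a \<in> bc_elems p" for x a
    proof -
      have "lin (?h u v) (x * a) = 0" if uv: "u \<in> bc_words p" "v \<in> bc_words p" for u v
      proof -
        have "lin (?h u v) (x * a) = lin (\<lambda>w. lin (\<lambda>\<alpha>. ?h u (\<alpha> + v) w) a) x"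
          by (simp add: lin_mult add.assoc)
        also have "\<dots> = lin (\<lambda>\<alpha>. lin (?h u (\<alpha> + v)) x) a" by (rule lin_swap)
        also have "\<dots> = 0" using x uv by (intro lin_eq_0[OF _ a]) (simp add: J_def)
        finally show ?thesis .
      qed
      then show ?thesis using x a by (simp add: J_def)
    qed
    show "bc_relators p \<subseteq> J"
    proof
      fix R :: "bc_word \<Rightarrow>\<^sub>0 'a" assume R: "R \<in> bc_relators p"
      have "lin (?h u v) R = 0" if "v \<in> bc_words p" for u v
        unfolding lin_word_act_shift
        by (rule word_act_eq_0[OF _ that QZp_0]) (rule word_act_relator[OF R])
      then show "R \<in> J" using R bc_relators_in by (auto simp: J_def)
    qed
  qed (auto simp: J_def)
  then have "x \<in> J" using assms by blast
  then have "\<forall>u\<in>bc_words p. \<forall>v\<in>bc_words p. lin (?h u v) x = 0"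
    unfolding J_def by blast
  then have "lin (?h 0 0) x = 0" using bc_words_0 by blast
  then show ?thesis by (simp add: bc_form_def)
qed

lemma bc_form_eqv: "bc_eqv p x y \<Longrightarrow> bc_form p Z x = bc_form p Z y"
  using bc_form_ideal[of "x - y" p Z] by (simp add: bc_eqv_def bc_form_diff)

section \<open>Rescaling automorphisms\<close>

definition rescale :: "(bc_word \<Rightarrow> 'r) \<Rightarrow> (bc_word \<Rightarrow>\<^sub>0 'r::comm_ring_1) \<Rightarrow> (bc_word \<Rightarrow>\<^sub>0 'r)" where
  "rescale \<kappa> x = Poly_Mapping.mapp (\<lambda>w c. \<kappa> w * c) x"

lemma lookup_rescale [simp]: "Poly_Mapping.lookup (rescale \<kappa> x) w = \<kappa> w * Poly_Mapping.lookup x w"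
  by (simp add: rescale_def lookup_mapp when_def in_keys_iff)

lemma rescale_add: "rescale \<kappa> (x + y) = rescale \<kappa> x + rescale \<kappa> y"
  by (rule poly_mapping_eqI) (simp add: lookup_add distrib_left)

lemma rescale_0 [simp]: "rescale \<kappa> 0 = 0"
  by (rule poly_mapping_eqI) simp

lemma rescale_diff: "rescale \<kappa> (x - y) = rescale \<kappa> x - rescale \<kappa> y"
  by (rule poly_mapping_eqI) (simp add: lookup_minus right_diff_distrib)

lemma rescale_sum: "rescale \<kappa> (sum g A) = (\<Sum>i\<in>A. rescale \<kappa> (g i))"
  by (induction A rule: infinite_finite_induct) (auto simp: rescale_add)

lemma rescale_single: "rescale \<kappa> (Poly_Mapping.single w c) = Poly_Mapping.single w (\<kappa> w * c)"
  by (rule poly_mapping_eqI) (simp add: lookup_single when_def)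

lemma rescale_in: "x \<in> bc_elems p \<Longrightarrow> rescale \<kappa> x \<in> bc_elems p"
proof -
  assume x: "x \<in> bc_elems p"
  have "Poly_Mapping.keys (rescale \<kappa> x) \<subseteq> Poly_Mapping.keys x"
    unfolding rescale_def by (rule keys_mapp_subset)
  then show ?thesis using x by (auto simp: bc_elems_def)
qed

lemma rescale_rescale: "rescale \<kappa> (rescale \<psi> x) = rescale (\<lambda>w. \<kappa> w * \<psi> w) x"
  by (rule poly_mapping_eqI) (simp add: mult.assoc)

lemma rescale_id: "(\<And>w. w \<in> bc_words p \<Longrightarrow> \<kappa> w = 1) \<Longrightarrow> x \<in> bc_elems p \<Longrightarrow> rescale \<kappa> x = x"
proof (rule poly_mapping_eqI)
  fix w assume one: "\<And>w. w \<in> bc_words p \<Longrightarrow> \<kappa> w = 1" and x: "x \<in> bc_elems p"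
  show "Poly_Mapping.lookup (rescale \<kappa> x) w = Poly_Mapping.lookup x w"
  proof (cases "w \<in> bc_words p")
    case False
    then have "w \<notin> Poly_Mapping.keys x" using x by (auto simp: bc_elems_def)
    then show ?thesis by (simp add: not_in_keys_iff_lookup_eq_zero)
  qed (simp add: one)
qed

text \<open>A system of scalars compatible with all relations: a character of the group of degrees
  \<open>b/a\<close>, evaluated on generators.\<close>

locale degree_char =
  fixes p :: nat and d :: "nat \<Rightarrow> 'r::comm_ring_1" and d' :: "nat \<Rightarrow> 'r"
  assumes d_mult: "n \<in> Ip p \<Longrightarrow> m \<in> Ip p \<Longrightarrow> d (n * m) = d n * d m"
    and d'_mult: "n \<in> Ip p \<Longrightarrow> m \<in> Ip p \<Longrightarrow> d' (n * m) = d' n * d' m"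
    and d_d': "n \<in> Ip p \<Longrightarrow> d n * d' n = 1"
begin

fun gen_weight :: "bc_gen \<Rightarrow> 'r" where
  "gen_weight (Gen_e \<gamma>) = 1"
| "gen_weight (Gen_mu n) = d' n"
| "gen_weight (Gen_mustar n) = d n"

definition weight :: "bc_word \<Rightarrow> 'r" where
  "weight w = prod_list (map gen_weight (letters w))"

lemma weight_0 [simp]: "weight 0 = 1"
  by (simp add: weight_def)

lemma weight_plus: "weight (u + v) = weight u * weight v"
  by (simp add: weight_def)

abbreviation twist :: "(bc_word \<Rightarrow>\<^sub>0 'r) \<Rightarrow> (bc_word \<Rightarrow>\<^sub>0 'r)" where
  "twist \<equiv> rescale weight"

lemma twist_1 [simp]: "twist 1 = 1"
  using rescale_single[of weight 0 1] by simp

lemma twist_const_mult: "twist (bc_const c * x) = bc_const c * twist x"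
  by (rule poly_mapping_eqI)
    (simp add: bc_const_def mult_map_scale_conv_mult[symmetric] map.rep_eq when_def mult.left_commute)

lemma twist_mult: "twist (x * y) = twist x * twist y"
proof -
  let ?s = "\<lambda>x w. Poly_Mapping.single w (Poly_Mapping.lookup x w)"
  have "x * y = (\<Sum>u\<in>Poly_Mapping.keys x. ?s x u) * (\<Sum>v\<in>Poly_Mapping.keys y. ?s y v)"
    using poly_mapping_sum_singles[of x] poly_mapping_sum_singles[of y] by simp
  also have "twist \<dots> = twist (\<Sum>u\<in>Poly_Mapping.keys x. ?s x u) * twist (\<Sum>v\<in>Poly_Mapping.keys y. ?s y v)"
    by (simp add: sum_product mult_single rescale_sum rescale_single weight_plus mult_ac)
  also have "\<dots> = twist x * twist y"
    by (simp only: poly_mapping_sum_singles[symmetric])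
  finally show ?thesis .
qed

lemma twist_gens:
  "twist (bc_e \<gamma>) = bc_e \<gamma>"
  "twist (bc_mu n) = bc_const (d' n) * bc_mu n"
  "twist (bc_mustar n) = bc_const (d n) * bc_mustar n"
  by (simp_all add: bc_e_def bc_mu_def bc_mustar_def rescale_single bc_const_mult_single weight_def)

lemma twist_of_nat: "twist (of_nat n) = of_nat n"
  using twist_const_mult[of "of_nat n" 1] by (simp add: bc_const_of_nat)

text \<open>All words in a relator have the same weight.\<close>

lemma twist_relator:
  assumes "R \<in> bc_relators p"
  shows "\<exists>c. twist R = bc_const c * R"
proof -
  note simps = rescale_diff rescale_sum rescale_single twist_of_nat weight_def bc_e_def bc_mu_def
    bc_mustar_def bc_const_mult_single right_diff_distrib sum_distrib_left
  from assms show ?thesis unfolding bc_relators_def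
  proof (elim UnE CollectE exE conjE)
    assume "R \<in> {bc_e 0 - 1}"
    then show ?thesis by (intro exI[of _ 1]) (simp add: simps)
  next
    fix \<gamma> \<epsilon> assume R: "R = bc_e \<gamma> * bc_e \<epsilon> - bc_e (frac (\<gamma> + \<epsilon>))"
    show ?thesis unfolding R gens_product by (intro exI[of _ 1]) (simp add: simps)
  next
    fix n m assume R: "R = bc_mu (n * m) - bc_mu n * bc_mu m" and "n \<in> Ip p" "m \<in> Ip p"
    then show ?thesis unfolding R gens_product
      by (intro exI[of _ "d' n * d' m"]) (simp add: simps d'_mult)
  next
    fix n m assume R: "R = bc_mustar (n * m) - bc_mustar n * bc_mustar m" and "n \<in> Ip p" "m \<in> Ip p"
    then show ?thesis unfolding R gens_product
      by (intro exI[of _ "d n * d m"]) (simp add: simps d_mult)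
  next
    fix n assume R: "R = bc_mustar n * bc_mu n - of_nat n" and "n \<in> Ip p"
    then show ?thesis unfolding R gens_product by (intro exI[of _ 1]) (simp add: simps d_d')
  next
    fix n m assume R: "R = bc_mu n * bc_mustar m - bc_mustar m * bc_mu n"
    show ?thesis unfolding R gens_product
      by (intro exI[of _ "d' n * d m"]) (simp add: simps mult.commute)
  next
    fix n \<gamma>
    assume R: "R = bc_mu n * bc_e \<gamma> * bc_mustar n - (\<Sum>\<gamma>' \<in> {\<gamma>' \<in> QZp p. frac (of_nat n * \<gamma>') = \<gamma>}. bc_e \<gamma>')"
      and n: "n \<in> Ip p"
    have "d' n * d n = 1" using d_d'[OF n] by (simp add: mult.commute)
    then show ?thesis unfolding R gens_product by (intro exI[of _ 1]) (simp add: simps)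
  next
    fix n \<gamma> assume R: "R = bc_mustar n * bc_e \<gamma> - bc_e (frac (of_nat n * \<gamma>)) * bc_mustar n"
    show ?thesis unfolding R gens_product by (intro exI[of _ "d n"]) (simp add: simps)
  next
    fix n \<gamma> assume R: "R = bc_e \<gamma> * bc_mu n - bc_mu n * bc_e (frac (of_nat n * \<gamma>))"
    show ?thesis unfolding R gens_product by (intro exI[of _ "d' n"]) (simp add: simps)
  qed
qed

lemma twist_ideal: "x \<in> bc_ideal p \<Longrightarrow> twist x \<in> bc_ideal p"
proof -
  define J where "J = {x \<in> bc_elems p. twist x \<in> bc_ideal p}"
  have "bc_ideal p \<subseteq> J"
  proof (rule bc_ideal_minimal)
    show "x - y \<in> J" if "x \<in> J" "y \<in> J" for x y
    proof -
      have "twist x + (- 1) * twist y \<in> bc_ideal p"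
        using that by (intro bc_ideal_add bc_ideal_l) (auto simp: J_def)
      then show ?thesis using that by (simp add: J_def rescale_diff)
    qed
    show "bc_relators p \<subseteq> J"
    proof
      fix R :: "bc_word \<Rightarrow>\<^sub>0 'r" assume R: "R \<in> bc_relators p"
      obtain c where c: "twist R = bc_const c * R" using twist_relator[OF R] by blast
      have "bc_const c * R \<in> bc_ideal p" by (intro bc_ideal_l bc_relators_ideal R) simp
      then show "R \<in> J" using R bc_relators_in c by (auto simp: J_def)
    qed
  qed (auto simp: J_def twist_mult bc_ideal_0 intro: bc_ideal_l bc_ideal_r rescale_in)
  then show "x \<in> bc_ideal p \<Longrightarrow> twist x \<in> bc_ideal p" by (auto simp: J_def)
qed

lemma twist_eqv: "bc_eqv p x y \<Longrightarrow> bc_eqv p (twist x) (twist y)"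
  using twist_ideal[of "x - y"] by (simp add: bc_eqv_def rescale_in rescale_diff)

lemma twist_mono: "twist (bc_mono a \<gamma> b) = bc_const (d' a * d b) * bc_mono a \<gamma> b"
  unfolding bc_mono_def gens_product by (simp add: rescale_single bc_const_mult_single weight_def)

end

section \<open>The KMS condition on the free algebra\<close>

lemma bc_mono_single: "bc_mono a \<gamma> b = Poly_Mapping.single (Word [Gen_mu a, Gen_e \<gamma>, Gen_mustar b]) 1"
  by (simp add: bc_mono_def gens_product)

lemma bc_form_single: "bc_form p Z (Poly_Mapping.single w 1) = word_act p w (vacuum Z) 0 1"
  by (simp add: bc_form_def)

lemma vacuum_quotient:
  assumes "a > 0" "b > 0" "r = of_nat a / of_nat b"
  shows "vacuum Z \<delta> r = (if a = b then Z \<delta> else 0)"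
proof -
  have "r = 1 \<longleftrightarrow> (of_nat a :: rat) = of_nat b" using assms by (auto simp: divide_eq_1_iff)
  then show ?thesis by (simp add: vacuum_def)
qed

lemma QZp_fibre_1: "\<gamma> \<in> QZp p \<Longrightarrow> QZp_fibre p 1 \<gamma> = {\<gamma>}"
  by (auto simp: QZp_fibre_def QZp_frac_id)

lemma bc_form_mono:
  assumes "a \<in> Ip p" "b \<in> Ip p" "\<gamma> \<in> QZp p" "coprime a b"
  shows "bc_form p Z (bc_mono a \<gamma> b) = (if a = 1 \<and> b = 1 then Z \<gamma> else 0)"
proof -
  have pos: "a > 0" "b > 0" using assms by (auto simp: Ip_def)
  have "bc_form p Z (bc_mono a \<gamma> b) = (\<Sum>\<delta>\<in>QZp_fibre p a \<gamma>. vacuum Z \<delta> (1 / of_nat b * of_nat a))"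
    using assms(3) by (simp add: bc_mono_single bc_form_single word_act_Word QZp_frac_id)
  also have "\<dots> = (\<Sum>\<delta>\<in>QZp_fibre p a \<gamma>. if a = b then Z \<delta> else 0)"
    using pos by (intro sum.cong refl vacuum_quotient) auto
  also have "\<dots> = (if a = 1 \<and> b = 1 then Z \<gamma> else 0)"
  proof (cases "a = b")
    case True
    then have "a = 1" "b = 1" using assms(4) by auto
    then show ?thesis using QZp_fibre_1[OF assms(3)] by simp
  qed auto
  finally show ?thesis .
qed

lemma coprime_eq_mult_iff: "coprime a b \<Longrightarrow> 0 < b \<Longrightarrow> a * n = b \<longleftrightarrow> a = 1 \<and> b = (n :: nat)"
  by (metis coprime_absorb_left dvd_triv_left mult_1 nat_dvd_1_iff_1)

lemma bc_form_e_mono: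
  assumes a: "a \<in> Ip p" and b: "b \<in> Ip p" and \<gamma>: "\<gamma> \<in> QZp p" and ab: "coprime a b" and \<delta>: "\<delta> \<in> QZp p"
  shows "bc_form p Z (bc_e \<delta> * bc_mono a \<gamma> b) = (if a = 1 \<and> b = 1 then Z (frac (\<gamma> + \<delta>)) else 0)"
    and "bc_form p Z (bc_mono a \<gamma> b * bc_e \<delta>) = (if a = 1 \<and> b = 1 then Z (frac (\<gamma> + \<delta>)) else 0)"
proof -
  have pos: "a > 0" "b > 0" using a b by (auto simp: Ip_def)
  have "bc_form p Z (bc_e \<delta> * bc_mono a \<gamma> b)
      = (\<Sum>x\<in>QZp_fibre p a \<gamma>. vacuum Z (frac (\<delta> + x)) (1 / of_nat b * of_nat a))"
    using \<gamma> by (simp add: bc_mono_single bc_e_def mult_single plus_bc_word_def bc_form_single word_act_Word QZp_frac_id)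
  also have "\<dots> = (\<Sum>x\<in>QZp_fibre p a \<gamma>. if a = b then Z (frac (\<delta> + x)) else 0)"
    using pos by (intro sum.cong refl vacuum_quotient) auto
  also have "\<dots> = (if a = 1 \<and> b = 1 then Z (frac (\<gamma> + \<delta>)) else 0)"
  proof (cases "a = b")
    case True
    then have "a = 1" "b = 1" using ab by auto
    then show ?thesis using QZp_fibre_1[OF \<gamma>] by (simp add: add.commute)
  qed auto
  finally show "bc_form p Z (bc_e \<delta> * bc_mono a \<gamma> b) = (if a = 1 \<and> b = 1 then Z (frac (\<gamma> + \<delta>)) else 0)" .
  have "bc_form p Z (bc_mono a \<gamma> b * bc_e \<delta>)
      = (\<Sum>x\<in>QZp_fibre p a (frac (\<gamma> + of_nat b * \<delta>)). vacuum Z x (1 / of_nat b * of_nat a))"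
    using \<delta> by (simp add: bc_mono_single bc_e_def mult_single plus_bc_word_def bc_form_single word_act_Word
        QZp_frac_id frac_add_frac)
  also have "\<dots> = (\<Sum>x\<in>QZp_fibre p a (frac (\<gamma> + of_nat b * \<delta>)). if a = b then Z x else 0)"
    using pos by (intro sum.cong refl vacuum_quotient) auto
  also have "\<dots> = (if a = 1 \<and> b = 1 then Z (frac (\<gamma> + \<delta>)) else 0)"
  proof (cases "a = b")
    case True
    then have "a = 1" "b = 1" using ab by auto
    then show ?thesis using QZp_fibre_1[OF QZp_frac_add[OF \<gamma> \<delta>]] by simp
  qed auto
  finally show "bc_form p Z (bc_mono a \<gamma> b * bc_e \<delta>) = (if a = 1 \<and> b = 1 then Z (frac (\<gamma> + \<delta>)) else 0)" .
qed

text \<open>The degree of the product is \<open>a n / b\<close>; with a and b coprime it is 1 only for \<open>a = 1\<close> and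
  \<open>b = n\<close>.\<close>

lemma bc_form_mu_mono:
  assumes a: "a \<in> Ip p" and b: "b \<in> Ip p" and \<gamma>: "\<gamma> \<in> QZp p" and ab: "coprime a b" and n: "n \<in> Ip p"
  shows "bc_form p Z (bc_mu n * bc_mono a \<gamma> b)
      = (if a = 1 \<and> b = n then \<Sum>\<delta>\<in>QZp_fibre p n \<gamma>. Z \<delta> else 0)"
    and "bc_form p Z (bc_mono a \<gamma> b * bc_mu n) = (if a = 1 \<and> b = n then of_nat n * Z \<gamma> else 0)"
proof -
  have pos: "a > 0" "b > 0" "n > 0" using a b n by (auto simp: Ip_def)
  note iff = coprime_eq_mult_iff[OF ab pos(2), of n]
  have "bc_form p Z (bc_mu n * bc_mono a \<gamma> b)
      = (\<Sum>x\<in>QZp_fibre p a \<gamma>. \<Sum>y\<in>QZp_fibre p n x. vacuum Z y (1 / of_nat b * of_nat a * of_nat n))"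
    using \<gamma> by (simp add: bc_mono_single bc_mu_def mult_single plus_bc_word_def bc_form_single word_act_Word QZp_frac_id)
  also have "\<dots> = (\<Sum>x\<in>QZp_fibre p a \<gamma>. \<Sum>y\<in>QZp_fibre p n x. if a * n = b then Z y else 0)"
    using pos by (intro sum.cong refl vacuum_quotient) auto
  also have "\<dots> = (if a = 1 \<and> b = n then \<Sum>\<delta>\<in>QZp_fibre p n \<gamma>. Z \<delta> else 0)"
    unfolding iff using QZp_fibre_1[OF \<gamma>] by (cases "a = 1 \<and> b = n") auto
  finally show "bc_form p Z (bc_mu n * bc_mono a \<gamma> b)
      = (if a = 1 \<and> b = n then \<Sum>\<delta>\<in>QZp_fibre p n \<gamma>. Z \<delta> else 0)" .
  have "bc_form p Z (bc_mono a \<gamma> b * bc_mu n)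
      = (\<Sum>y\<in>QZp_fibre p n 0. \<Sum>x\<in>QZp_fibre p a (frac (\<gamma> + frac (of_nat b * y))).
          vacuum Z x (of_nat n / of_nat b * of_nat a))"
    by (simp add: bc_mono_single bc_mu_def mult_single plus_bc_word_def bc_form_single word_act_Word)
  also have "\<dots> = (\<Sum>y\<in>QZp_fibre p n 0. \<Sum>x\<in>QZp_fibre p a (frac (\<gamma> + frac (of_nat b * y))).
          if a * n = b then Z x else 0)"
    using pos by (intro sum.cong refl vacuum_quotient) auto
  also have "\<dots> = (if a = 1 \<and> b = n then of_nat n * Z \<gamma> else 0)"
  proof (cases "a = 1 \<and> b = n")
    case True
    have "(\<Sum>y\<in>QZp_fibre p n 0. \<Sum>x\<in>QZp_fibre p 1 (frac (\<gamma> + frac (of_nat n * y))). Z x)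
        = (\<Sum>y\<in>QZp_fibre p n 0. Z \<gamma>)"
    proof (intro sum.cong refl)
      fix y assume "y \<in> QZp_fibre p n 0"
      then have "frac (of_nat n * y) = 0" by (simp only: QZp_fibre_def mem_Collect_eq)
      then have "frac (\<gamma> + frac (of_nat n * y)) = \<gamma>" by (simp only: add_0_right QZp_frac_id[OF \<gamma>])
      then show "(\<Sum>x\<in>QZp_fibre p 1 (frac (\<gamma> + frac (of_nat n * y))). Z x) = Z \<gamma>"
        by (simp only: QZp_fibre_1[OF \<gamma>]) simp
    qed
    then show ?thesis using True n by (simp add: card_QZp_fibre QZp_0)
  qed (auto simp: iff)
  finally show "bc_form p Z (bc_mono a \<gamma> b * bc_mu n) = (if a = 1 \<and> b = n then of_nat n * Z \<gamma> else 0)" .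
qed

lemma bc_form_mustar_mono:
  assumes a: "a \<in> Ip p" and b: "b \<in> Ip p" and \<gamma>: "\<gamma> \<in> QZp p" and ab: "coprime a b" and n: "n \<in> Ip p"
  shows "bc_form p Z (bc_mustar n * bc_mono a \<gamma> b) = (if b = 1 \<and> a = n then of_nat n * Z \<gamma> else 0)"
    and "bc_form p Z (bc_mono a \<gamma> b * bc_mustar n)
      = (if b = 1 \<and> a = n then \<Sum>\<delta>\<in>QZp_fibre p n \<gamma>. Z \<delta> else 0)"
proof -
  have pos: "a > 0" "b > 0" "n > 0" using a b n by (auto simp: Ip_def)
  have ba: "coprime b a" using ab by (simp add: coprime_commute)
  have iff: "a = b * n \<longleftrightarrow> b = 1 \<and> a = n" using coprime_eq_mult_iff[OF ba pos(1), of n] by blast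
  have "bc_form p Z (bc_mustar n * bc_mono a \<gamma> b)
      = (\<Sum>x\<in>QZp_fibre p a \<gamma>. vacuum Z (frac (of_nat n * x)) (1 / of_nat b * of_nat a / of_nat n))"
    using \<gamma> by (simp add: bc_mono_single bc_mustar_def mult_single plus_bc_word_def bc_form_single word_act_Word QZp_frac_id)
  also have "\<dots> = (\<Sum>x\<in>QZp_fibre p a \<gamma>. if a = b * n then Z (frac (of_nat n * x)) else 0)"
    using pos by (intro sum.cong refl vacuum_quotient) auto
  also have "\<dots> = (if b = 1 \<and> a = n then of_nat n * Z \<gamma> else 0)"
  proof (cases "b = 1 \<and> a = n")
    case True
    have "(\<Sum>x\<in>QZp_fibre p n \<gamma>. Z (frac (of_nat n * x))) = (\<Sum>x\<in>QZp_fibre p n \<gamma>. Z \<gamma>)"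
      by (intro sum.cong refl) (auto simp: QZp_fibre_def)
    then show ?thesis using True n \<gamma> by (simp add: card_QZp_fibre)
  qed (auto simp: iff)
  finally show "bc_form p Z (bc_mustar n * bc_mono a \<gamma> b) = (if b = 1 \<and> a = n then of_nat n * Z \<gamma> else 0)" .
  have "bc_form p Z (bc_mono a \<gamma> b * bc_mustar n)
      = (\<Sum>x\<in>QZp_fibre p a \<gamma>. vacuum Z x (1 / of_nat n / of_nat b * of_nat a))"
    using \<gamma> by (simp add: bc_mono_single bc_mustar_def mult_single plus_bc_word_def bc_form_single word_act_Word QZp_frac_id)
  also have "\<dots> = (\<Sum>x\<in>QZp_fibre p a \<gamma>. if a = b * n then Z x else 0)"
    using pos by (intro sum.cong refl vacuum_quotient) auto
  also have "\<dots> = (if b = 1 \<and> a = n then \<Sum>\<delta>\<in>QZp_fibre p n \<gamma>. Z \<delta> else 0)"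
    unfolding iff by auto
  finally show "bc_form p Z (bc_mono a \<gamma> b * bc_mustar n)
      = (if b = 1 \<and> a = n then \<Sum>\<delta>\<in>QZp_fibre p n \<gamma>. Z \<delta> else 0)" .
qed

text \<open>If the identity holds for all x with y and with y' in the second place, then
  \<open>\<phi>(x S(y) S(y')) = \<phi>(y' x S(y)) = \<phi>(y y' x)\<close>.\<close>

lemma bc_form_kms_induct:
  fixes S :: "(bc_word \<Rightarrow>\<^sub>0 'r) \<Rightarrow> (bc_word \<Rightarrow>\<^sub>0 'r::comm_ring_1)"
  assumes y: "y \<in> bc_elems p"
    and S_mult: "\<And>x y. S (x * y) = S x * S y" and S_add: "\<And>x y. S (x + y) = S x + S y"
    and S_const: "\<And>c x. S (bc_const c * x) = bc_const c * S x" and S_1: "S 1 = 1"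
    and S_in: "\<And>x. x \<in> bc_elems p \<Longrightarrow> S x \<in> bc_elems p"
    and gen: "\<And>g a b \<gamma>. g \<in> bc_gens p \<Longrightarrow> a \<in> Ip p \<Longrightarrow> b \<in> Ip p \<Longrightarrow> \<gamma> \<in> QZp p \<Longrightarrow> coprime a b \<Longrightarrow>
      bc_form p Z (bc_mono a \<gamma> b * S (Poly_Mapping.single (Word [g]) 1))
        = bc_form p Z (Poly_Mapping.single (Word [g]) 1 * bc_mono a \<gamma> b)"
  shows "\<forall>x\<in>bc_elems p. bc_form p Z (x * S y) = bc_form p Z (y * x)"
proof -
  have const_left: "x * (bc_const c * y) = bc_const c * (x * y)" for x y :: "bc_word \<Rightarrow>\<^sub>0 'r" and c
    by (simp add: mult.assoc[symmetric] bc_const_central)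
  have gen': "bc_form p Z (x * S (Poly_Mapping.single (Word [g]) 1)) = bc_form p Z (Poly_Mapping.single (Word [g]) 1 * x)"
    if g: "g \<in> bc_gens p" and x: "x \<in> bc_elems p" for g x
    using x
  proof (induction rule: bc_normal_form_induct)
    case (mono a b \<gamma>) then show ?case by (rule gen[OF g])
  next
    case (add x y) then show ?case by (simp add: distrib_left distrib_right bc_form_add)
  next
    case (scale x c) then show ?case by (simp add: mult.assoc const_left bc_form_const)
  next
    case (eqv x y)
    have "Poly_Mapping.single (Word [g]) 1 \<in> (bc_elems p :: (bc_word \<Rightarrow>\<^sub>0 'r) set)"
      using g by (intro bc_elems_single) (simp add: bc_words_def)
    then show ?case
      using eqv bc_form_eqv[OF eqv_mult_right[OF eqv(2)]] bc_form_eqv[OF eqv_mult_left[OF eqv(2)]] S_in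
      by metis
  qed
  have word: "\<forall>x\<in>bc_elems p. bc_form p Z (x * S (Poly_Mapping.single w 1)) = bc_form p Z (Poly_Mapping.single w 1 * x)"
    if "w \<in> bc_words p" for w
    using that
  proof (induction "letters w" arbitrary: w)
    case Nil
    then have "w = 0" by (cases w) (simp add: zero_bc_word_def)
    then show ?case by (simp add: S_1)
  next
    case (Cons g gs)
    let ?g = "Poly_Mapping.single (Word [g]) 1 :: bc_word \<Rightarrow>\<^sub>0 'r"
    let ?v = "Poly_Mapping.single (Word gs) 1 :: bc_word \<Rightarrow>\<^sub>0 'r"
    have w: "w = Word [g] + Word gs" using Cons(2) by (cases w) (simp add: plus_bc_word_def)
    then have single_w: "Poly_Mapping.single w 1 = ?g * ?v" by (simp add: mult_single)
    have g: "g \<in> bc_gens p" and gs: "Word gs \<in> bc_words p"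
      using Cons(3) w by (auto simp: bc_words_def)
    have v_in: "?v \<in> bc_elems p" and g_in: "?g \<in> bc_elems p"
      using gs g by (auto intro!: bc_elems_single simp: bc_words_def)
    show ?case
    proof
      fix x :: "bc_word \<Rightarrow>\<^sub>0 'r" assume x: "x \<in> bc_elems p"
      have "bc_form p Z (x * S (?g * ?v)) = bc_form p Z ((x * S ?g) * S ?v)"
        by (simp add: S_mult mult.assoc)
      also have "\<dots> = bc_form p Z (?v * (x * S ?g))"
        using Cons(1)[of "Word gs"] gs x S_in[OF g_in] by simp
      also have "\<dots> = bc_form p Z ((?v * x) * S ?g)" by (simp add: mult.assoc)
      also have "\<dots> = bc_form p Z (?g * (?v * x))" by (rule gen'[OF g]) (intro bc_elems_mult v_in x)
      finally show "bc_form p Z (x * S (Poly_Mapping.single w 1)) = bc_form p Z (Poly_Mapping.single w 1 * x)"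
        by (simp only: single_w mult.assoc)
    qed
  qed
  show ?thesis using y
  proof (induction rule: bc_elems_induct)
    case (add x y)
    then show ?case by (simp add: S_add distrib_left distrib_right bc_form_add)
  next
    case (single w c)
    have "Poly_Mapping.single w c = bc_const c * Poly_Mapping.single w 1"
      by (simp add: bc_const_mult_single)
    then show ?case using word[OF single] by (simp add: S_const const_left mult.assoc bc_form_const)
  qed
qed

section \<open>The KMS theorem\<close>

text \<open>The function induced on cosets by one that is constant on them, made extensional because the
  linear form and the automorphism are specified as extensional functions.\<close>

definition descend :: "nat \<Rightarrow> ((bc_word \<Rightarrow>\<^sub>0 'r::comm_ring_1) \<Rightarrow> 'b) \<Rightarrow> (bc_word \<Rightarrow>\<^sub>0 'r) set \<Rightarrow> 'b" where
  "descend p f = (\<lambda>X\<in>carrier (bc_algebra p). f (SOME x. x \<in> bc_elems p \<and> bc_cls p x = X))"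

lemma descend_extensional: "descend p f \<in> extensional (carrier (bc_algebra p))"
  by (simp add: descend_def)

lemma descend_cls:
  assumes f: "\<And>x y. bc_eqv p x y \<Longrightarrow> f x = f y" and x: "x \<in> bc_elems p"
  shows "descend p f (bc_cls p x) = f x"
proof -
  let ?P = "\<lambda>y. y \<in> bc_elems p \<and> bc_cls p y = bc_cls p x"
  have "?P (SOME y. ?P y)" by (rule someI[of ?P x]) (simp add: x)
  then have "bc_eqv p (SOME y. ?P y) x" using bc_cls_eq_iff[OF _ x] by blast
  then show ?thesis using x f by (auto simp: descend_def carrier_bc_algebra)
qed

lemma bc_mon_eq: "bc_mon p a \<gamma> b = bc_cls p (bc_mono a \<gamma> b)"
  by (simp add: bc_mon_def bc_mono_def)

lemma bc_algebra_cases: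
  assumes "X \<in> carrier (bc_algebra p)"
  obtains x where "x \<in> bc_elems p" "X = bc_cls p x"
  using assms by (auto simp: carrier_bc_algebra)

lemma bc_cls_in: "x \<in> bc_elems p \<Longrightarrow> bc_cls p x \<in> carrier (bc_algebra p)"
  by (simp add: carrier_bc_algebra)

context padic_complex
begin

lemma bc_form_is_kms_form:
  "is_kms_form p \<rho> (\<beta> :: 'c) (descend p (bc_form p (\<lambda>\<gamma>. Z_rho p \<rho> \<gamma> \<beta>)))" (is "is_kms_form p \<rho> \<beta> ?\<phi>")
proof -
  let ?F = "bc_form p (\<lambda>\<gamma>. Z_rho p \<rho> \<gamma> \<beta>)"
  have cls: "?\<phi> (bc_cls p x) = ?F x" if "x \<in> bc_elems p" for x
    by (rule descend_cls[OF bc_form_eqv that])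
  show ?thesis
    unfolding is_kms_form_def
  proof (intro conjI ballI allI impI)
    fix X Y :: "(bc_word \<Rightarrow>\<^sub>0 'c) set"
    assume "X \<in> carrier (bc_algebra p)" "Y \<in> carrier (bc_algebra p)"
    then show "?\<phi> (X \<oplus>\<^bsub>bc_algebra p\<^esub> Y) = ?\<phi> X + ?\<phi> Y"
      by (elim bc_algebra_cases) (simp add: bc_cls_add cls bc_form_add)
  next
    fix c and X :: "(bc_word \<Rightarrow>\<^sub>0 'c) set" assume "X \<in> carrier (bc_algebra p)"
    then show "?\<phi> (bc_scale p c X) = c * ?\<phi> X"
      by (elim bc_algebra_cases) (simp add: bc_scale_cls cls bc_form_const)
  next
    fix n m \<gamma> assume "n \<in> Ip p" "m \<in> Ip p" "\<gamma> \<in> QZp p" "coprime n m"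
    then show "?\<phi> (bc_mon p n \<gamma> m) = (if n = 1 \<and> m = 1 then Z_rho p \<rho> \<gamma> \<beta> else 0)"
      using bc_form_mono[of n p m \<gamma> "\<lambda>\<gamma>. Z_rho p \<rho> \<gamma> \<beta>"] by (simp only: bc_mon_eq cls mono_in)
  qed
qed

lemma kms_form_cls:
  assumes x: "x \<in> bc_elems p"
  shows "kms_form p \<rho> (\<beta> :: 'c) (bc_cls p x) = bc_form p (\<lambda>\<gamma>. Z_rho p \<rho> \<gamma> \<beta>) x"
proof -
  let ?\<phi> = "descend p (bc_form p (\<lambda>\<gamma>. Z_rho p \<rho> \<gamma> \<beta>))"
  have "kms_form p \<rho> \<beta> = ?\<phi>"
    unfolding kms_form_def
  proof (rule the_equality)
    show "?\<phi> \<in> extensional (carrier (bc_algebra p)) \<and> is_kms_form p \<rho> \<beta> ?\<phi>"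
      using bc_form_is_kms_form descend_extensional by blast
  next
    fix \<phi> assume "\<phi> \<in> extensional (carrier (bc_algebra p)) \<and> is_kms_form p \<rho> \<beta> \<phi>"
    then have ext: "\<phi> \<in> extensional (carrier (bc_algebra p))" and form: "is_kms_form p \<rho> \<beta> \<phi>" by auto
    have "\<phi> (bc_cls p x) = ?\<phi> (bc_cls p x)" if "x \<in> bc_elems p" for x
      using that
    proof (induction rule: bc_normal_form_induct)
      case (mono a b \<gamma>)
      then show ?case
        using form bc_form_is_kms_form[of \<rho> \<beta>] unfolding is_kms_form_def bc_mon_eq by metis
    next
      case (add x y)
      then show ?case
        using form bc_form_is_kms_form[of \<rho> \<beta>] bc_cls_in
        unfolding is_kms_form_def bc_cls_add[OF add(1,2), symmetric] by metis
    next
      case (scale x c)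
      then show ?case
        using form bc_form_is_kms_form[of \<rho> \<beta>] bc_cls_in
        unfolding is_kms_form_def bc_scale_cls[OF scale(1), symmetric] by metis
    next
      case (eqv x y)
      then show ?case using bc_cls_eq_iff[OF bc_eqvD[OF eqv(2)]] by simp
    qed
    then show "\<phi> = ?\<phi>"
      by (intro extensionalityI[OF ext descend_extensional]) (auto elim: bc_algebra_cases)
  qed
  then show ?thesis using descend_cls[OF bc_form_eqv x] by simp
qed

context
  fixes \<beta> :: 'c
  assumes \<beta>: "\<beta> \<in> padic_disc p"
begin

lemma rat_pow_mult:
  assumes "r \<in> unit_rat" "t \<in> unit_rat"
  shows "rat_pow p (r * t) \<beta> = rat_pow p r \<beta> * rat_pow p t \<beta>"
  using ang_pow_mult[OF padic_disc_diff[OF \<beta> one_in_padic_disc] assms]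
  by (simp add: rat_pow_eq of_rat_mult)

lemma degree_char_rat_pow:
  "degree_char p (\<lambda>n. rat_pow p (of_nat n) \<beta>) (\<lambda>n. rat_pow p (1 / of_nat n) \<beta>)"
proof
  fix n m assume n: "n \<in> Ip p" and m: "m \<in> Ip p"
  show "rat_pow p (of_nat (n * m)) \<beta> = rat_pow p (of_nat n) \<beta> * rat_pow p (of_nat m) \<beta>"
    using rat_pow_mult[OF unit_rat_of_nat[OF n] unit_rat_of_nat[OF m]] by simp
  show "rat_pow p (1 / of_nat (n * m)) \<beta> = rat_pow p (1 / of_nat n) \<beta> * rat_pow p (1 / of_nat m) \<beta>"
    using rat_pow_mult[OF unit_rat_inverse[OF n] unit_rat_inverse[OF m]] by simp
next
  fix n assume n: "n \<in> Ip p"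
  have "rat_pow p (of_nat n * (1 / of_nat n)) \<beta>
      = rat_pow p (of_nat n) \<beta> * rat_pow p (1 / of_nat n) \<beta>"
    by (rule rat_pow_mult[OF unit_rat_of_nat[OF n] unit_rat_inverse[OF n]])
  moreover have "of_nat n * (1 / of_nat n) = (1 :: rat)" using n by (simp add: Ip_def)
  ultimately show "rat_pow p (of_nat n) \<beta> * rat_pow p (1 / of_nat n) \<beta> = 1"
    by (simp add: rat_pow_eq)
qed

interpretation dc: degree_char p "\<lambda>n. rat_pow p (of_nat n) \<beta>" "\<lambda>n. rat_pow p (1 / of_nat n) \<beta>"
  by (rule degree_char_rat_pow)

interpretation inv: degree_char p "\<lambda>n. rat_pow p (1 / of_nat n) \<beta>" "\<lambda>n. rat_pow p (of_nat n) \<beta>"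
  using degree_char_rat_pow unfolding degree_char_def by (simp add: mult.commute)

lemma weight_inverse: "w \<in> bc_words p \<Longrightarrow> dc.weight w * inv.weight w = 1"
proof -
  have "prod_list (map dc.gen_weight gs) * prod_list (map inv.gen_weight gs) = 1"
    if "set gs \<subseteq> bc_gens p" for gs
    using that
  proof (induction gs)
    case (Cons g gs)
    have "dc.gen_weight g * inv.gen_weight g = 1"
      using Cons.prems dc.d_d' inv.d_d' by (auto simp: bc_gens_def)
    then show ?case using Cons by (simp add: mult_ac)
  qed simp
  then show "w \<in> bc_words p \<Longrightarrow> dc.weight w * inv.weight w = 1"
    by (simp add: dc.weight_def inv.weight_def bc_words_def)
qed

lemma twist_inverse:
  assumes "x \<in> bc_elems p"
  shows "dc.twist (inv.twist x) = x" "inv.twist (dc.twist x) = x"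
  unfolding rescale_rescale
  by (rule rescale_id[OF _ assms], simp add: weight_inverse mult.commute)+

abbreviation sigma_map :: "(bc_word \<Rightarrow>\<^sub>0 'c) set \<Rightarrow> (bc_word \<Rightarrow>\<^sub>0 'c) set" where
  "sigma_map \<equiv> descend p (\<lambda>x. bc_cls p (dc.twist x))"

lemma sigma_map_cls: "x \<in> bc_elems p \<Longrightarrow> sigma_map (bc_cls p x) = bc_cls p (dc.twist x)"
  by (rule descend_cls) (use dc.twist_eqv bc_cls_eq_iff bc_eqvD in blast)+

lemma sigma_map_iso: "sigma_map \<in> ring_iso (bc_algebra p) (bc_algebra p)"
proof (rule ring_iso_memI)
  show "bij_betw sigma_map (carrier (bc_algebra p)) (carrier (bc_algebra p))"
  proof (rule bij_betw_byWitness[where f' = "descend p (\<lambda>x. bc_cls p (inv.twist x))"])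
    have inv_cls: "descend p (\<lambda>x. bc_cls p (inv.twist x)) (bc_cls p x) = bc_cls p (inv.twist x)"
      if "x \<in> bc_elems p" for x
      by (rule descend_cls[OF _ that]) (use inv.twist_eqv bc_cls_eq_iff bc_eqvD in blast)
    show "\<forall>X\<in>carrier (bc_algebra p). descend p (\<lambda>x. bc_cls p (inv.twist x)) (sigma_map X) = X"
      by (auto simp: carrier_bc_algebra sigma_map_cls inv_cls rescale_in twist_inverse)
    show "\<forall>X\<in>carrier (bc_algebra p). sigma_map (descend p (\<lambda>x. bc_cls p (inv.twist x)) X) = X"
      by (auto simp: carrier_bc_algebra sigma_map_cls inv_cls rescale_in twist_inverse)
    show "sigma_map ` carrier (bc_algebra p) \<subseteq> carrier (bc_algebra p)"
      by (auto simp: carrier_bc_algebra sigma_map_cls rescale_in)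
    show "descend p (\<lambda>x. bc_cls p (inv.twist x)) ` carrier (bc_algebra p) \<subseteq> carrier (bc_algebra p)"
      by (auto simp: carrier_bc_algebra inv_cls rescale_in)
  qed
qed (auto elim!: bc_algebra_cases simp: sigma_map_cls bc_cls_in rescale_in bc_cls_mult bc_cls_add bc_cls_1
    dc.twist_mult rescale_add)

lemma rat_pow_quotient:
  assumes "a \<in> Ip p" "b \<in> Ip p"
  shows "rat_pow p (1 / of_nat a) \<beta> * rat_pow p (of_nat b) \<beta> = rat_pow p (of_nat b / of_nat a) \<beta>"
  using rat_pow_mult[OF unit_rat_inverse[OF assms(1)] unit_rat_of_nat[OF assms(2)]] by simp

lemma sigma_map_is_bc_sigma: "is_bc_sigma p \<beta> sigma_map"
  unfolding is_bc_sigma_def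
proof (intro conjI ballI allI sigma_map_iso)
  fix c and X :: "(bc_word \<Rightarrow>\<^sub>0 'c) set" assume "X \<in> carrier (bc_algebra p)"
  then show "sigma_map (bc_scale p c X) = bc_scale p c (sigma_map X)"
    by (elim bc_algebra_cases) (simp add: bc_scale_cls sigma_map_cls rescale_in dc.twist_const_mult)
next
  fix a b \<gamma> assume "a \<in> Ip p" "b \<in> Ip p" "\<gamma> \<in> QZp p"
  then show "sigma_map (bc_mon p a \<gamma> b)
      = bc_scale p (rat_pow p (of_nat b / of_nat a) \<beta>) (bc_mon p a \<gamma> b)"
    by (simp add: bc_mon_eq sigma_map_cls mono_in dc.twist_mono bc_scale_cls rat_pow_quotient)
qed

lemma bc_sigma_cls:
  assumes "x \<in> bc_elems p"
  shows "bc_sigma p \<beta> (bc_cls p x) = bc_cls p (dc.twist x)"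
proof -
  have "bc_sigma p \<beta> = sigma_map"
    unfolding bc_sigma_def
  proof (rule the_equality)
    show "sigma_map \<in> extensional (carrier (bc_algebra p)) \<and> is_bc_sigma p \<beta> sigma_map"
      using sigma_map_is_bc_sigma descend_extensional by blast
  next
    fix \<sigma> :: "(bc_word \<Rightarrow>\<^sub>0 'c) set \<Rightarrow> (bc_word \<Rightarrow>\<^sub>0 'c) set"
    assume "\<sigma> \<in> extensional (carrier (bc_algebra p)) \<and> is_bc_sigma p \<beta> \<sigma>"
    then have ext: "\<sigma> \<in> extensional (carrier (bc_algebra p))" and \<sigma>: "is_bc_sigma p \<beta> \<sigma>" by auto
    have hom: "\<sigma> \<in> ring_hom (bc_algebra p) (bc_algebra p)"
      using \<sigma> unfolding is_bc_sigma_def ring_iso_def by blast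
    have "\<sigma> (bc_cls p x) = sigma_map (bc_cls p x)" if "x \<in> bc_elems p" for x
      using that
    proof (induction rule: bc_normal_form_induct)
      case (mono a b \<gamma>)
      then show ?case
        using \<sigma> sigma_map_is_bc_sigma unfolding is_bc_sigma_def bc_mon_eq by metis
    next
      case (add x y)
      have "\<sigma> (bc_cls p (x + y)) = \<sigma> (bc_cls p x) \<oplus>\<^bsub>bc_algebra p\<^esub> \<sigma> (bc_cls p y)"
        using ring_hom_add[OF hom bc_cls_in[OF add(1)] bc_cls_in[OF add(2)]] add by (simp add: bc_cls_add)
      then show ?case using add by (simp add: sigma_map_cls rescale_in rescale_add bc_cls_add)
    next
      case (scale x c)
      have "\<sigma> (bc_cls p (bc_const c * x)) = bc_scale p c (\<sigma> (bc_cls p x))"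
        using \<sigma> bc_cls_in[OF scale(1)] unfolding is_bc_sigma_def bc_scale_cls[OF scale(1), symmetric] by blast
      then show ?case
        using scale by (simp add: sigma_map_cls rescale_in dc.twist_const_mult bc_scale_cls)
    next
      case (eqv x y)
      then show ?case using bc_cls_eq_iff[OF bc_eqvD[OF eqv(2)]] by simp
    qed
    then show "\<sigma> = sigma_map"
      by (intro extensionalityI[OF ext descend_extensional]) (auto elim: bc_algebra_cases)
  qed
  then show ?thesis using sigma_map_cls[OF assms] by simp
qed

text \<open>With \<open>n\<^sup>(\<^sup>\<beta>\<^sup>) = n \<langle>n\<rangle>\<^sup>\<beta>\<^sup>-\<^sup>1\<close> the distribution relation reads
  \<open>n\<^sup>(\<^sup>\<beta>\<^sup>) (\<Sum>\<delta>. Z \<delta>) = n Z \<gamma>\<close>; this is \<open>up\<close>, and \<open>down\<close> is the same after division by \<open>n\<^sup>(\<^sup>\<beta>\<^sup>)\<close>.\<close>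

lemma bc_form_kms:
  assumes \<beta>1: "\<beta> \<noteq> 1" and emb: "is_Qcyc_embedding p \<rho>" and x: "x \<in> bc_elems p" and y: "y \<in> bc_elems p"
  shows "bc_form p (\<lambda>\<gamma>. Z_rho p \<rho> \<gamma> \<beta>) (x * dc.twist y) = bc_form p (\<lambda>\<gamma>. Z_rho p \<rho> \<gamma> \<beta>) (y * x)"
proof -
  let ?Z = "\<lambda>\<gamma>. Z_rho p \<rho> \<gamma> \<beta>"
  have dist: "(\<Sum>\<delta>\<in>QZp_fibre p n \<gamma>. ?Z \<delta>) = ang_pow p (of_nat n) (1 - \<beta>) * ?Z \<gamma>"
    if "n \<in> Ip p" "\<gamma> \<in> QZp p" for n \<gamma>
    by (rule Z_rho_distribution[OF \<beta> \<beta>1 emb that(2,1)])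
  have ang: "ang_pow p (of_nat n) (\<beta> - 1) * ang_pow p (of_nat n) (1 - \<beta>) = 1" if "n \<in> Ip p" for n
  proof -
    have s: "\<beta> - 1 \<in> padic_disc p" "1 - \<beta> \<in> padic_disc p"
      using \<beta> one_in_padic_disc padic_disc_diff by auto
    have "padic_exp ((\<beta> - 1) * iwasawa_log p (of_nat n) + (1 - \<beta>) * iwasawa_log p (of_nat n)) = 
        padic_exp ((\<beta> - 1) * iwasawa_log p (of_nat n)) * padic_exp ((1 - \<beta>) * iwasawa_log p (of_nat n))"
      by (intro padic_exp_add vabs_mult_log_less s vabs_log_of_nat_le that)
    moreover have "(\<beta> - 1) * iwasawa_log p (of_nat n) + (1 - \<beta>) * iwasawa_log p (of_nat n) = 0"
      by (simp add: algebra_simps)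
    ultimately show ?thesis by (simp add: ang_pow_def)
  qed
  have up: "rat_pow p (of_nat n) \<beta> * (\<Sum>\<delta>\<in>QZp_fibre p n \<gamma>. ?Z \<delta>) = of_nat n * ?Z \<gamma>"
    if n: "n \<in> Ip p" and \<gamma>: "\<gamma> \<in> QZp p" for n \<gamma>
  proof -
    have "rat_pow p (of_nat n) \<beta> * (\<Sum>\<delta>\<in>QZp_fibre p n \<gamma>. ?Z \<delta>)
        = of_nat n * (ang_pow p (of_nat n) (\<beta> - 1) * ang_pow p (of_nat n) (1 - \<beta>)) * ?Z \<gamma>"
      by (simp add: dist[OF n \<gamma>] rat_pow_eq mult.assoc)
    then show ?thesis by (simp add: ang[OF n])
  qed
  have down: "rat_pow p (1 / of_nat n) \<beta> * (of_nat n * ?Z \<gamma>) = (\<Sum>\<delta>\<in>QZp_fibre p n \<gamma>. ?Z \<delta>)"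
    if n: "n \<in> Ip p" and \<gamma>: "\<gamma> \<in> QZp p" for n \<gamma>
  proof -
    have "rat_pow p (1 / of_nat n) \<beta> * (of_nat n * ?Z \<gamma>)
        = (rat_pow p (of_nat n) \<beta> * rat_pow p (1 / of_nat n) \<beta>) * (\<Sum>\<delta>\<in>QZp_fibre p n \<gamma>. ?Z \<delta>)"
      by (simp add: up[OF n \<gamma>, symmetric])
    then show ?thesis by (simp add: dc.d_d'[OF n])
  qed
  have "\<forall>x\<in>bc_elems p. bc_form p ?Z (x * dc.twist y) = bc_form p ?Z (y * x)"
  proof (rule bc_form_kms_induct[OF y])
    fix g a b \<gamma>
    assume g: "g \<in> bc_gens p" and ab: "a \<in> Ip p" "b \<in> Ip p" "\<gamma> \<in> QZp p" "coprime a b"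
    have const_left: "x * (bc_const c * y) = bc_const c * (x * y)" for x y :: "bc_word \<Rightarrow>\<^sub>0 'c" and c
      by (simp add: mult.assoc[symmetric] bc_const_central)
    from g show "bc_form p ?Z (bc_mono a \<gamma> b * dc.twist (Poly_Mapping.single (Word [g]) 1))
        = bc_form p ?Z (Poly_Mapping.single (Word [g]) 1 * bc_mono a \<gamma> b)"
      unfolding bc_gens_def
    proof (elim UnE imageE)
      fix \<delta> assume g: "g = Gen_e \<delta>" and \<delta>: "\<delta> \<in> QZp p"
      show ?thesis
        unfolding g bc_e_def[symmetric] dc.twist_gens bc_form_e_mono[OF ab \<delta>] ..
    next
      fix n assume g: "g = Gen_mu n" and n: "n \<in> Ip p"
      show ?thesis
        unfolding g bc_mu_def[symmetric] dc.twist_gens const_left bc_form_const bc_form_mu_mono[OF ab n]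
        using down[OF n ab(3)] by simp
    next
      fix n assume g: "g = Gen_mustar n" and n: "n \<in> Ip p"
      show ?thesis
        unfolding g bc_mustar_def[symmetric] dc.twist_gens const_left bc_form_const bc_form_mustar_mono[OF ab n]
        using up[OF n ab(3)] by simp
    qed
  qed (rule dc.twist_mult rescale_add dc.twist_const_mult dc.twist_1 | erule rescale_in)+
  then show ?thesis using x by blast
qed

end

end

theorem theorem7p11:
  fixes p :: nat
    and \<beta> :: "'c::complete_ultrametric_field"
    and \<rho> :: "complex \<Rightarrow> 'c"
  assumes "prime p"
    and "is_Cp p TYPE('c)"
    and "\<beta> \<in> padic_disc p"
    and "\<beta> \<noteq> 1"
    and "is_Qcyc_embedding p \<rho>"
  shows "(\<forall>x \<in> carrier (bc_algebra p). \<forall>y \<in> carrier (bc_algebra p).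
            kms_form p \<rho> \<beta> (x \<otimes>\<^bsub>bc_algebra p\<^esub> bc_sigma p \<beta> y)
              = kms_form p \<rho> \<beta> (y \<otimes>\<^bsub>bc_algebra p\<^esub> x))
       \<and> partition_fun p \<rho> \<beta> = Lp_trivial p \<beta>
       \<and> Lp_trivial p \<beta> \<noteq> 0"
proof -
  interpret padic_complex p "TYPE('c)"
    using assms(2) by unfold_locales (auto simp: is_Cp_def)
  have "kms_form p \<rho> \<beta> (X \<otimes>\<^bsub>bc_algebra p\<^esub> bc_sigma p \<beta> Y) = kms_form p \<rho> \<beta> (Y \<otimes>\<^bsub>bc_algebra p\<^esub> X)"
    if X: "X \<in> carrier (bc_algebra p)" and Y: "Y \<in> carrier (bc_algebra p)" for X Y :: "(bc_word \<Rightarrow>\<^sub>0 'c) set"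
  proof -
    obtain x where x: "x \<in> bc_elems p" "X = bc_cls p x" using X by (rule bc_algebra_cases)
    obtain y where y: "y \<in> bc_elems p" "Y = bc_cls p y" using Y by (rule bc_algebra_cases)
    show ?thesis
      using bc_form_kms[OF assms(3-5) x(1) y(1)] x(1) y(1)
      by (simp add: x(2) y(2) bc_sigma_cls[OF assms(3)] bc_cls_mult kms_form_cls rescale_in)
  qed
  moreover have "partition_fun p \<rho> \<beta> = Lp_trivial p \<beta>"
  proof -
    have "partition_fun p \<rho> \<beta> = bc_form p (\<lambda>\<gamma>. Z_rho p \<rho> \<gamma> \<beta>) 1"
      by (simp add: partition_fun_def bc_cls_1 kms_form_cls)
    also have "\<dots> = Z_rho p \<rho> 0 \<beta>" by (simp add: bc_form_def vacuum_def)
    finally show ?thesis by (simp only: Z_rho_0_eq_Lp[OF assms(3-5)])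
  qed
  ultimately show ?thesis using Lp_trivial_nonzero[OF assms(3,4)] by blast
qed

end
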